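(* For each integer $n\geq 0$ let $$\eta^{(n)}=n!\sum_{k=1}^{\infty}\frac{(-1)^{k+1}}{k^{n}\cdot k!}.$$ Then the numbers $\{\eta^{(n)}\}_{n\geq 0}$ are algebraically independent over $\overline{\mathbb{Q}}$ (i.e., for every $m\geq 0$, the numbers $\eta^{(0)},\eta^{(1)},\ldots,\eta^{(m)}$ satisfy no nontrivial polynomial relation with coefficients in $\overline{\mathbb{Q}}$). In particular, $\eta^{(n)}\in\mathbb{R}\setminus\overline{\mathbb{Q}}$ (i.e., $\eta^{(n)}$ is transcendental) for all $n\in\mathbb{Z}_{\geq 0}$.
   Context: $\overline{\mathbb{Q}}$ denotes the field of algebraic numbers. Equivalently, $\eta^{(n)}=\int_0^\infty x^n\exp(-x-e^{-x})\,dx$. *)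

theory Defs
  imports Complex_Main "HOL-Computational_Algebra.Polynomial" "HOL-Library.Poly_Mapping"
begin

definition eta :: "nat \<Rightarrow> real" where
  "eta n = fact n * suminf (\<lambda>j. (- 1) ^ (Suc j + 1) / (real (Suc j) ^ n * fact (Suc j)))"

lemma eta_sums:
  "(\<lambda>j. (- 1) ^ (Suc j + 1) / (real (Suc j) ^ n * fact (Suc j))) sums (eta n / fact n)"
proof -
  have s: "summable (\<lambda>j. inverse (fact j) :: real)"
    using summable_exp[of "1::real"] by simp
  have "norm ((- 1) ^ (Suc j + 1) / (real (Suc j) ^ n * fact (Suc j))) \<le> inverse (fact j)" for j
  proof -
    have "1 * fact j \<le> real (Suc j) ^ n * fact (Suc j)"
      by (intro mult_mono one_le_power fact_mono) auto
    then have "inverse (real (Suc j) ^ n * fact (Suc j)) \<le> inverse (fact j)"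
      by (intro le_imp_inverse_le) (simp_all del: fact_Suc of_nat_Suc)
    then show ?thesis
      by (simp add: abs_mult power_abs divide_inverse del: fact_Suc of_nat_Suc)
  qed
  then have "summable (\<lambda>j. (- 1) ^ (Suc j + 1) / (real (Suc j) ^ n * fact (Suc j)))"
    by (intro summable_comparison_test'[OF s, of 0])
  then show ?thesis
    by (simp add: eta_def summable_sums del: fact_Suc of_nat_Suc)
qed

text \<open>
  The polynomial ring over \<open>'a\<close> in variables indexed by \<open>'i\<close> is modelled by finitely supported
  maps from monomials to coefficients, a monomial being a finitely supported map from variables
  to exponents. Each such polynomial involves only finitely many variables, also when \<open>'i\<close> is
  infinite.
\<close>

type_synonym ('i, 'a) mpolynomial = "('i \<Rightarrow>\<^sub>0 nat) \<Rightarrow>\<^sub>0 'a"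

definition mpolynomial_vars :: "('i, 'a::zero) mpolynomial \<Rightarrow> 'i set" where
  "mpolynomial_vars p = (\<Union>m \<in> Poly_Mapping.keys p. Poly_Mapping.keys m)"

definition mpolynomial_eval :: "('i \<Rightarrow> 'a::comm_ring_1) \<Rightarrow> ('i, 'a) mpolynomial \<Rightarrow> 'a" where
  "mpolynomial_eval x p =
     (\<Sum>m \<in> Poly_Mapping.keys p. Poly_Mapping.lookup p m *
        (\<Prod>i \<in> Poly_Mapping.keys m. x i ^ Poly_Mapping.lookup m i))"

definition algebraically_independent_over ::
    "'a::field set \<Rightarrow> ('i \<Rightarrow> 'a) \<Rightarrow> 'i set \<Rightarrow> bool" where
  "algebraically_independent_over K x I \<longleftrightarrow>
     (\<forall>p :: ('i, 'a) mpolynomial.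
        (\<forall>m. Poly_Mapping.lookup p m \<in> K) \<longrightarrow> mpolynomial_vars p \<subseteq> I \<longrightarrow>
        mpolynomial_eval x p = 0 \<longrightarrow> p = 0)"

lemma algebraically_independent_over_UNIV_iff:
  fixes x :: "nat \<Rightarrow> 'a::field"
  shows "algebraically_independent_over K x UNIV \<longleftrightarrow>
    (\<forall>m. algebraically_independent_over K x {0..m})"
proof -
  have "\<exists>m. mpolynomial_vars p \<subseteq> {0..m}" for p :: "(nat, 'a) mpolynomial"
  proof -
    have "finite (mpolynomial_vars p)"
      by (simp add: mpolynomial_vars_def)
    then show ?thesis
      by (metis atLeast0AtMost finite_nat_iff_bounded_le)
  qed
  then show ?thesis
    unfolding algebraically_independent_over_def by blast
qed

definition algebraic_numbers :: "complex set" where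
  "algebraic_numbers = {z. algebraic z}"

end

theory Submission
  imports Defs "Jordan_Normal_Form.Determinant" "HOL-Analysis.FPS_Convergence" "HOL-Computational_Algebra.Field_as_Ring"
begin

text \<open>
  With \<open>\<theta> = z d/dz\<close>, the series \<open>f\<^sub>k = \<Sum> (-1)\<^sup>l\<^sup>+\<^sup>1 z\<^sup>l / (l\<^sup>k l!)\<close> satisfy
  \<open>\<theta> f\<^sub>k\<^sub>+\<^sub>1 = f\<^sub>k\<close>, and \<open>f\<^sub>0 = 1 - exp (-z)\<close>; so the monomials of bounded degree in \<open>exp (-z), f\<^sub>1, \<dots>, f\<^sub>m\<close>
  solve a linear system \<open>\<theta> w = (A\<^sub>0 + z A\<^sub>1) w\<close> with \<open>A\<^sub>0\<close> strictly triangular and \<open>A\<^sub>1\<close> diagonal. The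
  Siegel--Shidlovskii method shows that their values at 1 are linearly independent over the
  rationals. Shidlovskii's lemma is elementary for such systems: the coefficients of the derivatives
  of a linear form span a space of polynomial vectors stable under the adjoint derivation, and the
  ratios of its maximal minors solve \<open>\<theta> u = k z u + s\<close> recursively. Rational solutions of this
  equation are constant, so the space has a basis of constant vectors.

  A relation with algebraic coefficients gives one with integer coefficients: the coefficients act
  by rational matrices on a finitely generated module, and the determinant of the resulting matrix
  of polynomials vanishes at the given point.
\<close>

hide_const (open) Module.smult Finite_Cartesian_Product.mat Finite_Cartesian_Product.vec
subsection \<open>Determinants\<close>

text \<open>The contradiction is a count of factorials. For M monomials, the auxiliary form has
  coefficients of degree at most n = (M + 1) s and vanishes to order L = M n - s. The given relation
  and M - 1 iterated derivatives of the form at 1 make up a nonzero integer determinant. Up to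
  factors exponential in s, the entries of the derivative rows have size n! s!. Since 1 is among the
  monomials, one column can be replaced by the values of the forms, which gain the factor 1 / L! and
  are 0 in the row of the relation. So (n! s!)^(M-1) / L! cannot be small; but L = (M - 1) n + M s
  makes it at most 1 / s!. With n = M s no factor s! would remain, which explains M + 1. All other
  losses must be exponential in s: this dictates lcm(1, ..., l) as the measure of denominators and
  forces the number of derivatives to be s + O(1), which is where the nonvanishing determinant of
  the zero estimate enters. The condition used in place of linear independence over the rational
  functions is that a nonzero stable space of constant vectors contains a form with nonzero constant
  term.\<close>

text \<open>Matrices are entered as functions of two indices: replacing a row or a column is then a
  plain \<open>if\<close> or a function update, without carrier conditions.\<close>

definition dt :: "nat \<Rightarrow> (nat \<Rightarrow> nat \<Rightarrow> 'a::comm_ring_1) \<Rightarrow> 'a" where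
  "dt n f = det (mat n n (\<lambda>(i, j). f i j))"

text \<open>The adjugate: the two indices are swapped against \<open>cofactor\<close>, so that the
  product with \<open>f\<close> on either side is \<open>dt n f\<close> times the identity.\<close>

definition adj :: "nat \<Rightarrow> (nat \<Rightarrow> nat \<Rightarrow> 'a::comm_ring_1) \<Rightarrow> nat \<Rightarrow> nat \<Rightarrow> 'a" where
  "adj n f i k = cofactor (mat n n (\<lambda>(i, j). f i j)) k i"

lemma dt_leibniz:
  "dt n f = (\<Sum>p | p permutes {..<n}. of_int (sign p) * (\<Prod>i<n. f i (p i)))"
proof -
  have "(\<Prod>i<n. mat n n (\<lambda>(i, j). f i j) $$ (i, p i)) = (\<Prod>i<n. f i (p i))"
    if "p permutes {..<n}" for p
    using permutes_in_image[OF that] by (intro prod.cong) auto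
  then show ?thesis
    by (simp add: dt_def det_def atLeast0LessThan)
qed

lemma dt_cong: "(\<And>i j. i < n \<Longrightarrow> j < n \<Longrightarrow> f i j = g i j) \<Longrightarrow> dt n f = dt n g"
  unfolding dt_def by (intro arg_cong[of _ _ det] eq_matI) auto

lemma dt_expand_col:
  assumes "j < n"
  shows "dt n f = (\<Sum>i<n. f i j * adj n f j i)"
  unfolding dt_def adj_def
  by (subst laplace_expansion_column[OF mat_carrier assms], rule sum.cong) (use assms in simp_all)

lemma dt_expand_row:
  assumes "i < n"
  shows "dt n f = (\<Sum>j<n. f i j * adj n f j i)"
  unfolding dt_def adj_def
  by (subst laplace_expansion_row[OF mat_carrier assms], rule sum.cong) (use assms in simp_all)

lemma dt_eq_rows:
  assumes "i \<noteq> j" "i < n" "j < n" "\<And>k. k < n \<Longrightarrow> f i k = f j k"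
  shows "dt n f = 0"
  unfolding dt_def using assms by (intro Determinant.det_identical_rows[of _ n i j]) auto

lemma dt_eq_cols:
  assumes "i \<noteq> j" "i < n" "j < n" "\<And>k. k < n \<Longrightarrow> f k i = f k j"
  shows "dt n f = 0"
  unfolding dt_def using assms by (intro Determinant.det_identical_columns[of _ n i j]) auto

lemma adj_upd_col:
  assumes "i < n" "k < n"
  shows "adj n (\<lambda>a j. if j = i then b a else f a j) i k = adj n f i k"
  unfolding adj_def cofactor_def mat_delete_def using assms
  by (intro arg_cong2[of _ _ _ _ "(*)"] arg_cong[of _ _ det] refl eq_matI) auto

lemma adj_upd_row:
  assumes "i < n" "k < n"
  shows "adj n (\<lambda>a. if a = k then b else f a) i k = adj n f i k"
  unfolding adj_def cofactor_def mat_delete_def using assms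
  by (intro arg_cong2[of _ _ _ _ "(*)"] arg_cong[of _ _ det] refl eq_matI) auto

text \<open>Cramer's rule: the cofactors along column \<open>i\<close> do not depend on column
  \<open>i\<close>, so any vector \<open>b\<close> may be put there before expanding.\<close>

lemma adj_mult_col:
  assumes "i < n"
  shows "(\<Sum>k<n. adj n f i k * b k) = dt n (\<lambda>a j. if j = i then b a else f a j)"
  by (subst dt_expand_col[OF assms]) (use assms in \<open>simp add: adj_upd_col mult.commute\<close>)

lemma row_mult_adj:
  assumes "k < n"
  shows "(\<Sum>i<n. b i * adj n f i k) = dt n (\<lambda>a. if a = k then b else f a)"
  by (subst dt_expand_row[OF assms]) (use assms in \<open>simp add: adj_upd_row\<close>)

lemma adj_mult:
  assumes "i < n" "j < n"
  shows "(\<Sum>k<n. adj n f i k * f k j) = (if i = j then dt n f else 0)"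
proof (cases "i = j")
  case True
  then show ?thesis
    using assms dt_expand_col[of j n f] by (simp add: mult.commute)
next
  case False
  then show ?thesis
    using assms by (subst adj_mult_col) (auto intro!: dt_eq_cols[of i j])
qed

lemma mult_adj:
  assumes "i < n" "j < n"
  shows "(\<Sum>k<n. f i k * adj n f k j) = (if i = j then dt n f else 0)"
proof (cases "i = j")
  case True
  then show ?thesis
    using assms dt_expand_row[of j n f] by simp
next
  case False
  then show ?thesis
    using assms by (subst row_mult_adj) (auto intro!: dt_eq_rows[of i j])
qed

lemma dt_eq_0_iff_rows_dependent:
  fixes f :: "nat \<Rightarrow> nat \<Rightarrow> 'a::idom"
  shows "dt n f = 0 \<longleftrightarrow> (\<exists>c. (\<exists>i<n. c i \<noteq> 0) \<and> (\<forall>j<n. (\<Sum>i<n. c i * f i j) = 0))"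
proof -
  let ?A = "mat n n (\<lambda>(i, j). f i j)"
  \<comment> \<open>The fact about vanishing determinants concerns combinations of columns, hence
    the transpose.\<close>
  have "dt n f = det (transpose_mat ?A)"
    unfolding dt_def by (subst det_transpose[of _ n]) auto
  then have eq: "dt n f = 0 \<longleftrightarrow>
      (\<exists>v. v \<in> carrier_vec n \<and> v \<noteq> 0\<^sub>v n \<and> transpose_mat ?A *\<^sub>v v = 0\<^sub>v n)"
    by (simp add: det_0_iff_vec_prod_zero[of _ n])
  show ?thesis
    unfolding eq
  proof safe
    fix v assume v: "v \<in> carrier_vec n" "v \<noteq> 0\<^sub>v n" and "transpose_mat ?A *\<^sub>v v = 0\<^sub>v n"
    then have "vec_index (transpose_mat ?A *\<^sub>v v) j = 0" if "j < n" for j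
      using that by simp
    then have "\<forall>j<n. (\<Sum>i<n. vec_index v i * f i j) = 0"
      using v by (auto simp: scalar_prod_def atLeast0LessThan mult.commute intro!: sum.cong)
    moreover have "\<exists>i<n. vec_index v i \<noteq> 0"
      using v by (metis carrier_vecD eq_vecI index_zero_vec)
    ultimately show "\<exists>c. (\<exists>i<n. c i \<noteq> 0) \<and> (\<forall>j<n. (\<Sum>i<n. c i * f i j) = 0)"
      by (intro exI[of _ "vec_index v"]) auto
  next
    fix c i assume c: "\<forall>j<n. (\<Sum>i<n. c i * f i j) = 0" "i < n" "c i \<noteq> 0"
    then show "\<exists>v. v \<in> carrier_vec n \<and> v \<noteq> 0\<^sub>v n \<and> transpose_mat ?A *\<^sub>v v = 0\<^sub>v n"
    proof (intro exI[of _ "vec n c"] conjI)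
      show "vec n c \<noteq> 0\<^sub>v n"
        using c by (metis index_vec index_zero_vec(1))
      show "transpose_mat ?A *\<^sub>v vec n c = 0\<^sub>v n"
        using c by (intro eq_vecI) (auto simp: scalar_prod_def atLeast0LessThan mult.commute)
    qed auto
  qed
qed

lemma dt_row_sum:
  assumes "k < n"
  shows "dt n (\<lambda>i. if i = k then (\<lambda>j. \<Sum>s\<in>S. c s * b s j) else f i) =
    (\<Sum>s\<in>S. c s * dt n (\<lambda>i. if i = k then b s else f i))"
proof -
  have "(\<Sum>i<n. (\<Sum>s\<in>S. c s * b s i) * adj n f i k) = (\<Sum>s\<in>S. \<Sum>i<n. c s * b s i * adj n f i k)"
    unfolding sum_distrib_right by (rule sum.swap)
  then show ?thesis
    unfolding row_mult_adj[OF assms, symmetric] by (simp add: sum_distrib_left mult.assoc)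
qed

lemma degree_dt_le:
  assumes "\<And>i j. i < n \<Longrightarrow> j < n \<Longrightarrow> degree (f i j) \<le> k"
  shows "degree (dt n f) \<le> k * n"
  unfolding dt_def using assms by (intro degree_det_le) auto

lemma (in comm_ring_hom) hom_dt: "hom (dt n f) = dt n (\<lambda>i j. hom (f i j))"
  unfolding dt_def hom_det[symmetric] by (intro arg_cong[of _ _ det] eq_matI) auto

lemma adj_last: "adj (Suc r) f r r = dt r f"
  unfolding adj_def cofactor_def dt_def
  by (simp, intro arg_cong[of _ _ det] eq_matI) (auto simp: mat_delete_def)

text \<open>Bordering: the cofactors along a new last column form a combination of the rows whose
  last coefficient is the minor already found; at a column where this combination is nonzero, the
  bordered minor is nonzero.\<close>

lemma exists_minor_nonzero:
  fixes P :: "nat \<Rightarrow> nat \<Rightarrow> 'a::idom"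
  assumes "\<And>c. \<exists>k<r. c k \<noteq> 0 \<Longrightarrow> \<exists>i<M. (\<Sum>k<r. c k * P k i) \<noteq> 0"
  shows "\<exists>\<nu>. (\<forall>j<r. \<nu> j < M) \<and> dt r (\<lambda>k j. P k (\<nu> j)) \<noteq> 0"
  using assms
proof (induction r)
  case 0
  then show ?case
    by (simp add: dt_def)
next
  case (Suc r)
  have "\<exists>i<M. (\<Sum>k<r. c k * P k i) \<noteq> 0" if "\<exists>k<r. c k \<noteq> 0" for c
  proof -
    have "\<exists>k<Suc r. (c(r := 0)) k \<noteq> 0"
      using that less_SucI by fastforce
    from Suc.prems[OF this] show ?thesis
      by auto
  qed
  from Suc.IH[OF this] obtain \<nu> where \<nu>: "\<forall>j<r. \<nu> j < M" "dt r (\<lambda>k j. P k (\<nu> j)) \<noteq> 0"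
    by blast
  define c where "c = adj (Suc r) (\<lambda>k j. P k (\<nu> j)) r"
  have "c r \<noteq> 0"
    using \<nu> by (simp add: c_def adj_last)
  then obtain i where i: "i < M" "(\<Sum>k<Suc r. c k * P k i) \<noteq> 0"
    using Suc.prems[of c] by blast
  have "(\<Sum>k<Suc r. c k * P k i) = dt (Suc r) (\<lambda>k j. P k ((\<nu>(r := i)) j))"
    unfolding c_def by (subst adj_mult_col) (auto intro!: dt_cong)
  with i \<nu> show ?case
    by (intro exI[of _ "\<nu>(r := i)"]) (auto simp: less_Suc_eq)
qed

subsection \<open>The zero estimate\<close>

definition theta :: "'a::{comm_ring_1,ring_no_zero_divisors} poly \<Rightarrow> 'a poly" where
  "theta p = pCons 0 (pderiv p)"

lemma theta_0 [simp]: "theta 0 = 0"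
  and theta_add: "theta (p + q) = theta p + theta q"
  and theta_mult: "theta (p * q) = theta p * q + p * theta q"
  and theta_const [simp]: "theta [:c:] = 0"
  and theta_of_int [simp]: "theta (of_int a) = 0"
  by (simp_all add: theta_def pderiv_add pderiv_smult pderiv_mult pderiv_pCons of_int_poly algebra_simps)

lemma theta_sum: "theta (sum f S) = (\<Sum>s\<in>S. theta (f s))"
  by (induction S rule: infinite_finite_induct) (simp_all add: theta_add)

lemma theta_prod: "finite S \<Longrightarrow> theta (prod f S) = (\<Sum>s\<in>S. theta (f s) * prod f (S - {s}))"
proof (induction S rule: finite_induct)
  case (insert x S)
  have "prod f (insert x S - {s}) = f x * prod f (S - {s})" if "s \<in> S" for s
  proof -
    have "insert x S - {s} = insert x (S - {s})"
      using insert that by auto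
    then show ?thesis
      using insert by simp
  qed
  then show ?case
    using insert by (simp add: theta_mult sum_distrib_left mult_ac)
qed (simp add: theta_def)

lemma coeff_theta: "coeff (theta p) n = of_nat n * coeff p n"
  by (cases n) (simp_all add: theta_def coeff_pderiv)

lemma degree_theta_le: "degree (theta p) \<le> degree p"
  by (rule degree_le) (auto simp: coeff_theta coeff_eq_0)

lemma fps_of_poly_theta: "fps_of_poly (theta p) = fps_XD (fps_of_poly p)"
  by (rule fps_ext) (simp add: coeff_theta)

lemma theta_dt:
  fixes f :: "nat \<Rightarrow> nat \<Rightarrow> 'a::{comm_ring_1,ring_no_zero_divisors} poly"
  shows "theta (dt r f) = (\<Sum>k<r. dt r (\<lambda>i. if i = k then \<lambda>j. theta (f i j) else f i))"
proof -
  have "theta (dt r f) = (\<Sum>p | p permutes {..<r}. \<Sum>k<r. of_int (sign p) *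
      (theta (f k (p k)) * (\<Prod>i\<in>{..<r} - {k}. f i (p i))))"
    unfolding dt_leibniz theta_sum theta_mult by (simp add: theta_prod sum_distrib_left)
  also have "\<dots> = (\<Sum>p | p permutes {..<r}. \<Sum>k<r. of_int (sign p) *
      (\<Prod>i<r. if i = k then theta (f i (p i)) else f i (p i)))"
  proof (intro sum.cong refl arg_cong2[of _ _ _ _ "(*)"])
    fix p k assume "k \<in> {..<r}"
    then show "theta (f k (p k)) * (\<Prod>i\<in>{..<r} - {k}. f i (p i)) =
      (\<Prod>i<r. if i = k then theta (f i (p i)) else f i (p i))"
      by (subst (2) prod.remove[of _ k]) (auto intro!: prod.cong)
  qed
  also have "\<dots> = (\<Sum>k<r. dt r (\<lambda>i. if i = k then \<lambda>j. theta (f i j) else f i))"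
    unfolding dt_leibniz if_distribR by (rule sum.swap)
  finally show ?thesis .
qed

text \<open>Writing \<open>u = q / p\<close>, the hypothesis says \<open>z u' = k z u + s\<close>; rational solutions of this
  equation are constant.\<close>

lemma rational_solution_const:
  fixes p q :: "real poly"
  assumes p: "p \<noteq> 0"
    and eq: "p * theta q - q * theta p = [:0, k:] * (p * q) + smult s (p * p)"
  shows "\<exists>c. q = smult c p"
proof -
  define g where "g = gcd p q"
  have g: "g \<noteq> 0"
    using p by (simp add: g_def)
  obtain p1 q1 where p1: "p = p1 * g" and q1: "q = q1 * g" and cop: "coprime p1 q1"
    using gcd_coprime_exists[of p q] g unfolding g_def by blast
  have "p1 \<noteq> 0"
    using p p1 by auto
  note g = g this
  have "(g * g) * (p1 * theta q1 - q1 * theta p1) =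
      (g * g) * ([:0, k:] * (p1 * q1) + smult s (p1 * p1))"
    using eq unfolding p1 q1 theta_mult by (simp add: algebra_simps del: mult_pCons_left)
  then have eq1: "p1 * theta q1 - q1 * theta p1 = [:0, k:] * (p1 * q1) + smult s (p1 * p1)"
    unfolding mult_cancel_left using g by simp
  then have "q1 * theta p1 = p1 * (theta q1 - [:0, k:] * q1 - smult s p1)"
    by (simp add: algebra_simps del: mult_pCons_left)
  \<comment> \<open>The reduced denominator divides its own image under \<open>theta\<close>. As
    \<open>theta\<close> does not raise degrees, the quotient is a constant, and comparing
    coefficients makes \<open>p1\<close> a monomial of degree \<open>e\<close>: the only possible
    pole is 0.\<close>
  then have "p1 dvd q1 * theta p1"
    by (rule dvdI)
  then have "p1 dvd theta p1"
    using cop coprime_dvd_mult_right_iff by blast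
  then obtain h where h: "theta p1 = p1 * h" ..
  have "degree h = 0"
  proof (cases "h = 0")
    case False
    then have "degree (theta p1) = degree p1 + degree h"
      using g by (simp add: h degree_mult_eq)
    then show ?thesis
      using degree_theta_le[of p1] by linarith
  qed simp
  then obtain a where a: "h = [:a:]"
    using degree_eq_zeroE by blast
  define e where "e = degree p1"
  have "coeff (theta p1) e = coeff (p1 * h) e"
    by (simp add: h)
  then have ae: "a = real e"
    using g by (simp add: a coeff_theta e_def)
  have p1_coeff: "coeff p1 j = 0" if "j \<noteq> e" for j
  proof -
    have "coeff (theta p1) j = coeff (p1 * h) j"
      by (simp add: h)
    then show ?thesis
      using that by (auto simp: a ae coeff_theta)
  qed
  have "p1 * (theta q1 - smult a q1) = p1 * ([:0, k:] * q1 + smult s p1)"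
    using eq1 unfolding h a by (simp add: algebra_simps del: mult_pCons_left)
  then have eq2: "theta q1 - smult a q1 = [:0, k:] * q1 + smult s p1"
    using g by simp
  have co: "(real j - real e) * coeff q1 j =
      (if j = 0 then 0 else k * coeff q1 (j - 1)) + s * coeff p1 j" for j
  proof -
    have "coeff (theta q1 - smult a q1) j = coeff ([:0, k:] * q1 + smult s p1) j"
      by (simp add: eq2)
    then show ?thesis
      by (cases j) (simp_all add: ae coeff_theta algebra_simps)
  qed
  have "\<exists>c. q1 = smult c p1"
  \<comment> \<open>For \<open>k = 0\<close> only the coefficient at \<open>e\<close> survives.
    Otherwise the recursion kills all coefficients of \<open>q1\<close> below \<open>e\<close>,
    hence \<open>s\<close>, and just above the degree of \<open>q1\<close> it contradicts
    \<open>q1\<close> being nonzero.\<close>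
  proof (cases "k = 0")
    case True
    have q1_coeff: "coeff q1 j = 0" if "j \<noteq> e" for j
    proof -
      have "(real j - real e) * coeff q1 j = 0"
        using co[of j] that p1_coeff[of j] True by auto
      then show ?thesis
        using that by simp
    qed
    have cf: "coeff q1 n = coeff q1 e / coeff p1 e * coeff p1 n" for n
      using q1_coeff[of n] p1_coeff[of n] g by (cases "n = e") (auto simp: e_def)
    have "q1 = smult (coeff q1 e / coeff p1 e) p1"
      by (rule poly_eqI) (unfold coeff_smult, rule cf)
    then show ?thesis ..
  next
    case False
    have low: "coeff q1 j = 0" if "j < e" for j
      using that
    proof (induction j)
      case 0
      then show ?case
        using co[of 0] p1_coeff[of 0] by auto
    next
      case (Suc j)
      then show ?case
        using co[of "Suc j"] p1_coeff[of "Suc j"] by auto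
    qed
    have "s * coeff p1 e = 0"
      using co[of e] low[of "e - 1"] by (cases e) auto
    then have s: "s = 0"
      using g by (simp add: e_def)
    have "q1 = 0"
    proof (rule ccontr)
      assume "q1 \<noteq> 0"
      then show False
        using co[of "Suc (degree q1)"] s False by (simp add: coeff_eq_0)
    qed
    then show ?thesis
      by (intro exI[of _ 0]) simp
  qed
  then show ?thesis
    using p1 q1 by auto
qed

lemma fps_XD_sum: "fps_XD (\<Sum>s\<in>S. f s) = (\<Sum>s\<in>S. fps_XD (f s :: real fps))"
  by (induction S rule: infinite_finite_induct) (simp_all add: fps_XD_def distrib_left)

lemma fps_XD_mult: "fps_XD (f * g) = fps_XD f * g + f * fps_XD (g :: real fps)"
  by (simp add: fps_XD_def algebra_simps)

section \<open>The derivation on linear forms dual to a triangular system\<close>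

text \<open>Integer entries let \<open>Dv\<close> preserve integrality of coefficients; the weight
  \<open>wt\<close> expresses strict triangularity without reordering the indices.\<close>

locale triangular_system =
  fixes M :: nat and A0 :: "nat \<Rightarrow> nat \<Rightarrow> int" and be :: "nat \<Rightarrow> int" and wt :: "nat \<Rightarrow> nat"
    and w :: "nat \<Rightarrow> real fps"
  assumes tri: "i < M \<Longrightarrow> j < M \<Longrightarrow> A0 i j \<noteq> 0 \<Longrightarrow> wt j < wt i"
    and system: "i < M \<Longrightarrow> fps_XD (w i) =
      (\<Sum>j<M. fps_const (of_int (A0 i j)) * w j) + fps_const (of_int (be i)) * fps_X * w i"
begin

text \<open>The adjoint derivation: the matrix enters transposed, which is what makes
  \<open>lin_Dv\<close> true.\<close>

definition Dv :: "(nat \<Rightarrow> real poly) \<Rightarrow> nat \<Rightarrow> real poly" where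
  "Dv p i = theta (p i) + (\<Sum>j<M. smult (of_int (A0 j i)) (p j)) + [:0, of_int (be i):] * p i"

definition lin :: "(nat \<Rightarrow> real poly) \<Rightarrow> real fps" where
  "lin p = (\<Sum>i<M. fps_of_poly (p i) * w i)"

lemma Dv_add: "Dv (\<lambda>i. p i + q i) i = Dv p i + Dv q i"
  by (simp add: Dv_def theta_add smult_add_right sum.distrib algebra_simps del: mult_pCons_left)

lemma Dv_mult: "Dv (\<lambda>i. a * p i) i = theta a * p i + a * Dv p i"
  by (simp add: Dv_def theta_mult sum_distrib_left algebra_simps del: mult_pCons_left)

lemma Dv_cong: "(\<And>j. j < M \<Longrightarrow> p j = q j) \<Longrightarrow> i < M \<Longrightarrow> Dv p i = Dv q i"
  by (simp add: Dv_def)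

lemma Dv_zero [simp]: "Dv (\<lambda>i. 0) i = 0"
  by (simp add: Dv_def)

lemma Dv_sum: "Dv (\<lambda>i. \<Sum>s\<in>S. p s i) i = (\<Sum>s\<in>S. Dv (p s) i)"
proof (induction S rule: infinite_finite_induct)
  case (insert s S)
  then show ?case
    using Dv_add[of "p s" "\<lambda>i. \<Sum>s\<in>S. p s i" i] by simp
qed simp_all

lemma lin_Dv: "lin (Dv p) = fps_XD (lin p)"
proof -
  have "fps_XD (lin p) = (\<Sum>i<M. fps_XD (fps_of_poly (p i)) * w i) +
     (\<Sum>i<M. fps_of_poly (p i) * fps_XD (w i))"
    unfolding lin_def fps_XD_sum fps_XD_mult by (rule sum.distrib)
  also have "(\<Sum>i<M. fps_of_poly (p i) * fps_XD (w i)) =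
     (\<Sum>i<M. \<Sum>j<M. fps_of_poly (p i) * (fps_const (of_int (A0 i j)) * w j)) +
     (\<Sum>i<M. fps_of_poly (p i) * (fps_const (of_int (be i)) * fps_X * w i))"
    by (simp add: system distrib_left sum_distrib_left sum.distrib)
  also have "(\<Sum>i<M. \<Sum>j<M. fps_of_poly (p i) * (fps_const (of_int (A0 i j)) * w j)) =
     (\<Sum>i<M. (\<Sum>j<M. fps_const (of_int (A0 j i)) * fps_of_poly (p j)) * w i)"
    unfolding sum_distrib_right by (subst sum.swap) (simp add: mult_ac)
  finally show ?thesis
    by (simp add: lin_def Dv_def fps_of_poly_add fps_of_poly_theta fps_of_poly_sum fps_of_poly_smult
        fps_of_poly_mult fps_of_poly_pCons sum.distrib algebra_simps del: mult_pCons_left)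
qed

lemma lin_Dvs: "lin ((Dv ^^ k) p) = (fps_XD ^^ k) (lin p)"
  by (induction k) (simp_all add: lin_Dv)

text \<open>\<open>fps_XD\<close> is diagonal on coefficients, so the iterates keep the order of
  vanishing of a form, at the price of the factor \<open>l ^ k\<close>.\<close>

lemma nth_lin_Dvs: "fps_nth (lin ((Dv ^^ k) p)) l = of_nat l ^ k * fps_nth (lin p) l"
  by (simp add: lin_Dvs fps_mult_fps_XD_shift)

lemma degree_Dv_le:
  assumes "\<And>i. i < M \<Longrightarrow> degree (p i) \<le> N" "i < M"
  shows "degree (Dv p i) \<le> Suc N"
proof -
  have "degree (smult c (p j)) \<le> Suc N" if "j < M" for c j
    using degree_smult_le[of c "p j"] assms(1)[OF that] by linarith
  then have "degree (\<Sum>j<M. smult (of_int (A0 j i)) (p j)) \<le> Suc N"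
    by (intro degree_sum_le) (auto simp del: degree_smult_eq)
  moreover have "degree ([:0, of_int (be i):] * p i) \<le> Suc N"
    using degree_mult_le[of "[:0, of_int (be i):]" "p i"] assms
    by (metis One_nat_def add_mono degree_pCons_le degree_0 le_trans plus_1_eq_Suc degree_pCons_eq_if le_refl)
  moreover have "degree (theta (p i)) \<le> Suc N"
    using degree_theta_le[of "p i"] assms(1)[of i] assms(2) by linarith
  ultimately show ?thesis
    unfolding Dv_def by (intro degree_add_le)
qed

lemma degree_Dvs_le:
  assumes "\<And>i. i < M \<Longrightarrow> degree (p i) \<le> N" "i < M"
  shows "degree ((Dv ^^ k) p i) \<le> N + k"
  using assms(2)
proof (induction k arbitrary: i)
  case (Suc k)
  then show ?case
    using degree_Dv_le[of "(Dv ^^ k) p" "N + k"] by simp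
qed (use assms in simp)


section \<open>Minors of the iterates of a form\<close>

text \<open>The columns are given by an arbitrary map, repetitions included (the minor is then 0),
  so that exchanging one column is the update \<open>\<rho>(j := i)\<close>.\<close>

definition minor :: "(nat \<Rightarrow> real poly) \<Rightarrow> nat \<Rightarrow> (nat \<Rightarrow> nat) \<Rightarrow> real poly" where
  "minor R r \<rho> = dt r (\<lambda>k j. (Dv ^^ k) R (\<rho> j))"

lemma minor_upd:
  assumes "j < r"
  shows "minor R r (\<rho>(j := i)) =
    (\<Sum>k<r. adj r (\<lambda>k j. (Dv ^^ k) R (\<rho> j)) j k * (Dv ^^ k) R i)"
  unfolding minor_def by (subst adj_mult_col[OF assms]) (auto intro!: dt_cong)

lemma smult_sum_right: "smult c (\<Sum>s\<in>S. f s) = (\<Sum>s\<in>S. smult c (f s))"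
  by (induction S rule: infinite_finite_induct) (simp_all add: smult_add_right)

text \<open>An Abel-Liouville identity. Applying \<open>Dv\<close> to row k gives row k + 1, which
  is already present unless k is the last index \<open>r0\<close>; there the dependency leaves
  \<open>- a r0\<close>. Passing from \<open>Dv\<close> back to \<open>theta\<close> costs the
  matrix terms: the diagonal part multiplies the minor by a multiple of z, and \<open>A0\<close>
  exchanges one column at a time.\<close>

lemma minor_differential_equation:
  assumes dep: "\<And>i. i < M \<Longrightarrow> (\<Sum>k\<le>Suc r0. a k * (Dv ^^ k) R i) = 0"
    and r: "r = Suc r0" and \<rho>: "\<And>j. j < r \<Longrightarrow> \<rho> j < M"
  shows "a r * theta (minor R r \<rho>) = - a r0 * minor R r \<rho>
     - a r * ([:0, of_int (\<Sum>j<r. be (\<rho> j)):] * minor R r \<rho>)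
     - a r * (\<Sum>j<r. \<Sum>i<M. smult (of_int (A0 i (\<rho> j))) (minor R r (\<rho>(j := i))))"
proof -
  define P where "P = (\<lambda>k. (Dv ^^ k) R)"
  define f where "f = (\<lambda>k j. P k (\<rho> j))"
  define g where "g = (\<lambda>k j. (\<Sum>i<M. smult (of_int (A0 i (\<rho> j))) (P k i)) +
    [:0, of_int (be (\<rho> j)):] * P k (\<rho> j))"
  have f: "minor R r \<rho> = dt r f"
    by (simp add: minor_def f_def P_def)
  have theta_f: "theta (f k j) = P (Suc k) (\<rho> j) - g k j" for k j
    by (simp add: f_def g_def P_def Dv_def)
  have "theta (dt r f) = (\<Sum>k<r. \<Sum>j<r. theta (f k j) * adj r f j k)"
    unfolding theta_dt by (intro sum.cong refl) (subst row_mult_adj, auto intro!: dt_cong)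
  also have "\<dots> = (\<Sum>k<r. \<Sum>j<r. P (Suc k) (\<rho> j) * adj r f j k) - (\<Sum>k<r. \<Sum>j<r. g k j * adj r f j k)"
    by (simp add: theta_f left_diff_distrib sum_subtractf)
  also have "(\<Sum>k<r. \<Sum>j<r. P (Suc k) (\<rho> j) * adj r f j k) = (\<Sum>j<r. P r (\<rho> j) * adj r f j r0)"
  proof -
    have "(\<Sum>j<r. P (Suc k) (\<rho> j) * adj r f j k) = 0" if "k < r0" for k
      using that r by (subst row_mult_adj) (auto intro!: dt_eq_rows[of k "Suc k"] simp: f_def)
    then show ?thesis
      unfolding r by simp
  qed
  finally have 1: "a r * theta (dt r f) =
      a r * (\<Sum>j<r. P r (\<rho> j) * adj r f j r0) - a r * (\<Sum>k<r. \<Sum>j<r. g k j * adj r f j k)"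
    by (simp add: right_diff_distrib)
  have "a r * (\<Sum>j<r. P r (\<rho> j) * adj r f j r0) = (\<Sum>j<r. (a r * P r (\<rho> j)) * adj r f j r0)"
    by (simp add: sum_distrib_left mult.assoc)
  also have "\<dots> = (\<Sum>j<r. (\<Sum>k<r. - a k * f k j) * adj r f j r0)"
  proof (intro sum.cong refl arg_cong2[of _ _ _ _ "(*)"])
    fix j assume "j \<in> {..<r}"
    then have "(\<Sum>k<r. a k * P k (\<rho> j)) + a r * P r (\<rho> j) = 0"
      using dep[OF \<rho>, of j] unfolding r P_def by (simp add: lessThan_Suc_atMost)
    then show "a r * P r (\<rho> j) = (\<Sum>k<r. - a k * f k j)"
      by (simp add: f_def sum_negf eq_neg_iff_add_eq_0 add.commute)
  qed
  also have "\<dots> = (\<Sum>k<r. - a k * (\<Sum>j<r. f k j * adj r f j r0))"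
    unfolding sum_distrib_left sum_distrib_right by (subst sum.swap) (simp add: mult.assoc)
  also have "\<dots> = - a r0 * dt r f"
  proof -
    have "(\<Sum>k<r. - a k * (\<Sum>j<r. f k j * adj r f j r0)) =
        (\<Sum>k<r. if k = r0 then - a r0 * dt r f else 0)"
      using r by (intro sum.cong refl) (subst mult_adj, auto)
    then show ?thesis
      using r by simp
  qed
  finally have 2: "a r * (\<Sum>j<r. P r (\<rho> j) * adj r f j r0) = - a r0 * dt r f" .
  have 3: "(\<Sum>k<r. \<Sum>j<r. g k j * adj r f j k) =
     [:0, of_int (\<Sum>j<r. be (\<rho> j)):] * dt r f +
     (\<Sum>j<r. \<Sum>i<M. smult (of_int (A0 i (\<rho> j))) (minor R r (\<rho>(j := i))))"
  proof -
    have "(\<Sum>k<r. g k j * adj r f j k) = [:0, of_int (be (\<rho> j)):] * dt r f +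
       (\<Sum>i<M. smult (of_int (A0 i (\<rho> j))) (minor R r (\<rho>(j := i))))" if j: "j < r" for j
    proof -
      have "(\<Sum>k<r. g k j * adj r f j k) =
          (\<Sum>k<r. \<Sum>i<M. smult (of_int (A0 i (\<rho> j))) (P k i) * adj r f j k) +
          [:0, of_int (be (\<rho> j)):] * (\<Sum>k<r. adj r f j k * f k j)"
        unfolding g_def distrib_right sum_distrib_right sum.distrib
        by (simp add: f_def sum_distrib_left mult_ac del: mult_pCons_left mult_pCons_right)
      also have "(\<Sum>k<r. adj r f j k * f k j) = dt r f"
        using adj_mult[OF j j, of f] by simp
      also have "(\<Sum>k<r. \<Sum>i<M. smult (of_int (A0 i (\<rho> j))) (P k i) * adj r f j k) =
          (\<Sum>i<M. smult (of_int (A0 i (\<rho> j))) (minor R r (\<rho>(j := i))))"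
        unfolding minor_upd[OF j] by (subst sum.swap)
          (simp add: smult_sum_right f_def P_def mult.commute)
      finally show ?thesis
        by (simp only: add.commute)
    qed
    then have "(\<Sum>j<r. \<Sum>k<r. g k j * adj r f j k) =
        (\<Sum>j<r. [:0, of_int (be (\<rho> j)):]) * dt r f +
        (\<Sum>j<r. \<Sum>i<M. smult (of_int (A0 i (\<rho> j))) (minor R r (\<rho>(j := i))))"
      by (simp add: sum.distrib sum_distrib_right del: mult_pCons_left)
    moreover have "(\<Sum>j<n. [:0, of_int (be (\<rho> j)):]) = [:0, real_of_int (\<Sum>j<n. be (\<rho> j)):]" for n
      by (induction n) auto
    ultimately show ?thesis
      by (subst sum.swap) simp
  qed
  show ?thesis
    unfolding f 1 2 3 by (simp add: distrib_left)
qed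

text \<open>Downward induction on the total weight of the columns: a nonzero minor of maximal weight solves
  a homogeneous first-order equation, which eliminates \<open>a\<close> from the equations of the others.\<close>

lemma minors_proportional:
  assumes dep: "\<And>i. i < M \<Longrightarrow> (\<Sum>k\<le>Suc r0. a k * (Dv ^^ k) R i) = 0"
    and r: "r = Suc r0" and ar: "a r \<noteq> 0"
    and ex: "\<exists>\<nu>. (\<forall>j<r. \<nu> j < M) \<and> minor R r \<nu> \<noteq> 0"
  shows "\<exists>\<nu>. (\<forall>j<r. \<nu> j < M) \<and> minor R r \<nu> \<noteq> 0 \<and>
    (\<forall>\<rho>. (\<forall>j<r. \<rho> j < M) \<longrightarrow> (\<exists>c. minor R r \<rho> = smult c (minor R r \<nu>)))"
proof -
  define W where "W = (\<lambda>\<rho>. \<Sum>j<r. wt (\<rho> j))"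
  define B where "B = r * (\<Sum>i<M. wt i)"
  have W_le: "W \<rho> \<le> B" if "\<forall>j<r. \<rho> j < M" for \<rho>
  proof -
    have "wt (\<rho> j) \<le> (\<Sum>i<M. wt i)" if "j < r" for j
      using that \<open>\<forall>j<r. \<rho> j < M\<close> by (intro member_le_sum) auto
    then show ?thesis
      unfolding W_def B_def using sum_bounded_above[of "{..<r}" "\<lambda>j. wt (\<rho> j)"] by simp
  qed
  have W_upd: "W (\<rho>(j := i)) > W \<rho>" if "j < r" "wt (\<rho> j) < wt i" for \<rho> i j
    unfolding W_def using that by (intro sum_strict_mono_ex1) auto
  obtain \<nu> where \<nu>: "\<forall>j<r. \<nu> j < M" "minor R r \<nu> \<noteq> 0"
    and max: "\<And>\<rho>. \<forall>j<r. \<rho> j < M \<Longrightarrow> minor R r \<rho> \<noteq> 0 \<Longrightarrow> W \<rho> \<le> W \<nu>"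
  proof -
    from ex obtain \<nu>0 where *: "(\<forall>j<r. \<nu>0 j < M) \<and> minor R r \<nu>0 \<noteq> 0"
      by blast
    have "\<exists>x. ((\<forall>j<r. x j < M) \<and> minor R r x \<noteq> 0) \<and>
        (\<forall>y. (\<forall>j<r. y j < M) \<and> minor R r y \<noteq> 0 \<longrightarrow> W y \<le> W x)"
      using ex_has_greatest_nat[where P = "\<lambda>x. (\<forall>j<r. x j < M) \<and> minor R r x \<noteq> 0" and f = W
          and b = "Suc B", OF *] by (auto simp: less_Suc_eq_le W_le)
    then show ?thesis
      using that by blast
  qed
  define p where "p = minor R r \<nu>"
  define b where "b = (\<lambda>\<rho>. real_of_int (\<Sum>j<r. be (\<rho> j)))"
  have eq: "a r * theta (minor R r \<rho>) = - a r0 * minor R r \<rho> - a r * ([:0, b \<rho>:] * minor R r \<rho>)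
     - a r * (\<Sum>j<r. \<Sum>i<M. smult (of_int (A0 i (\<rho> j))) (minor R r (\<rho>(j := i))))"
    if "\<forall>j<r. \<rho> j < M" for \<rho>
    unfolding b_def using minor_differential_equation[OF dep r] that by blast
  \<comment> \<open>Every exchange of columns permitted by \<open>A0\<close> raises
    \<open>W\<close>, so at maximal weight all exchanged minors vanish.\<close>
  have "(\<Sum>j<r. \<Sum>i<M. smult (of_int (A0 i (\<nu> j))) (minor R r (\<nu>(j := i)))) = 0"
  proof (intro sum.neutral ballI)
    fix j i assume ji: "j \<in> {..<r}" "i \<in> {..<M}"
    show "smult (of_int (A0 i (\<nu> j))) (minor R r (\<nu>(j := i))) = 0"
    proof (cases "A0 i (\<nu> j) = 0")
      case False
      then have "wt (\<nu> j) < wt i"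
        using tri[of i "\<nu> j"] ji \<nu> by auto
      then have "W (\<nu>(j := i)) > W \<nu>"
        using W_upd ji by auto
      then have "minor R r (\<nu>(j := i)) = 0"
        using max[of "\<nu>(j := i)"] ji \<nu> by fastforce
      then show ?thesis
        by simp
    qed simp
  qed
  then have eqp: "a r * theta p = - a r0 * p - a r * ([:0, b \<nu>:] * p)"
    using eq[OF \<nu>(1)] by (simp add: p_def)
  have "\<exists>c. minor R r \<rho> = smult c p" if "\<forall>j<r. \<rho> j < M" for \<rho>
    using that
  proof (induction "B - W \<rho>" arbitrary: \<rho> rule: less_induct)
    case less
    have "\<exists>s. (\<Sum>i<M. smult (of_int (A0 i (\<rho> j))) (minor R r (\<rho>(j := i)))) = smult s p"
      if j: "j < r" for j
    proof -
      have "\<exists>c. smult (of_int (A0 i (\<rho> j))) (minor R r (\<rho>(j := i))) = smult c p" if i: "i < M" for i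
      proof (cases "A0 i (\<rho> j) = 0")
        case False
        then have "wt (\<rho> j) < wt i"
          using tri[of i "\<rho> j"] i j less.prems by auto
        then have "W (\<rho>(j := i)) > W \<rho>"
          using W_upd j by auto
        moreover have valid: "\<forall>k<r. (\<rho>(j := i)) k < M"
          using less.prems i by auto
        ultimately have "B - W (\<rho>(j := i)) < B - W \<rho>"
          using W_le[OF valid] by linarith
        then obtain c where "minor R r (\<rho>(j := i)) = smult c p"
          using less.hyps valid by blast
        then show ?thesis
          by auto
      qed (auto intro: exI[of _ 0])
      then obtain c where "\<And>i. i < M \<Longrightarrow> smult (of_int (A0 i (\<rho> j))) (minor R r (\<rho>(j := i))) = smult (c i) p"
        by metis
      then have "(\<Sum>i<M. smult (of_int (A0 i (\<rho> j))) (minor R r (\<rho>(j := i)))) = smult (\<Sum>i<M. c i) p"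
        by (simp add: smult_sum)
      then show ?thesis ..
    qed
    then obtain c where "\<And>j. j < r \<Longrightarrow>
        (\<Sum>i<M. smult (of_int (A0 i (\<rho> j))) (minor R r (\<rho>(j := i)))) = smult (c j) p"
      by metis
    then have S: "(\<Sum>j<r. \<Sum>i<M. smult (of_int (A0 i (\<rho> j))) (minor R r (\<rho>(j := i)))) =
        smult (\<Sum>j<r. c j) p"
      by (simp add: smult_sum)
    define s where "s = (\<Sum>j<r. c j)"
    define q where "q = minor R r \<rho>"
    have eqq: "a r * theta q = - a r0 * q - a r * ([:0, b \<rho>:] * q) - a r * smult s p"
      using eq[OF less.prems] unfolding S q_def s_def .
    define x y where "x = [:0, b \<nu>:]" and "y = [:0, b \<rho>:]"
    \<comment> \<open>The unknown function \<open>a r0\<close> cancels in this Wronskian of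
      \<open>p\<close> and \<open>q\<close>; what remains is the equation of
      \<open>rational_solution_const\<close>.\<close>
    have "a r * (p * theta q - q * theta p) = p * (a r * theta q) - q * (a r * theta p)"
      by (simp add: algebra_simps)
    also have "\<dots> = a r * ((x - y) * (p * q) - smult s (p * p))"
      unfolding eqp eqq x_def[symmetric] y_def[symmetric] by (simp add: algebra_simps)
    also have "(x - y) * (p * q) - smult s (p * p) =
        [:0, b \<nu> - b \<rho>:] * (p * q) + smult (- s) (p * p)"
      by (simp add: x_def y_def)
    finally have "p * theta q - q * theta p = [:0, b \<nu> - b \<rho>:] * (p * q) + smult (- s) (p * p)"
      using ar unfolding mult_cancel_left by blast
    then show ?case
      using rational_solution_const[of p q] \<nu> unfolding p_def q_def by blast
  qed
  with \<nu> show ?thesis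
    unfolding p_def by blast
qed


section \<open>Stable spaces and the order of vanishing\<close>

text \<open>For a constant vector u, \<open>Dv u\<close> is the transpose of \<open>A0\<close>
  applied to u plus z times the diagonal part applied to u. The last two conditions are these two
  coefficients, so together they express closure under \<open>Dv\<close>.\<close>

definition stable :: "(nat \<Rightarrow> real) set \<Rightarrow> bool" where
  "stable U \<longleftrightarrow> (\<forall>u\<in>U. \<forall>v\<in>U. (\<lambda>i. u i + v i) \<in> U) \<and> (\<forall>c. \<forall>u\<in>U. (\<lambda>i. c * u i) \<in> U) \<and>
     (\<forall>u\<in>U. (\<lambda>i. \<Sum>j<M. of_int (A0 j i) * u j) \<in> U) \<and> (\<forall>u\<in>U. (\<lambda>i. of_int (be i) * u i) \<in> U)"

lemma lin_sum_mult: "lin (\<lambda>l. \<Sum>k\<in>S. b k * x k l) = (\<Sum>k\<in>S. fps_of_poly (b k) * lin (x k))"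
  unfolding lin_def sum_distrib_left fps_of_poly_sum fps_of_poly_mult sum_distrib_right
  by (subst sum.swap) (simp add: mult.assoc)

lemma dependency_top:
  fixes c :: "nat \<Rightarrow> real poly"
  assumes "\<exists>k<r. c k \<noteq> 0" "\<And>i. i < M \<Longrightarrow> (\<Sum>k<r. c k * P k i) = 0"
  shows "\<exists>t<r. \<exists>a. a t \<noteq> 0 \<and> (\<forall>i<M. (\<Sum>k\<le>t. a k * P k i) = 0)"
proof -
  define t where "t = Max {k. k < r \<and> c k \<noteq> 0}"
  have fin: "finite {k. k < r \<and> c k \<noteq> 0}" and ne: "{k. k < r \<and> c k \<noteq> 0} \<noteq> {}"
    using assms by auto
  have t: "t < r" "c t \<noteq> 0"
    using Max_in[OF fin ne] by (auto simp: t_def)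
  have "c k = 0" if "k < r" "t < k" for k
    using Max_ge[OF fin, of k] that unfolding t_def by fastforce
  then have "(\<Sum>k\<le>t. c k * P k i) = (\<Sum>k<r. c k * P k i)" for i
    using t by (intro sum.mono_neutral_left) auto
  then have "\<forall>i<M. (\<Sum>k\<le>t. c k * P k i) = 0"
    using assms(2) by simp
  with t show ?thesis
    by blast
qed

text \<open>If the \<open>Dv\<close>-iterates of \<open>R\<close> span a space of dimension \<open>r < M\<close>, this space has a basis of
  constant vectors, so it contains a constant vector \<open>v\<close> whose form has nonzero constant term;
  then \<open>p v\<close> is a combination of the iterates for an \<open>r\<close>-minor \<open>p\<close>, and the degree of \<open>p\<close> bounds
  the order of vanishing of the form of \<open>R\<close>.\<close>

theorem zero_estimate:
  assumes no_stable_kernel: "\<And>U v i. stable U \<Longrightarrow> v \<in> U \<Longrightarrow> i < M \<Longrightarrow> v i \<noteq> 0 \<Longrightarrow>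
      \<exists>v\<in>U. (\<Sum>i<M. v i * fps_nth (w i) 0) \<noteq> 0"
    and R: "i0 < M" "R i0 \<noteq> 0"
    and deg: "\<And>i. i < M \<Longrightarrow> degree (R i) \<le> N"
    and van: "\<And>l. l < L \<Longrightarrow> fps_nth (lin R) l = 0"
    and L: "L > (N + M) * (M - 1)"
  shows "dt M (\<lambda>k j. (Dv ^^ k) R j) \<noteq> 0"
proof
  assume dt0: "dt M (\<lambda>k j. (Dv ^^ k) R j) = 0"
  define P where "P = (\<lambda>k. (Dv ^^ k) R)"
  define Q where "Q = (\<lambda>r. \<exists>a. a r \<noteq> 0 \<and> (\<forall>i<M. (\<Sum>k\<le>r. a k * P k i) = 0))"
  have "\<exists>t<M. Q t"
    using dt0 dependency_top[of M _ P] unfolding dt_eq_0_iff_rows_dependent Q_def P_def by blast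
  then obtain t where t: "t < M" "Q t"
    by blast
  \<comment> \<open>The rank of the iterates: those before number \<open>r\<close> are independent,
    and \<open>P r\<close> is the first to depend on its predecessors.\<close>
  define r where "r = (LEAST r. Q r)"
  have Qr: "Q r" and rM: "r < M"
    using LeastI[of Q t] Least_le[of Q t] t unfolding r_def by auto
  obtain a where a: "a r \<noteq> 0" "\<And>i. i < M \<Longrightarrow> (\<Sum>k\<le>r. a k * P k i) = 0"
    using Qr unfolding Q_def by blast
  have "r \<noteq> 0"
    using a(1) a(2)[OF R(1)] R(2) by (cases r) (auto simp: P_def)
  then obtain r0 where r0: "r = Suc r0"
    by (cases r) auto
  have "\<exists>i<M. (\<Sum>k<r. c k * P k i) \<noteq> 0" if c: "\<exists>k<r. c k \<noteq> 0" for c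
  proof (rule ccontr)
    assume "\<not> ?thesis"
    then have "\<exists>t<r. Q t"
      using dependency_top[OF c, of P] unfolding Q_def by blast
    then obtain t where "t < r" "Q t"
      by blast
    then show False
      using not_less_Least[of t Q] unfolding r_def by blast
  qed
  from exists_minor_nonzero[OF this]
  have "\<exists>\<nu>. (\<forall>j<r. \<nu> j < M) \<and> minor R r \<nu> \<noteq> 0"
    by (simp add: minor_def P_def)
  then have "\<exists>\<nu>. (\<forall>j<r. \<nu> j < M) \<and> minor R r \<nu> \<noteq> 0 \<and>
      (\<forall>\<rho>. (\<forall>j<r. \<rho> j < M) \<longrightarrow> (\<exists>c. minor R r \<rho> = smult c (minor R r \<nu>)))"
    using a by (intro minors_proportional[where a = a, OF _ r0]) (auto simp: P_def r0)
  then obtain \<nu> where \<nu>: "\<forall>j<r. \<nu> j < M" "minor R r \<nu> \<noteq> 0"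
    and proportional: "\<And>\<rho>. \<forall>j<r. \<rho> j < M \<Longrightarrow> \<exists>c. minor R r \<rho> = smult c (minor R r \<nu>)"
    by blast
  define p where "p = minor R r \<nu>"
  define f where "f = (\<lambda>k j. P k (\<nu> j))"
  have p: "p \<noteq> 0" "p = dt r f"
    using \<nu> by (auto simp: p_def f_def minor_def P_def)
  have ex_c: "\<exists>c. minor R r (\<nu>(i := l)) = smult c p" if "l < M" for i l
    using proportional[of "\<nu>(i := l)"] \<nu> that unfolding p_def by auto
  \<comment> \<open>By Cramer's rule, column \<open>l\<close> of the first \<open>r\<close> iterates
    is the combination of the columns \<open>\<nu> i\<close> with coefficients \<open>c i l\<close>;
    proportionality of the minors makes these coefficients constants.\<close>
  define c where "c = (\<lambda>i l. SOME c. minor R r (\<nu>(i := l)) = smult c p)"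
  have c: "minor R r (\<nu>(i := l)) = smult (c i l) p" if "l < M" for i l
    unfolding c_def using someI_ex[OF ex_c[OF that]] .
  have adj_P: "(\<Sum>k<r. adj r f i k * P k l) = smult (c i l) p" if "i < r" "l < M" for i l
    using minor_upd[OF that(1), of R \<nu> l] c[OF that(2), of i] by (simp add: f_def P_def)
  \<comment> \<open>Membership in the span of the first \<open>r\<close> iterates over the rational
    functions, expressed by linear relations with constant coefficients: every coordinate is
    determined by those at \<open>\<nu> i\<close>. No denominators appear, and constant vectors in
    the span are visible directly.\<close>
  define inW where "inW = (\<lambda>x :: nat \<Rightarrow> real poly. \<forall>l<M. x l = (\<Sum>i<r. smult (c i l) (x (\<nu> i))))"
  have inW_sum: "inW (\<lambda>l. \<Sum>k\<in>S. b k * x k l)" if "\<And>k. k \<in> S \<Longrightarrow> inW (x k)" for S :: "nat set" and b x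
    unfolding inW_def
  proof (intro allI impI)
    fix l assume l: "l < M"
    have "(\<Sum>k\<in>S. b k * x k l) = (\<Sum>k\<in>S. b k * (\<Sum>i<r. smult (c i l) (x k (\<nu> i))))"
      using that l unfolding inW_def by (intro sum.cong refl arg_cong2[of _ _ _ _ "(*)"]) blast
    also have "\<dots> = (\<Sum>i<r. smult (c i l) (\<Sum>k\<in>S. b k * x k (\<nu> i)))"
      unfolding smult_sum_right sum_distrib_left by (subst sum.swap) simp
    finally show "(\<Sum>k\<in>S. b k * x k l) = (\<Sum>i<r. smult (c i l) (\<Sum>k\<in>S. b k * x k (\<nu> i)))" .
  qed
  have inW_cancel: "inW x" if "inW (\<lambda>l. q * x l)" "q \<noteq> 0" for x q
    unfolding inW_def
  proof (intro allI impI)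
    fix l assume l: "l < M"
    then have "q * x l = (\<Sum>i<r. smult (c i l) (q * x (\<nu> i)))"
      using that(1) unfolding inW_def by blast
    also have "\<dots> = q * (\<Sum>i<r. smult (c i l) (x (\<nu> i)))"
      by (simp add: sum_distrib_left)
    finally show "x l = (\<Sum>i<r. smult (c i l) (x (\<nu> i)))"
      using that(2) by simp
  qed
  have inW_diff: "inW (\<lambda>l. x l - y l)" if "inW x" "inW y" for x y
    unfolding inW_def
  proof (intro allI impI)
    fix l assume "l < M"
    then have "x l = (\<Sum>i<r. smult (c i l) (x (\<nu> i)))" "y l = (\<Sum>i<r. smult (c i l) (y (\<nu> i)))"
      using that unfolding inW_def by blast+
    then show "x l - y l = (\<Sum>i<r. smult (c i l) (x (\<nu> i) - y (\<nu> i)))"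
      by (simp only: smult_diff_right sum_subtractf)
  qed
  have inW_cong: "inW x \<longleftrightarrow> inW y" if xy: "\<And>l. l < M \<Longrightarrow> x l = y l" for x y
  proof -
    have "(\<Sum>i<r. smult (c i l) (x (\<nu> i))) = (\<Sum>i<r. smult (c i l) (y (\<nu> i)))" for l
      by (rule sum.cong) (use xy \<nu>(1) in auto)
    with xy show ?thesis
      unfolding inW_def by metis
  qed
  have P_lt: "inW (P k)" if k: "k < r" for k
    unfolding inW_def
  proof (intro allI impI)
    fix l assume l: "l < M"
    have "p * P k l = (\<Sum>k'<r. (\<Sum>i<r. f k i * adj r f i k') * P k' l)"
    proof -
      have "(\<Sum>k'<r. (\<Sum>i<r. f k i * adj r f i k') * P k' l) =
          (\<Sum>k'<r. if k' = k then p * P k l else 0)"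
        using k p by (intro sum.cong refl) (subst mult_adj, auto)
      then show ?thesis
        using k by simp
    qed
    also have "\<dots> = (\<Sum>i<r. f k i * (\<Sum>k'<r. adj r f i k' * P k' l))"
      unfolding sum_distrib_left sum_distrib_right by (subst sum.swap) (simp add: mult.assoc)
    also have "\<dots> = p * (\<Sum>i<r. smult (c i l) (P k (\<nu> i)))"
      using adj_P l by (simp add: sum_distrib_left f_def mult.commute)
    finally show "P k l = (\<Sum>i<r. smult (c i l) (P k (\<nu> i)))"
      using p by simp
  qed
  have P_r: "inW (P r)"
  proof (rule inW_cancel[of "a r"])
    have "inW (\<lambda>l. \<Sum>k<r. - a k * P k l)"
      using P_lt by (intro inW_sum) auto
    moreover have "a r * P r l = (\<Sum>k<r. - a k * P k l)" if "l < M" for l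
      using a(2)[OF that] unfolding lessThan_Suc_atMost[symmetric]
      by (simp add: sum_negf eq_neg_iff_add_eq_0 add.commute)
    ultimately show "inW (\<lambda>l. a r * P r l)"
      using inW_cong[of "\<lambda>l. a r * P r l" "\<lambda>l. \<Sum>k<r. - a k * P k l"] by blast
  qed (rule a)
  have inW_P: "\<exists>b. \<forall>l<M. p * x l = (\<Sum>k<r. b k * P k l)" if "inW x" for x
  proof (intro exI allI impI)
    fix l assume l: "l < M"
    have "p * x l = p * (\<Sum>i<r. smult (c i l) (x (\<nu> i)))"
      using that l unfolding inW_def by metis
    also have "\<dots> = (\<Sum>i<r. x (\<nu> i) * (\<Sum>k<r. adj r f i k * P k l))"
      using adj_P l by (simp add: sum_distrib_left mult.commute)
    also have "\<dots> = (\<Sum>k<r. (\<Sum>i<r. x (\<nu> i) * adj r f i k) * P k l)"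
      unfolding sum_distrib_left sum_distrib_right by (subst sum.swap) (simp add: mult.assoc)
    finally show "p * x l = (\<Sum>k<r. (\<Sum>i<r. x (\<nu> i) * adj r f i k) * P k l)" .
  qed
  have inW_Dv: "inW (Dv x)" if x: "inW x" for x
  proof (rule inW_cancel[of p])
    obtain b where b: "\<forall>l<M. p * x l = (\<Sum>k<r. b k * P k l)"
      using inW_P[OF x] by blast
    have "p * Dv x l = ((\<Sum>k<r. theta (b k) * P k l) + (\<Sum>k<r. b k * P (Suc k) l)) - theta p * x l"
      if l: "l < M" for l
    proof -
      have "Dv (\<lambda>l. p * x l) l = Dv (\<lambda>l. \<Sum>k<r. b k * P k l) l"
        using b l by (intro Dv_cong) auto
      then show ?thesis
        by (simp add: Dv_mult Dv_sum P_def sum.distrib algebra_simps)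
    qed
    \<comment> \<open>The sign and the one-term sum bring the expression into the shape covered by
      \<open>inW_diff\<close> and \<open>inW_sum\<close>.\<close>
    then have "p * Dv x l = ((\<Sum>k<r. theta (b k) * P k l) - (\<Sum>k<r. - b k * P (Suc k) l)) - (\<Sum>k<Suc 0. theta p * x l)"
      if "l < M" for l
      using that by (simp add: sum_negf)
    moreover have "inW (\<lambda>l. ((\<Sum>k<r. theta (b k) * P k l) - (\<Sum>k<r. - b k * P (Suc k) l)) - (\<Sum>k<Suc 0. theta p * x l))"
    proof (intro inW_diff inW_sum)
      show "inW (P (Suc k))" if "k \<in> {..<r}" for k
        using P_lt[of "Suc k"] P_r that by (cases "Suc k = r") auto
    qed (use x P_lt in auto)
    ultimately show "inW (\<lambda>l. p * Dv x l)"
      using inW_cong[of "\<lambda>l. p * Dv x l" "\<lambda>l. ((\<Sum>k<r. theta (b k) * P k l) -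
        (\<Sum>k<r. - b k * P (Suc k) l)) - (\<Sum>k<Suc 0. theta p * x l)"] by blast
  qed (rule p)
  define U where "U = {v. inW (\<lambda>i. [:v i:])}"
  have sum_const: "(\<Sum>i<n. [:g i:]) = [:\<Sum>i<n. g i:]" for n and g :: "nat \<Rightarrow> real"
    by (induction n) auto
  have U: "v \<in> U \<longleftrightarrow> (\<forall>l<M. v l = (\<Sum>i<r. c i l * v (\<nu> i)))" for v
    unfolding U_def inW_def by (simp add: sum_const)
  have D: "(\<lambda>l. \<Sum>j<M. of_int (A0 j l) * v j) \<in> U \<and> (\<lambda>l. of_int (be l) * v l) \<in> U" if v: "v \<in> U" for v
  proof -
    let ?y = "\<lambda>l. [:\<Sum>j<M. of_int (A0 j l) * v j, of_int (be l) * v l:]"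
    have "Dv (\<lambda>i. [:v i:]) l = ?y l" for l
      by (simp add: Dv_def sum_const)
    then have "inW ?y"
      using inW_Dv[of "\<lambda>i. [:v i:]"] v inW_cong[of "Dv (\<lambda>i. [:v i:])" ?y] unfolding U_def by simp
    then have *: "?y l = (\<Sum>i<r. smult (c i l) (?y (\<nu> i)))" if "l < M" for l
      using that unfolding inW_def by blast
    have co: "coeff (?y l) n = (\<Sum>i<r. c i l * coeff (?y (\<nu> i)) n)" if "l < M" for l n
      using arg_cong[OF *[OF that], of "\<lambda>q. coeff q n"] by (simp only: coeff_sum coeff_smult)
    have "(\<Sum>j<M. of_int (A0 j l) * v j) = (\<Sum>i<r. c i l * (\<Sum>j<M. of_int (A0 j (\<nu> i)) * v j))"
      "of_int (be l) * v l = (\<Sum>i<r. c i l * (of_int (be (\<nu> i)) * v (\<nu> i)))" if "l < M" for l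
      using co[OF that, of 0] co[OF that, of 1] by simp_all
    then show ?thesis
      unfolding U by blast
  qed
  have "stable U"
    unfolding stable_def
  proof (intro conjI ballI allI)
    fix u v c assume "u \<in> U" "v \<in> U"
    then show "(\<lambda>i. u i + v i) \<in> U"
      unfolding U by (simp add: distrib_left sum.distrib)
  next
    fix u c assume "u \<in> U"
    then show "(\<lambda>i. c * u i) \<in> U"
      unfolding U by (simp add: sum_distrib_left mult_ac)
  qed (use D in auto)
  \<comment> \<open>Exchanging column 0 for \<open>\<nu> i\<close> repeats a column unless i = 0. So
    \<open>c 0\<close> is a unit vector on the chosen columns, which makes it a nonzero element of
    \<open>U\<close>.\<close>
  moreover have c0: "c 0 (\<nu> i) = (if i = 0 then 1 else 0)" if i: "i < r" for i
  proof (cases "i = 0")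
    case True
    then have "minor R r \<nu> = smult (c 0 (\<nu> 0)) p"
      using c[of "\<nu> 0" 0] \<nu> r0 by simp
    then have "smult (c 0 (\<nu> 0) - 1) p = 0"
      by (simp add: p_def smult_diff_left)
    then show ?thesis
      using True p by simp
  next
    case False
    have "minor R r (\<nu>(0 := \<nu> i)) = 0"
      unfolding minor_def using i False by (intro dt_eq_cols[of 0 i]) auto
    then show ?thesis
      using c[of "\<nu> i" 0] \<nu> p i False by simp
  qed
  have "c 0 \<in> U"
    unfolding U
  proof (intro allI impI)
    fix l assume "l < M"
    have "(\<Sum>i<r. c i l * c 0 (\<nu> i)) = (\<Sum>i<r. if i = 0 then c 0 l else 0)"
      by (intro sum.cong refl) (simp add: c0)
    then show "c 0 l = (\<Sum>i<r. c i l * c 0 (\<nu> i))"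
      using r0 by simp
  qed
  moreover have "\<nu> 0 < M" "c 0 (\<nu> 0) \<noteq> 0"
    using c0[of 0] \<nu> r0 by auto
  ultimately obtain v where v: "v \<in> U" "(\<Sum>i<M. v i * fps_nth (w i) 0) \<noteq> 0"
    using no_stable_kernel[of U "c 0" "\<nu> 0"] by blast
  obtain b where b: "\<And>l. l < M \<Longrightarrow> p * [:v l:] = (\<Sum>k<r. b k * P k l)"
    using inW_P[of "\<lambda>i. [:v i:]"] v(1) unfolding U_def by auto
  \<comment> \<open>The product of \<open>p\<close> and \<open>s\<close> is a polynomial combination
    of forms vanishing to order \<open>L\<close>; since \<open>s\<close> has a nonzero constant
    term, \<open>p\<close> itself vanishes to order \<open>L\<close> at 0, too much for its
    degree.\<close>
  define s where "s = (\<Sum>i<M. fps_const (v i) * w i)"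
  have s: "fps_nth s 0 \<noteq> 0"
    using v by (simp add: s_def fps_sum_nth)
  have "fps_of_poly p * s = lin (\<lambda>l. p * [:v l:])"
    by (simp add: lin_def s_def sum_distrib_left fps_of_poly_mult fps_of_poly_smult mult_ac)
  also have "\<dots> = (\<Sum>k<r. fps_of_poly (b k) * lin (P k))"
    unfolding lin_sum_mult[symmetric] using b by (simp add: lin_def del: mult_pCons_right)
  finally have eq: "fps_of_poly p * s = (\<Sum>k<r. fps_of_poly (b k) * lin (P k))" .
  have "fps_nth (fps_of_poly (b k) * lin (P k)) l = 0" if "l < L" for k l
    unfolding fps_mult_nth P_def nth_lin_Dvs using van that by (intro sum.neutral) auto
  then have "fps_nth (fps_of_poly p * s) l = 0" if "l < L" for l
    unfolding eq using that by (simp add: fps_sum_nth)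
  moreover have ps: "fps_of_poly p * s \<noteq> 0"
    using p s by auto
  ultimately have "L \<le> subdegree (fps_of_poly p * s)"
    by (intro subdegree_geI) auto
  also have "\<dots> = subdegree (fps_of_poly p)"
    using p s by (subst subdegree_mult) auto
  also have "\<dots> \<le> degree p"
    using p by (intro subdegree_leI) auto
  also have "\<dots> \<le> (N + r) * r"
  proof -
    have "degree (f k j) \<le> N + r" if "k < r" "j < r" for k j
      using degree_Dvs_le[of R N "\<nu> j" k] deg \<nu> that by (force simp: f_def P_def)
    then show ?thesis
      unfolding p by (intro degree_dt_le)
  qed
  also have "\<dots> \<le> (N + M) * (M - 1)"
    using rM by (intro mult_mono) auto
  finally show False
    using L by simp
qed

end

subsection \<open>Specialisation at 1\<close>

text \<open>Each \<open>theta\<close> lowers the order of vanishing at 1 by exactly one, because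
  theta (z - 1) = z does not vanish there.\<close>

lemma theta_power_funpow_vanish:
  fixes h :: "real poly"
  assumes "poly h 1 \<noteq> 0" "j \<le> s"
  shows "\<exists>h'. (theta ^^ j) ([:-1, 1:] ^ s * h) = [:-1, 1:] ^ (s - j) * h' \<and> poly h' 1 \<noteq> 0"
  using assms(2)
proof (induction j)
  case 0
  then show ?case
    using assms by auto
next
  case (Suc j)
  then obtain h' where h': "(theta ^^ j) ([:-1, 1:] ^ s * h) = [:-1, 1:] ^ (s - j) * h'" "poly h' 1 \<noteq> 0"
    by auto
  obtain m where m: "s - j = Suc m" "s - Suc j = m"
    using Suc.prems by (metis Suc_diff_Suc Suc_le_lessD)
  have theta_power: "theta ([:-1, 1:] ^ n * u) = [:-1, 1:] ^ (n - 1) * (of_nat n * [:0, 1:] * u + [:-1, 1:] * theta u)"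
    if "n > 0" for n and u :: "real poly"
  proof -
    define x where "x = ([:-1, 1:] :: real poly)"
    have thpx: "theta x = [:0, 1:]"
      by (simp add: x_def theta_def pderiv_pCons)
    have tp: "theta (x ^ n) = of_nat n * x ^ (n - 1) * [:0, 1:]" for n
    proof (induction n)
      case (Suc n)
      then show ?case
        by (cases n) (simp_all add: theta_mult thpx algebra_simps del: mult_pCons_left mult_pCons_right)
    qed (simp add: theta_def)
    have xs: "x ^ n = x ^ (n - 1) * x"
      using that by (cases n) auto
    have "theta (x ^ n * u) = (of_nat n * x ^ (n - 1) * [:0, 1:]) * u + (x ^ (n - 1) * x) * theta u"
      unfolding theta_mult tp by (subst xs) (rule refl)
    then show ?thesis
      unfolding x_def[symmetric] by (simp only: distrib_left mult_ac)
  qed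
  have "(theta ^^ Suc j) ([:-1, 1:] ^ s * h) =
      [:-1, 1:] ^ m * (of_nat (Suc m) * [:0, 1:] * h' + [:-1, 1:] * theta h')"
    using theta_power[of "Suc m" h'] by (simp add: h' m del: power_Suc of_nat_Suc mult_pCons_left)
  moreover have "poly (of_nat (Suc m) * [:0, 1:] * h' + [:-1, 1:] * theta h') 1 \<noteq> 0"
    using h'(2) by (simp del: of_nat_Suc)
  ultimately show ?case
    unfolding m by blast
qed

text \<open>The zero of order \<open>L\<close> at 0 uses up part of the degree, and only the rest is
  available for the zero at 1.\<close>

lemma exists_theta_nonvanishing_at_1:
  fixes p :: "real poly"
  assumes "p \<noteq> 0" "monom 1 L dvd p"
  shows "\<exists>s. s + L \<le> degree p \<and> poly ((theta ^^ s) p) 1 \<noteq> 0 \<and> (\<forall>j<s. poly ((theta ^^ j) p) 1 = 0)"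
proof -
  obtain p1 where p1: "p = monom 1 L * p1"
    using assms by auto
  have nz: "p1 \<noteq> 0"
    using assms p1 by auto
  define s where "s = order 1 p"
  obtain h where h: "p = [:-1, 1:] ^ s * h" "\<not> [:-1, 1:] dvd h"
    using order_decomp[OF assms(1), of 1] unfolding s_def by auto
  then have h1: "poly h 1 \<noteq> 0"
    by (simp add: poly_eq_0_iff_dvd)
  have "order 1 (monom 1 L :: real poly) = 0"
    by (rule order_0I) (simp add: poly_monom)
  then have "s = order 1 p1"
    using assms(1) unfolding s_def p1 by (subst order_mult) auto
  also have "\<dots> \<le> degree p1"
    using nz by (rule order_degree)
  finally have "s + L \<le> degree p"
    using nz unfolding p1 by (simp add: degree_mult_eq monom_eq_0_iff degree_monom_eq)
  moreover have "poly ((theta ^^ s) p) 1 \<noteq> 0"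
    using theta_power_funpow_vanish[OF h1, of s s] h(1) by auto
  moreover have "poly ((theta ^^ j) p) 1 = 0" if "j < s" for j
    using theta_power_funpow_vanish[OF h1, of j s] that h(1) by auto
  ultimately show ?thesis
    by blast
qed

context triangular_system
begin

lemma lin_cong: "(\<And>i. i < M \<Longrightarrow> p i = q i) \<Longrightarrow> lin p = lin q"
  by (simp add: lin_def)

lemma Dvs_add: "(Dv ^^ s) (\<lambda>i. p i + q i) = (\<lambda>i. (Dv ^^ s) p i + (Dv ^^ s) q i)"
  by (induction s) (simp_all add: ext[OF Dv_add])

lemma Dvs_sum: "(Dv ^^ s) (\<lambda>i. \<Sum>k\<in>S. p k i) = (\<lambda>i. \<Sum>k\<in>S. (Dv ^^ s) (p k) i)"
  by (induction s) (simp_all add: ext[OF Dv_sum])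

lemma Dvs_cong:
  assumes "\<And>j. j < M \<Longrightarrow> p j = q j" "i < M"
  shows "(Dv ^^ s) p i = (Dv ^^ s) q i"
  using assms(2)
proof (induction s arbitrary: i)
  case (Suc s)
  then show ?case
    using Dv_cong[of "(Dv ^^ s) p" "(Dv ^^ s) q" i] by simp
qed (use assms in simp)

lemma Dvs_Suc_mult:
  "(Dv ^^ Suc s) (\<lambda>i. a * p i) = (\<lambda>i. (Dv ^^ s) (\<lambda>i. theta a * p i) i + (Dv ^^ s) (\<lambda>i. a * Dv p i) i)"
proof -
  have "Dv (\<lambda>i. a * p i) = (\<lambda>i. theta a * p i + a * Dv p i)"
    by (simp add: Dv_mult fun_eq_iff)
  then show ?thesis
    by (simp add: funpow_swap1 Dvs_add)
qed

text \<open>In the Leibniz expansion every term carries some \<open>(theta ^^ j) a\<close> with j at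
  most s, and only j = s survives at 1.\<close>

lemma poly_1_Dvs_mult:
  assumes "\<And>j. j < s \<Longrightarrow> poly ((theta ^^ j) a) 1 = 0"
  shows "poly ((Dv ^^ s) (\<lambda>i. a * p i) i) 1 = poly ((theta ^^ s) a) 1 * poly (p i) 1"
  using assms
proof (induction s arbitrary: a p)
  case (Suc s)
  have "poly ((theta ^^ j) (theta a)) 1 = 0" if "j < s" for j
    using Suc.prems[of "Suc j"] that by (simp add: funpow_swap1)
  from Suc.IH[OF this, of p] Suc.IH[OF Suc.prems, of "Dv p"] Suc.prems[of s]
  show ?case
    unfolding Dvs_Suc_mult by (simp add: funpow_swap1)
qed simp

section \<open>The span of the values of the iterates at 1\<close>

definition row_comb :: "(nat \<Rightarrow> real poly) \<Rightarrow> nat \<Rightarrow> (nat \<Rightarrow> real) \<Rightarrow> bool" where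
  "row_comb R t x \<longleftrightarrow> (\<exists>g. \<forall>i<M. x i = (\<Sum>k<t. g k * poly ((Dv ^^ k) R i) 1))"

lemma row_comb_mono:
  assumes "row_comb R t x" "t \<le> t'"
  shows "row_comb R t' x"
proof -
  obtain g where g: "\<forall>i<M. x i = (\<Sum>k<t. g k * poly ((Dv ^^ k) R i) 1)"
    using assms(1) unfolding row_comb_def by blast
  have "(\<Sum>k<t'. (if k < t then g k else 0) * poly ((Dv ^^ k) R i) 1) =
      (\<Sum>k<t. g k * poly ((Dv ^^ k) R i) 1)" for i
    using assms(2) by (intro sum.mono_neutral_cong_right) auto
  then show ?thesis
    unfolding row_comb_def using g by (intro exI[of _ "\<lambda>k. if k < t then g k else 0"]) simp
qed

lemma row_comb_add:
  assumes "row_comb R t x" "row_comb R t y"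
  shows "row_comb R t (\<lambda>i. x i + y i)"
proof -
  obtain g h where "\<forall>i<M. x i = (\<Sum>k<t. g k * poly ((Dv ^^ k) R i) 1)"
      "\<forall>i<M. y i = (\<Sum>k<t. h k * poly ((Dv ^^ k) R i) 1)"
    using assms unfolding row_comb_def by blast
  then have "\<forall>i<M. x i + y i = (\<Sum>k<t. (g k + h k) * poly ((Dv ^^ k) R i) 1)"
    by (simp add: distrib_right sum.distrib)
  then show ?thesis
    unfolding row_comb_def by (intro exI[of _ "\<lambda>k. g k + h k"])
qed

lemma row_comb_scale:
  assumes "row_comb R t x"
  shows "row_comb R t (\<lambda>i. c * x i)"
proof -
  obtain g where "\<forall>i<M. x i = (\<Sum>k<t. g k * poly ((Dv ^^ k) R i) 1)"
    using assms unfolding row_comb_def by blast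
  then have "\<forall>i<M. c * x i = (\<Sum>k<t. (c * g k) * poly ((Dv ^^ k) R i) 1)"
    by (simp add: sum_distrib_left mult.assoc)
  then show ?thesis
    unfolding row_comb_def by (intro exI[of _ "\<lambda>k. c * g k"])
qed

lemma row_comb_sum:
  assumes "\<And>s. s \<in> S \<Longrightarrow> row_comb R t (x s)"
  shows "row_comb R t (\<lambda>i. \<Sum>s\<in>S. x s i)"
  using assms
proof (induction S rule: infinite_finite_induct)
  case (insert s S)
  then have "row_comb R t (\<lambda>i. x s i + (\<Sum>s\<in>S. x s i))"
    by (intro row_comb_add) auto
  with insert show ?case
    by simp
qed (auto simp: row_comb_def intro!: exI[of _ "\<lambda>_. 0"])

lemma row_comb_iterate: "k < t \<Longrightarrow> row_comb R t (\<lambda>i. poly ((Dv ^^ k) R i) 1)"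
  unfolding row_comb_def by (intro exI[of _ "\<lambda>k'. if k' = k then 1 else 0"])
    (simp add: if_distrib[of "\<lambda>c. c * _"] cong: if_cong)

lemma row_comb_Dvs_mult: "row_comb R (k + s + 1) (\<lambda>i. poly ((Dv ^^ s) (\<lambda>i. a * (Dv ^^ k) R i) i) 1)"
proof (induction s arbitrary: a k)
  case 0
  show ?case
    using row_comb_scale[OF row_comb_iterate[of k "k + 1" R], of "poly a 1"] by simp
next
  case (Suc s)
  have "row_comb R (k + Suc s + 1) (\<lambda>i. poly ((Dv ^^ s) (\<lambda>i. theta a * (Dv ^^ k) R i) i) 1 +
      poly ((Dv ^^ s) (\<lambda>i. a * Dv ((Dv ^^ k) R) i) i) 1)"
    using row_comb_mono[OF Suc[of k "theta a"], of "k + Suc s + 1"] Suc[of "Suc k" a]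
    by (intro row_comb_add) auto
  then show ?case
    unfolding Dvs_Suc_mult by simp
qed

text \<open>With \<open>D\<close> the determinant of the first M iterates, Cramer's rule writes
  \<open>D\<close> times a unit vector as a combination of them. In coordinate \<open>i1\<close>,
  where the function is 1, this shows that z^L divides \<open>D\<close>, so the order s of
  \<open>D\<close> at 1 is at most M (N + M) - L. Applying \<open>Dv\<close> s times and setting z =
  1 leaves a nonzero multiple of the unit vector, and the iterates involved have index below M +
  s.\<close>

lemma row_comb_unit:
  assumes nz: "dt M (\<lambda>k j. (Dv ^^ k) R j) \<noteq> 0"
    and deg: "\<And>i. i < M \<Longrightarrow> degree (R i) \<le> N"
    and van: "\<And>l. l < L \<Longrightarrow> fps_nth (lin R) l = 0"
    and i1: "i1 < M" "w i1 = 1" and l: "l < M"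
  shows "row_comb R (M + (M * (N + M) - L)) (\<lambda>i. if i = l then 1 else 0)"
proof -
  define f where "f = (\<lambda>k j. (Dv ^^ k) R j)"
  define D where "D = dt M f"
  have D0: "D \<noteq> 0"
    using nz by (simp add: D_def f_def)
  have adj_f: "(\<Sum>k<M. adj M f i k * (Dv ^^ k) R j) = (if i = j then D else 0)" if "i < M" "j < M" for i j
    using adj_mult[OF that, of f] by (simp add: D_def f_def)
  have eq: "fps_of_poly D = (\<Sum>k<M. fps_of_poly (adj M f i1 k) * lin ((Dv ^^ k) R))"
  proof -
    have "(\<Sum>k<M. fps_of_poly (adj M f i1 k) * lin ((Dv ^^ k) R)) =
        lin (\<lambda>j. if i1 = j then D else 0)"
      unfolding lin_sum_mult[symmetric] using adj_f i1 by (intro lin_cong) auto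
    also have "\<dots> = (\<Sum>i<M. if i = i1 then fps_of_poly D else 0)"
      unfolding lin_def using i1 by (intro sum.cong refl) auto
    finally show ?thesis
      using i1 by simp
  qed
  have "fps_nth (fps_of_poly a * lin ((Dv ^^ k) R)) m = 0" if "m < L" for a k m
    unfolding fps_mult_nth nth_lin_Dvs using van that by (intro sum.neutral) auto
  then have "coeff D m = 0" if "m < L" for m
    using that arg_cong[OF eq, of "\<lambda>f. fps_nth f m"] by (simp add: fps_sum_nth)
  then have "monom 1 L dvd D"
    by (simp add: monom_1_dvd_iff')
  from exists_theta_nonvanishing_at_1[OF D0 this]
  obtain s where s: "s + L \<le> degree D" "poly ((theta ^^ s) D) 1 \<noteq> 0"
      "\<And>j. j < s \<Longrightarrow> poly ((theta ^^ j) D) 1 = 0"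
    by blast
  have "degree D \<le> (N + M) * M"
    unfolding D_def
  proof (rule degree_dt_le)
    show "degree (f i j) \<le> N + M" if "i < M" "j < M" for i j
      using degree_Dvs_le[of R N j i] deg that by (force simp: f_def)
  qed
  then have sT: "s \<le> M * (N + M) - L"
    using s(1) by (simp add: mult.commute)
  define x where "x = (\<lambda>i. poly ((Dv ^^ s) (\<lambda>i. \<Sum>k<M. adj M f l k * (Dv ^^ k) R i) i) 1)"
  have "row_comb R (M + (M * (N + M) - L)) x"
    unfolding x_def Dvs_sum poly_sum
    using row_comb_mono[OF row_comb_Dvs_mult] sT by (intro row_comb_sum) auto
  moreover have "x i = poly ((theta ^^ s) D) 1 * (if i = l then 1 else 0)" if i: "i < M" for i
  proof -
    have "(Dv ^^ s) (\<lambda>i. \<Sum>k<M. adj M f l k * (Dv ^^ k) R i) i =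
        (Dv ^^ s) (\<lambda>i. D * (if i = l then 1 else 0)) i"
      using adj_f l i by (intro Dvs_cong) auto
    then show ?thesis
      unfolding x_def using poly_1_Dvs_mult[OF s(3), of s "\<lambda>i. if i = l then 1 else 0" i] by simp
  qed
  ultimately have "row_comb R (M + (M * (N + M) - L)) (\<lambda>i. poly ((theta ^^ s) D) 1 * (if i = l then 1 else 0))"
    unfolding row_comb_def by simp
  from row_comb_scale[OF this, of "1 / poly ((theta ^^ s) D) 1"] s(2) show ?thesis
    by simp
qed

text \<open>Steinitz exchange by multilinearity: start from the identity matrix with row
  \<open>l0\<close> replaced by \<open>q\<close>, nonsingular because \<open>q l0\<close> is
  nonzero, and trade the other unit rows one at a time for values of iterates.\<close>

lemma complete_to_nonsingular:
  fixes q :: "nat \<Rightarrow> real"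
  assumes unit: "\<And>l. l < M \<Longrightarrow> row_comb R t (\<lambda>i. if i = l then 1 else 0)"
    and l0: "l0 < M" "q l0 \<noteq> 0"
  shows "\<exists>\<kappa>. (\<forall>i. \<kappa> i < t) \<and>
    dt M (\<lambda>i. if i = l0 then q else (\<lambda>j. poly ((Dv ^^ \<kappa> i) R j) 1)) \<noteq> 0"
proof -
  define y where "y = (\<lambda>k j. poly ((Dv ^^ k) R j) 1)"
  define e where "e = (\<lambda>i j::nat. if j = i then 1 else 0 :: real)"
  have t: "t > 0"
    using unit[OF l0(1)] l0(1) unfolding row_comb_def by (cases "t = 0") auto
  have "\<exists>\<kappa>. (\<forall>i. \<kappa> i < t) \<and>
      dt M (\<lambda>i. if i = l0 then q else if i < n then y (\<kappa> i) else e i) \<noteq> 0" if "n \<le> M" for n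
    using that
  proof (induction n)
    case 0
    have "dt M (\<lambda>i. if i = l0 then q else e i) \<noteq> 0"
    proof
      assume "dt M (\<lambda>i. if i = l0 then q else e i) = 0"
      then obtain c i where c: "i < M" "c i \<noteq> 0"
        "\<And>j. j < M \<Longrightarrow> (\<Sum>i<M. c i * (if i = l0 then q else e i) j) = 0"
        unfolding dt_eq_0_iff_rows_dependent by blast
      have eq: "c l0 * q j + (if j = l0 then 0 else c j) = 0" if j: "j < M" for j
      proof -
        have "(\<Sum>i<M. c i * (if i = l0 then q else e i) j) =
            (\<Sum>i<M. (if i = l0 then c l0 * q j else 0) + (if i = j then if j = l0 then 0 else c j else 0))"
          by (intro sum.cong refl) (auto simp: e_def)
        also have "\<dots> = c l0 * q j + (if j = l0 then 0 else c j)"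
          using j l0 by (simp add: sum.distrib)
        finally show ?thesis
          using c(3)[OF j] by simp
      qed
      have "c l0 = 0"
        using eq[OF l0(1)] l0(2) by simp
      then show False
        using eq[OF c(1)] c(2) by (simp split: if_splits)
    qed
    then show ?case
      using t by (intro exI[of _ "\<lambda>_. 0"]) (simp cong: if_cong)
  next
    case (Suc n)
    then obtain \<kappa> where \<kappa>: "\<forall>i. \<kappa> i < t"
      "dt M (\<lambda>i. if i = l0 then q else if i < n then y (\<kappa> i) else e i) \<noteq> 0"
      by auto
    show ?case
    proof (cases "n = l0")
      case True
      then have "(\<lambda>i. if i = l0 then q else if i < Suc n then y (\<kappa> i) else e i) =
          (\<lambda>i. if i = l0 then q else if i < n then y (\<kappa> i) else e i)"
        by (auto simp: fun_eq_iff)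
      with \<kappa> show ?thesis
        by (intro exI[of _ \<kappa>]) simp
    next
      case False
      define F where "F = (\<lambda>i. if i = l0 then q else if i < n then y (\<kappa> i) else e i)"
      have n: "n < M"
        using Suc.prems by simp
      obtain g where g: "\<forall>i<M. (if i = n then 1 else 0) = (\<Sum>k<t. g k * y k i)"
        using unit[OF n] unfolding row_comb_def y_def by blast
      have "dt M F = dt M (\<lambda>i. if i = n then (\<lambda>j. \<Sum>k<t. g k * y k j) else F i)"
        using g False by (intro dt_cong) (auto simp: F_def e_def)
      also have "\<dots> = (\<Sum>k<t. g k * dt M (\<lambda>i. if i = n then y k else F i))"
        by (rule dt_row_sum[OF n])
      finally have "(\<Sum>k<t. g k * dt M (\<lambda>i. if i = n then y k else F i)) \<noteq> 0"
        using \<kappa>(2) by (simp add: F_def)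
      then obtain k where k: "k < t" "dt M (\<lambda>i. if i = n then y k else F i) \<noteq> 0"
        by (metis (no_types, lifting) lessThan_iff mult_zero_right sum.neutral)
      have "(\<lambda>i. if i = n then y k else F i) =
          (\<lambda>i. if i = l0 then q else if i < Suc n then y ((\<kappa>(n := k)) i) else e i)"
        using False by (auto simp: F_def fun_eq_iff)
      with k \<kappa>(1) show ?thesis
        by (intro exI[of _ "\<kappa>(n := k)"]) auto
    qed
  qed
  from this[of M] obtain \<kappa> where \<kappa>: "\<forall>i. \<kappa> i < t"
      "dt M (\<lambda>i. if i = l0 then q else if i < M then y (\<kappa> i) else e i) \<noteq> 0"
    by auto
  have "dt M (\<lambda>i. if i = l0 then q else if i < M then y (\<kappa> i) else e i) =
      dt M (\<lambda>i. if i = l0 then q else y (\<kappa> i))"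
    by (intro dt_cong) auto
  with \<kappa> show ?thesis
    unfolding y_def by (intro exI[of _ \<kappa>]) simp
qed

end

subsection \<open>Siegel's lemma and E-functions\<close>

text \<open>From k (p^a choose k) = p^a (p^a - 1 choose k - 1): were p prime to the binomial
  coefficient, p^a would divide k.\<close>

lemma prime_dvd_choose_prime_power:
  fixes p :: nat
  assumes p: "prime p" and k: "0 < k" "k < p ^ a"
  shows "p dvd (p ^ a choose k)"
proof (rule ccontr)
  assume "\<not> ?thesis"
  then have "coprime (p ^ a) (p ^ a choose k)"
    using p prime_imp_coprime by (metis coprime_power_left_iff)
  moreover have "p ^ a dvd k * (p ^ a choose k)"
    using times_binomial_minus1_eq[OF k(1), of "p ^ a"] by simp
  ultimately have "p ^ a dvd k"
    using coprime_dvd_mult_left_iff by blast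
  with k show False
    by (auto dest: dvd_imp_le)
qed

text \<open>Vandermonde for 2n = p^a + (2n - p^a): the term k = 0 vanishes because 2n - p^a < n, and
  in all other terms the first binomial is divisible by p.\<close>

lemma prime_dvd_central_binomial:
  fixes p :: nat
  assumes p: "prime p" and a: "n < p ^ a" "p ^ a \<le> 2 * n"
  shows "p dvd (2 * n choose n)"
proof -
  have "p dvd (p ^ a choose k) * (2 * n - p ^ a choose (n - k))" if "k \<le> n" for k
  proof (cases "k = 0")
    case True
    have "2 * n - p ^ a < n"
      using a by linarith
    then show ?thesis
      using True by (simp add: binomial_eq_0)
  next
    case False
    then show ?thesis
      using prime_dvd_choose_prime_power[OF p, of k a] that a by simp
  qed
  then have "p dvd (\<Sum>k\<le>n. (p ^ a choose k) * (2 * n - p ^ a choose (n - k)))"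
    by (intro dvd_sum) auto
  then show ?thesis
    using vandermonde[of "p ^ a" "2 * n - p ^ a" n] a by simp
qed

text \<open>For a prime power p^a up to 2n, either p^a is at most n, or p^(a-1) is and the missing
  factor p comes from the central binomial coefficient.\<close>

lemma Lcm_double_dvd: "Lcm {1..2 * n} dvd Lcm {1..n} * (2 * n choose n)" for n :: nat
proof (rule Lcm_least)
  fix k :: nat assume k: "k \<in> {1..2 * n}"
  have nz: "Lcm {1..n} * (2 * n choose n) \<noteq> 0"
    by (auto simp: Lcm_0_iff)
  show "k dvd Lcm {1..n} * (2 * n choose n)"
  proof (rule multiplicity_le_imp_dvd)
    fix p :: nat assume p: "prime p"
    define a where "a = multiplicity p k"
    have "p ^ a dvd k"
      by (simp add: a_def multiplicity_dvd)
    then have a: "p ^ a \<le> 2 * n"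
      using k by (auto dest: dvd_imp_le)
    have pow_dvd: "p ^ b dvd Lcm {1..n}" if "p ^ b \<le> n" for b
      using that p by (intro dvd_Lcm) (auto simp: Suc_le_eq prime_gt_0_nat)
    have "p ^ a dvd Lcm {1..n} * (2 * n choose n)"
    proof (cases "p ^ a \<le> n")
      case True
      then show ?thesis
        by (intro dvd_mult2 pow_dvd)
    next
      case False
      then obtain b where b: "a = Suc b"
        using k by (cases a) auto
      have "2 * p ^ b \<le> p ^ a"
        using prime_ge_2_nat[OF p] by (simp add: b)
      then have "p ^ b \<le> n"
        using a by linarith
      then show ?thesis
        using mult_dvd_mono[OF pow_dvd prime_dvd_central_binomial[OF p, of n a]] False a
        by (simp add: b mult.commute)
    qed
    then show "multiplicity p k \<le> multiplicity p (Lcm {1..n} * (2 * n choose n))"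
      using p nz unfolding a_def[symmetric] by (intro multiplicity_geI) auto
  qed (use k in auto)
qed

text \<open>Halving: with m = ceiling (n / 2) the step gives 64^m 4^m = 4^(4m), and 4m <= 3n for n
  >= 2 brings this below 4^(3n) = 64^n.\<close>

lemma Lcm_upto_le: "Lcm {1..n} \<le> (64::nat) ^ n"
proof (induction n rule: less_induct)
  case (less n)
  show ?case
  proof (cases "n \<le> 1")
    case True
    then show ?thesis
      by (cases n) auto
  next
    case False
    define m where "m = (n + 1) div 2"
    have m: "m < n" "n \<le> 2 * m" "4 * m \<le> 3 * n"
      using False unfolding m_def by linarith+
    have "Lcm {1..n} dvd Lcm {1..2 * m}"
      using m by (intro Lcm_subset) auto
    also have "\<dots> dvd Lcm {1..m} * (2 * m choose m)"
      by (rule Lcm_double_dvd)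
    finally have "Lcm {1..n} \<le> Lcm {1..m} * (2 * m choose m)"
      by (rule dvd_imp_le) (auto simp: Lcm_0_iff intro!: Nat.gr0I)
    also have "\<dots> \<le> 64 ^ m * 2 ^ (2 * m)"
      using less[OF m(1)] binomial_le_pow2[of "2 * m" m] by (intro mult_mono) auto
    also have "\<dots> = 4 ^ (4 * m)"
      by (simp add: power_mult power_mult_distrib[symmetric])
    also have "\<dots> \<le> 4 ^ (3 * n)"
      using m by (intro power_increasing) auto
    finally show ?thesis
      by (simp add: power_mult)
  qed
qed

text \<open>Box principle: two vectors with entries between 0 and \<open>B\<close> have the same
  image, and their difference is the solution. A natural number \<open>c\<close> in place of the
  usual quotient of cardinalities avoids real exponents.\<close>

lemma siegel_lemma:
  fixes a :: "'e \<Rightarrow> 'x \<Rightarrow> int"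
  assumes fin: "finite X" "finite E" and H: "H \<ge> 1"
    and bound: "\<And>e x. e \<in> E \<Longrightarrow> x \<in> X \<Longrightarrow> \<bar>a e x\<bar> \<le> int H"
    and card: "card E < card X" "card E \<le> c * (card X - card E)"
  shows "\<exists>p :: 'x \<Rightarrow> int. (\<exists>x\<in>X. p x \<noteq> 0) \<and> (\<forall>e\<in>E. (\<Sum>x\<in>X. a e x * p x) = 0) \<and>
    (\<forall>x\<in>X. \<bar>p x\<bar> \<le> int ((2 * card X * H) ^ c))"
proof -
  define N where "N = card X"
  define m where "m = card E"
  define B where "B = (2 * N * H) ^ c"
  define F where "F = PiE X (\<lambda>_. {0..int B})"
  define G where "G = PiE E (\<lambda>_. {- int (N * H * B)..int (N * H * B)})"
  define g where "g = (\<lambda>p. \<lambda>e\<in>E. \<Sum>x\<in>X. a e x * p x)"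
  have N: "N \<ge> 1" "m < N"
    using card by (auto simp: N_def m_def)
  have g_G: "g p \<in> G" if p: "p \<in> F" for p
  proof -
    have bd: "\<bar>\<Sum>x\<in>X. a e x * p x\<bar> \<le> int (N * H * B)" if e: "e \<in> E" for e
    proof -
      have "\<bar>\<Sum>x\<in>X. a e x * p x\<bar> \<le> (\<Sum>x\<in>X. \<bar>a e x * p x\<bar>)"
        by (rule sum_abs)
      also have "\<dots> \<le> (\<Sum>x\<in>X. int H * int B)"
      proof (rule sum_mono)
        fix x assume x: "x \<in> X"
        then have "\<bar>p x\<bar> \<le> int B"
          using PiE_mem[OF p[unfolded F_def] x] by simp
        then show "\<bar>a e x * p x\<bar> \<le> int H * int B"
          unfolding abs_mult using bound[OF e x] by (intro mult_mono) auto
      qed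
      finally show ?thesis
        by (simp add: N_def)
    qed
    then have "(\<Sum>x\<in>X. a e x * p x) \<in> {- int (N * H * B)..int (N * H * B)}" if "e \<in> E" for e
      using bd[OF that] unfolding abs_le_iff atLeastAtMost_iff by linarith
    then show ?thesis
      unfolding G_def g_def by auto
  qed
  have "card (g ` F) \<le> card G"
    using g_G fin by (intro card_mono) (auto simp: G_def intro!: finite_PiE)
  also have "card G = (2 * N * H * B + 1) ^ m"
  proof -
    have "card {- int k..int k} = 2 * k + 1" for k
      by simp
    from this[of "N * H * B"] show ?thesis
      using fin by (simp only: G_def card_PiE m_def prod_constant mult.assoc)
  qed
  also have "\<dots> \<le> (2 * N * H * (B + 1)) ^ m"
    using N H by (intro power_mono) (auto simp: Suc_le_eq)
  also have "\<dots> = (2 * N * H) ^ m * (B + 1) ^ m"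
    by (rule power_mult_distrib)
  also have "(2 * N * H) ^ m * (B + 1) ^ m < (B + 1) ^ (N - m) * (B + 1) ^ m"
  proof -
    have "(2 * N * H) ^ m \<le> (2 * N * H) ^ (c * (N - m))"
      using N H card(2) unfolding N_def m_def by (intro power_increasing) (auto simp: Suc_le_eq)
    also have "\<dots> = B ^ (N - m)"
      by (simp add: B_def power_mult)
    also have "\<dots> < (B + 1) ^ (N - m)"
      using N by (intro power_strict_mono) auto
    finally show ?thesis
      by simp
  qed
  also have "\<dots> = (B + 1) ^ N"
    using N by (simp add: power_add[symmetric])
  also have "\<dots> = card F"
    using fin by (simp add: F_def card_PiE N_def nat_add_distrib)
  finally have "\<not> inj_on g F"
    by (rule pigeonhole)
  then obtain u v where uv: "u \<in> F" "v \<in> F" "g u = g v" "u \<noteq> v"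
    by (auto simp: inj_on_def)
  show ?thesis
  proof (intro exI[of _ "\<lambda>x. u x - v x"] conjI ballI)
    show "\<exists>x\<in>X. u x - v x \<noteq> 0"
      using uv(1,2,4) unfolding F_def by (metis PiE_ext eq_iff_diff_eq_0)
    show "(\<Sum>x\<in>X. a e x * (u x - v x)) = 0" if "e \<in> E" for e
      using fun_cong[OF uv(3), of e] that by (simp add: g_def right_diff_distrib sum_subtractf)
    show "\<bar>u x - v x\<bar> \<le> int ((2 * card X * H) ^ c)" if "x \<in> X" for x
    proof -
      have "u x \<in> {0..int B}" "v x \<in> {0..int B}"
        using uv that by (auto simp: F_def)
      then show ?thesis
        by (auto simp: B_def N_def)
    qed
  qed
qed

section \<open>E-functions with rational coefficients\<close>

text \<open>Denominators are tied to a power of lcm(1, ..., l): this shape is monotone in l, so it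
  also serves all smaller indices, and it passes to products. The exponential size of the lcm enters
  only in \<open>auxiliary_form\<close>.\<close>

definition e_fun :: "real fps \<Rightarrow> bool" where
  "e_fun f \<longleftrightarrow> (\<exists>C e :: nat. C \<ge> 1 \<and> (\<forall>l. \<bar>fact l * fps_nth f l\<bar> \<le> real C ^ l) \<and>
     (\<forall>l. real (Lcm {1..l}) ^ e * (fact l * fps_nth f l) \<in> \<int>))"

lemma e_fun_1 [simp]: "e_fun 1"
  unfolding e_fun_def by (intro exI[of _ 1] exI[of _ 0]) auto

lemma fact_mult_nth_mult:
  fixes f g :: "real fps"
  shows "fact l * fps_nth (f * g) l =
    (\<Sum>i\<le>l. real (l choose i) * (fact i * fps_nth f i) * (fact (l - i) * fps_nth g (l - i)))"
  unfolding fps_mult_nth sum_distrib_left atLeast0AtMost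
  by (intro sum.cong refl) (simp add: binomial_fact field_simps)

lemma Lcm_power_mult_Ints:
  assumes "real (Lcm {1..i}) ^ e * x \<in> \<int>" "i \<le> l"
  shows "real (Lcm {1..l}) ^ e * x \<in> \<int>"
proof -
  have "Lcm {1..i} dvd Lcm {1..l}"
    using assms by (intro Lcm_subset) auto
  then obtain k where k: "Lcm {1..l} = Lcm {1..i} * k" ..
  have eq: "real (Lcm {1..l}) ^ e * x = real k ^ e * (real (Lcm {1..i}) ^ e * x)"
    unfolding k by (simp add: power_mult_distrib)
  show ?thesis
    unfolding eq by (rule Ints_mult[OF _ assms(1)]) simp
qed

text \<open>After multiplication by l! the product is a binomial convolution, so the growth
  constants add by the binomial theorem, and the exponents of the lcm add.\<close>

lemma e_fun_mult:
  assumes "e_fun f" "e_fun g"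
  shows "e_fun (f * g)"
proof -
  obtain C e where C: "C \<ge> 1" "\<And>l. \<bar>fact l * fps_nth f l\<bar> \<le> real C ^ l"
    "\<And>l. real (Lcm {1..l}) ^ e * (fact l * fps_nth f l) \<in> \<int>"
    using assms(1) unfolding e_fun_def by blast
  obtain D d where D: "D \<ge> 1" "\<And>l. \<bar>fact l * fps_nth g l\<bar> \<le> real D ^ l"
    "\<And>l. real (Lcm {1..l}) ^ d * (fact l * fps_nth g l) \<in> \<int>"
    using assms(2) unfolding e_fun_def by blast
  have bound: "\<bar>fact l * fps_nth (f * g) l\<bar> \<le> real (C + D) ^ l" for l
  proof -
    have "\<bar>fact l * fps_nth (f * g) l\<bar> \<le> (\<Sum>i\<le>l. real (l choose i) * real C ^ i * real D ^ (l - i))"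
      unfolding fact_mult_nth_mult
    proof (rule order.trans[OF sum_abs], intro sum_mono)
      fix i
      show "\<bar>real (l choose i) * (fact i * fps_nth f i) * (fact (l - i) * fps_nth g (l - i))\<bar> \<le>
          real (l choose i) * real C ^ i * real D ^ (l - i)"
        unfolding abs_mult[of "_ * _" "_ * _"] abs_mult[of "real _"]
        by (intro mult_mono C D) (use C D in auto)
    qed
    also have "\<dots> = real (C + D) ^ l"
      unfolding of_nat_add binomial_ring ..
    finally show ?thesis .
  qed
  have int: "real (Lcm {1..l}) ^ (e + d) * (fact l * fps_nth (f * g) l) \<in> \<int>" for l
  proof -
    have "real (Lcm {1..l}) ^ (e + d) * (fact l * fps_nth (f * g) l) =
       (\<Sum>i\<le>l. real (l choose i) * (real (Lcm {1..l}) ^ e * (fact i * fps_nth f i)) *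
         (real (Lcm {1..l}) ^ d * (fact (l - i) * fps_nth g (l - i))))"
      unfolding fact_mult_nth_mult sum_distrib_left power_add
      by (intro sum.cong refl) (simp only: mult_ac)
    also have "\<dots> \<in> \<int>"
      by (intro Ints_sum Ints_mult Lcm_power_mult_Ints[OF C(3)] Lcm_power_mult_Ints[OF D(3)]) auto
    finally show ?thesis .
  qed
  show ?thesis
    unfolding e_fun_def using bound int C(1) by (intro exI[of _ "C + D"] exI[of _ "e + d"]) auto
qed

lemma e_fun_power: "e_fun f \<Longrightarrow> e_fun (f ^ k)"
  by (induction k) (simp_all add: e_fun_mult)

lemma e_fun_prod: "(\<And>i. i \<in> S \<Longrightarrow> e_fun (f i)) \<Longrightarrow> e_fun (prod f S)"
  by (induction S rule: infinite_finite_induct) (simp_all add: e_fun_mult)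

lemma e_fun_conv_radius:
  assumes "e_fun f"
  shows "fps_conv_radius f = \<infinity>"
proof -
  obtain C :: nat where C: "\<And>l. \<bar>fact l * fps_nth f l\<bar> \<le> real C ^ l"
    using assms unfolding e_fun_def by blast
  show ?thesis
    unfolding fps_conv_radius_def
  proof (rule conv_radius_inftyI'')
    fix z :: real
    have "norm (fps_nth f l * z ^ l) \<le> inverse (fact l) * (real C * \<bar>z\<bar>) ^ l" for l
    proof -
      have "norm (fps_nth f l * z ^ l) = inverse (fact l) * (\<bar>fact l * fps_nth f l\<bar> * \<bar>z\<bar> ^ l)"
        by (simp add: abs_mult power_abs)
      also have "\<dots> \<le> inverse (fact l) * (real C ^ l * \<bar>z\<bar> ^ l)"
        using C by (intro mult_left_mono mult_right_mono) auto
      finally show ?thesis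
        by (simp add: power_mult_distrib)
    qed
    then show "summable (\<lambda>l. fps_nth f l * z ^ l)"
      by (intro summable_comparison_test'[OF summable_exp[of "real C * \<bar>z\<bar>"], of 0]) auto
  qed
qed

lemma e_fun_uniform:
  fixes M :: nat
  assumes "\<And>i. i < M \<Longrightarrow> e_fun (w i)"
  shows "\<exists>C e :: nat. C \<ge> 1 \<and> (\<forall>i<M. \<forall>l. \<bar>fact l * fps_nth (w i) l\<bar> \<le> real C ^ l \<and>
     real (Lcm {1..l}) ^ e * (fact l * fps_nth (w i) l) \<in> \<int>)"
  using assms
proof (induction M)
  case (Suc M)
  then obtain C e :: nat where C: "C \<ge> 1" "\<And>i l. i < M \<Longrightarrow> \<bar>fact l * fps_nth (w i) l\<bar> \<le> real C ^ l"
     "\<And>i l. i < M \<Longrightarrow> real (Lcm {1..l}) ^ e * (fact l * fps_nth (w i) l) \<in> \<int>"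
    by (metis less_Suc_eq)
  obtain D d :: nat where D: "D \<ge> 1" "\<And>l. \<bar>fact l * fps_nth (w M) l\<bar> \<le> real D ^ l"
    "\<And>l. real (Lcm {1..l}) ^ d * (fact l * fps_nth (w M) l) \<in> \<int>"
    using Suc.prems[of M] unfolding e_fun_def by blast
  have "real C ^ l \<le> real (C + D) ^ l" "real D ^ l \<le> real (C + D) ^ l" for l
    by (intro power_mono; simp)+
  then have 1: "\<bar>fact l * fps_nth (w i) l\<bar> \<le> real (C + D) ^ l" if "i < Suc M" for i l
    using C(2)[of i l] D(2)[of l] that by (metis less_Suc_eq order.trans)
  have 2: "real (Lcm {1..l}) ^ (e + d) * (fact l * fps_nth (w i) l) \<in> \<int>" if "i < Suc M" for i l
  proof (cases "i = M")
    case True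
    have "real (Lcm {1..l}) ^ e * (real (Lcm {1..l}) ^ d * (fact l * fps_nth (w i) l)) \<in> \<int>"
      by (rule Ints_mult) (use D(3)[of l] True in simp_all)
    then show ?thesis
      by (simp add: power_add mult_ac)
  next
    case False
    have "real (Lcm {1..l}) ^ d * (real (Lcm {1..l}) ^ e * (fact l * fps_nth (w i) l)) \<in> \<int>"
      by (rule Ints_mult) (use C(3)[of i l] False that in simp_all)
    then show ?thesis
      by (simp add: power_add mult_ac)
  qed
  show ?case
    using 1 2 C(1) by (intro exI[of _ "C + D"] exI[of _ "e + d"]) auto
qed (auto intro: exI[of _ 1])

lemma eval_fps_sum_entire:
  fixes f :: "'i \<Rightarrow> real fps"
  assumes "\<And>i. i \<in> S \<Longrightarrow> fps_conv_radius (f i) = \<infinity>"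
  shows "fps_conv_radius (sum f S) = \<infinity> \<and> eval_fps (sum f S) z = (\<Sum>i\<in>S. eval_fps (f i) z)"
  using assms
proof (induction S rule: infinite_finite_induct)
  case (insert i S)
  then have *: "fps_conv_radius (f i) = \<infinity>" "fps_conv_radius (sum f S) = \<infinity>"
      "eval_fps (sum f S) z = (\<Sum>i\<in>S. eval_fps (f i) z)"
    by auto
  have "fps_conv_radius (f i + sum f S) = \<infinity>"
    using fps_conv_radius_add[of "f i" "sum f S"] * by simp
  with * insert show ?case
    by (simp add: eval_fps_add)
qed auto

section \<open>Lengths of polynomials and estimates from the exponential series\<close>

definition pnorm :: "real poly \<Rightarrow> real" where
  "pnorm p = (\<Sum>k\<le>degree p. \<bar>coeff p k\<bar>)"

lemma pnorm_eq: "degree p \<le> D \<Longrightarrow> pnorm p = (\<Sum>k\<le>D. \<bar>coeff p k\<bar>)"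
  unfolding pnorm_def by (intro sum.mono_neutral_left) (auto simp: coeff_eq_0)

lemma pnorm_nonneg: "pnorm p \<ge> 0"
  unfolding pnorm_def by (intro sum_nonneg) auto

lemma pnorm_add_le: "pnorm (p + q) \<le> pnorm p + pnorm q"
proof -
  define D where "D = max (degree p) (degree q)"
  have "pnorm (p + q) = (\<Sum>k\<le>D. \<bar>coeff p k + coeff q k\<bar>)"
    by (subst pnorm_eq[of _ D]) (auto simp: D_def intro: degree_add_le)
  also have "\<dots> \<le> (\<Sum>k\<le>D. \<bar>coeff p k\<bar> + \<bar>coeff q k\<bar>)"
    by (intro sum_mono) auto
  also have "\<dots> = pnorm p + pnorm q"
    by (simp add: sum.distrib pnorm_eq[of p D] pnorm_eq[of q D] D_def)
  finally show ?thesis .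
qed

lemma pnorm_0 [simp]: "pnorm 0 = 0"
  by (simp add: pnorm_def)

lemma pnorm_sum_le: "pnorm (sum f S) \<le> (\<Sum>s\<in>S. pnorm (f s))"
proof (induction S rule: infinite_finite_induct)
  case (insert s S)
  then show ?case
    using pnorm_add_le[of "f s" "sum f S"] by simp
qed auto

lemma pnorm_smult: "pnorm (smult c p) = \<bar>c\<bar> * pnorm p"
  by (subst pnorm_eq[of _ "degree p"]) (auto simp: degree_smult_le pnorm_def abs_mult sum_distrib_left)

lemma pnorm_pCons_0: "pnorm (pCons 0 p) = pnorm p"
proof -
  have "pnorm (pCons 0 p) = (\<Sum>k\<le>Suc (degree p). \<bar>coeff (pCons 0 p) k\<bar>)"
    by (rule pnorm_eq) (rule degree_pCons_le)
  also have "\<dots> = pnorm p"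
    by (simp only: sum.atMost_Suc_shift coeff_pCons_Suc coeff_pCons_0 pnorm_def abs_zero add_0)
  finally show ?thesis .
qed

lemma pnorm_theta_le: "degree p \<le> D \<Longrightarrow> pnorm (theta p) \<le> real D * pnorm p"
  by (subst (1 2) pnorm_eq[of _ D])
     (auto simp: coeff_theta abs_mult sum_distrib_left intro!: sum_mono mult_right_mono
        intro: order.trans[OF degree_theta_le])

lemma abs_poly_1_le_pnorm: "\<bar>poly p 1\<bar> \<le> pnorm p"
  by (simp add: poly_altdef pnorm_def sum_abs)

lemma pnorm_monom_le: "pnorm (monom c n) \<le> \<bar>c\<bar>"
proof -
  have "pnorm (monom c n) = (\<Sum>k\<le>n. \<bar>coeff (monom c n) k\<bar>)"
    by (rule pnorm_eq) (rule degree_monom_le)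
  also have "\<dots> = (\<Sum>k\<le>n. if k = n then \<bar>c\<bar> else 0)"
    by (intro sum.cong) auto
  finally show ?thesis
    by simp
qed

lemma exp_tail_le:
  fixes x :: real
  assumes "x \<ge> 0"
  shows "summable (\<lambda>l. x ^ (l + L) / fact (l + L))"
    "suminf (\<lambda>l. x ^ (l + L) / fact (l + L)) \<le> x ^ L / fact L * exp x"
proof -
  have s: "summable (\<lambda>l. x ^ l / fact l)"
    using summable_exp[of x] by (simp add: field_simps)
  then show s': "summable (\<lambda>l. x ^ (l + L) / fact (l + L))"
    by (subst summable_iff_shift)
  have "suminf (\<lambda>l. x ^ (l + L) / fact (l + L)) \<le> suminf (\<lambda>l. x ^ L / fact L * (x ^ l / fact l))"
  proof (intro suminf_le s' summable_mult s)
    fix l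
    have "fact l * fact L \<le> (fact (l + L) :: real)"
      by (metis dvd_imp_le fact_fact_dvd_fact fact_gt_zero of_nat_fact of_nat_le_iff of_nat_mult)
    then show "x ^ (l + L) / fact (l + L) \<le> x ^ L / fact L * (x ^ l / fact l)"
      using assms by (simp add: power_add frac_le mult.commute)
  qed
  also have "\<dots> = x ^ L / fact L * suminf (\<lambda>l. x ^ l / fact l)"
    by (rule suminf_mult[OF s])
  also have "suminf (\<lambda>l. x ^ l / fact l) = exp x"
    by (simp add: exp_def scaleR_conv_of_real divide_inverse mult.commute)
  finally show "suminf (\<lambda>l. x ^ (l + L) / fact (l + L)) \<le> x ^ L / fact L * exp x" .
qed

text \<open>One term of the exponential series is at most the whole sum. This trades a power with a
  large exponent for a factorial and an exponential.\<close>

lemma power_le_fact_exp: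
  fixes x :: real
  assumes "x \<ge> 0"
  shows "x ^ k \<le> fact k * exp x"
proof -
  have "x ^ k / fact k \<le> suminf (\<lambda>l. x ^ l / fact l)"
    using summable_exp[of x] assms
    by (intro order.trans[OF _ sum_le_suminf[of _ "{k}"]]) (auto simp: field_simps)
  also have "suminf (\<lambda>l. x ^ l / fact l) = exp x"
    by (simp add: exp_def scaleR_conv_of_real divide_inverse mult.commute)
  finally show ?thesis
    by (simp add: field_simps)
qed

context triangular_system
begin

lemma Dvs_Ints:
  assumes "\<And>i k. i < M \<Longrightarrow> coeff (p i) k \<in> \<int>" "i < M"
  shows "coeff ((Dv ^^ n) p i) k \<in> \<int>"
  using assms(2)
proof (induction n arbitrary: i k)
  case (Suc n)
  have "coeff ([:0, of_int (be i):] * (Dv ^^ n) p i) k \<in> \<int>"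
    using Suc by (cases k) (auto intro!: Ints_mult)
  then show ?case
    using Suc unfolding funpow.simps o_def Dv_def[of "(Dv ^^ n) p"]
    by (auto simp: coeff_sum coeff_theta simp del: mult_pCons_left intro!: Ints_add Ints_sum Ints_mult)
qed (use assms in simp)

text \<open>A crude bound shared by all coordinates; what matters is that it depends on the system
  alone.\<close>

definition size_A :: nat where
  "size_A = nat (\<Sum>i<M. \<Sum>j<M. \<bar>A0 j i\<bar>) + nat (\<Sum>i<M. \<bar>be i\<bar>)"

lemma pnorm_Dv_le:
  assumes b: "\<And>j. j < M \<Longrightarrow> pnorm (p j) \<le> b" and deg: "degree (p i) \<le> D" and i: "i < M"
  shows "pnorm (Dv p i) \<le> real (D + size_A) * b"
proof -
  have b0: "b \<ge> 0"
    using b[OF i] pnorm_nonneg[of "p i"] by linarith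
  have 1: "pnorm (theta (p i)) \<le> real D * b"
    using pnorm_theta_le[OF deg] b[OF i] by (meson mult_left_mono of_nat_0_le_iff order.trans)
  have 2: "pnorm (\<Sum>j<M. smult (of_int (A0 j i)) (p j)) \<le> of_int (\<Sum>j<M. \<bar>A0 j i\<bar>) * b"
  proof -
    have "pnorm (\<Sum>j<M. smult (of_int (A0 j i)) (p j)) \<le> (\<Sum>j<M. \<bar>of_int (A0 j i)\<bar> * pnorm (p j))"
      using pnorm_sum_le[of "\<lambda>j. smult (of_int (A0 j i)) (p j)" "{..<M}"] by (simp only: pnorm_smult)
    also have "\<dots> \<le> (\<Sum>j<M. \<bar>of_int (A0 j i)\<bar> * b)"
      using b by (intro sum_mono mult_left_mono) auto
    finally show ?thesis
      by (simp add: sum_distrib_right)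
  qed
  have 3: "pnorm ([:0, of_int (be i):] * p i) \<le> of_int \<bar>be i\<bar> * b"
  proof -
    have "[:0, of_int (be i):] * p i = smult (of_int (be i)) (pCons 0 (p i))"
      by simp
    then show ?thesis
      using b[OF i] by (simp only: pnorm_smult pnorm_pCons_0) (auto intro: mult_left_mono)
  qed
  have "(\<Sum>j<M. \<bar>A0 j i\<bar>) \<le> (\<Sum>i<M. \<Sum>j<M. \<bar>A0 j i\<bar>)"
    using i by (intro member_le_sum[of i "{..<M}" "\<lambda>i. \<Sum>j<M. \<bar>A0 j i\<bar>"]) (auto intro: sum_nonneg)
  moreover have "\<bar>be i\<bar> \<le> (\<Sum>i<M. \<bar>be i\<bar>)"
    using i by (intro member_le_sum[of i "{..<M}" "\<lambda>i. \<bar>be i\<bar>"]) auto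
  ultimately have "(\<Sum>j<M. \<bar>A0 j i\<bar>) + \<bar>be i\<bar> \<le> int size_A"
    unfolding size_A_def by linarith
  then have A: "of_int ((\<Sum>j<M. \<bar>A0 j i\<bar>) + \<bar>be i\<bar>) \<le> real size_A"
    by (metis of_int_le_iff of_int_of_nat_eq)
  have "pnorm (Dv p i) \<le> real D * b + of_int (\<Sum>j<M. \<bar>A0 j i\<bar>) * b + of_int \<bar>be i\<bar> * b"
    unfolding Dv_def by (intro order.trans[OF pnorm_add_le] add_mono 1 2 3)
  also have "\<dots> = real D * b + of_int ((\<Sum>j<M. \<bar>A0 j i\<bar>) + \<bar>be i\<bar>) * b"
    by (simp add: algebra_simps)
  also have "\<dots> \<le> real D * b + real size_A * b"
    using A b0 by (intro add_mono mult_right_mono) auto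
  finally show ?thesis
    by (simp add: algebra_simps)
qed

lemma pnorm_Dvs_le:
  assumes b: "\<And>j. j < M \<Longrightarrow> pnorm (p j) \<le> b" and deg: "\<And>j. j < M \<Longrightarrow> degree (p j) \<le> N"
    and "n \<le> t" "i < M"
  shows "pnorm ((Dv ^^ n) p i) \<le> real (N + t + size_A) ^ n * b"
  using assms(3,4)
proof (induction n arbitrary: i)
  case (Suc n)
  have "degree ((Dv ^^ n) p i) \<le> N + n"
    using deg Suc.prems by (intro degree_Dvs_le) auto
  then have "degree ((Dv ^^ n) p i) \<le> N + t"
    using Suc.prems by linarith
  then have "pnorm (Dv ((Dv ^^ n) p) i) \<le> real (N + t + size_A) * (real (N + t + size_A) ^ n * b)"
    using Suc by (intro pnorm_Dv_le) auto
  then show ?case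
    by (simp add: mult.assoc)
qed (use b in simp)

lemma eval_lin:
  assumes "\<And>i. i < M \<Longrightarrow> fps_conv_radius (w i) = \<infinity>"
  shows "fps_conv_radius (lin p) = \<infinity> \<and> eval_fps (lin p) 1 = (\<Sum>i<M. poly (p i) 1 * eval_fps (w i) 1)"
proof -
  have *: "fps_conv_radius (fps_of_poly (p i) * w i) = \<infinity>" if "i < M" for i
    using fps_conv_radius_mult[of "fps_of_poly (p i)" "w i"] assms[OF that] by simp
  have "eval_fps (fps_of_poly (p i) * w i) 1 = poly (p i) 1 * eval_fps (w i) 1" if "i < M" for i
    using assms[OF that] by (subst eval_fps_mult) auto
  with * show ?thesis
    unfolding lin_def using eval_fps_sum_entire[of "{..<M}" "\<lambda>i. fps_of_poly (p i) * w i" 1] by simp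
qed

end

lemma dt_Ints: "(\<And>i j. i < n \<Longrightarrow> j < n \<Longrightarrow> f i j \<in> \<int>) \<Longrightarrow> dt n f \<in> (\<int> :: real set)"
  unfolding dt_leibniz
  by (intro Ints_sum Ints_mult Ints_prod) (auto dest: permutes_in_image[of _ "{..<n}"])

text \<open>The row \<open>l0\<close> has the zero entry in column \<open>i1\<close>, so every nonzero term of the expansion takes
  its entry in column \<open>i1\<close> from one of the other rows.\<close>

lemma abs_dt_le:
  fixes f :: "nat \<Rightarrow> nat \<Rightarrow> real"
  assumes l0: "l0 < M" and i1: "i1 < M" and z: "f l0 i1 = 0"
    and q: "\<And>j. j < M \<Longrightarrow> \<bar>f l0 j\<bar> \<le> q" and q0: "q \<ge> 0"
    and r: "\<And>i. i < M \<Longrightarrow> i \<noteq> l0 \<Longrightarrow> \<bar>f i i1\<bar> \<le> r" and r0: "r \<ge> 0"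
    and b: "\<And>i j. i < M \<Longrightarrow> i \<noteq> l0 \<Longrightarrow> j < M \<Longrightarrow> j \<noteq> i1 \<Longrightarrow> \<bar>f i j\<bar> \<le> b" and b0: "b \<ge> 0"
  shows "\<bar>dt M f\<bar> \<le> fact M * (q * r * b ^ (M - 2))"
proof -
  have summand: "\<bar>of_int (sign p) * (\<Prod>i<M. f i (p i))\<bar> \<le> q * r * b ^ (M - 2)"
    if p: "p permutes {..<M}" for p
  proof -
    have "\<bar>of_int (sign p) * (\<Prod>i<M. f i (p i))\<bar> = (\<Prod>i<M. \<bar>f i (p i)\<bar>)"
      by (simp add: abs_mult sign_def abs_prod)
    also have "\<dots> \<le> q * r * b ^ (M - 2)"
    proof (cases "p l0 = i1")
      case True
      then have "(\<Prod>i<M. \<bar>f i (p i)\<bar>) = 0"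
        using l0 z by (intro prod_zero bexI[of _ l0]) auto
      also have "0 \<le> q * r * b ^ (M - 2)"
        using q0 r0 b0 by simp
      finally show ?thesis .
    next
      case False
      obtain k where pk: "p k = i1"
        using permutes_surj[OF p] by (metis surjD)
      then have k: "k < M" "k \<noteq> l0"
        using permutes_in_image[OF p, of k] i1 False by auto
      have "(\<Prod>i<M. \<bar>f i (p i)\<bar>) = \<bar>f l0 (p l0)\<bar> * (\<bar>f k (p k)\<bar> * (\<Prod>i\<in>{..<M} - {l0} - {k}. \<bar>f i (p i)\<bar>))"
        using k l0 by (subst prod.remove[of _ l0], simp, simp, subst prod.remove[of _ k]) auto
      also have "\<dots> \<le> q * (r * (\<Prod>i\<in>{..<M} - {l0} - {k}. b))"
      proof (intro mult_mono prod_mono conjI prod_nonneg ballI)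
        show "\<bar>f l0 (p l0)\<bar> \<le> q"
          using q[of "p l0"] permutes_in_image[OF p, of l0] l0 by simp
        show "\<bar>f k (p k)\<bar> \<le> r"
          using r k pk by simp
        fix i assume i: "i \<in> {..<M} - {l0} - {k}"
        then have "p i \<noteq> i1"
          using pk permutes_inj[OF p] by (metis DiffE injD insertI1)
        then show "\<bar>f i (p i)\<bar> \<le> b"
          using b[of i "p i"] i permutes_in_image[OF p, of i] by simp
      qed (use q0 r0 in \<open>auto intro!: mult_nonneg_nonneg prod_nonneg\<close>)
      also have "(\<Prod>i\<in>{..<M} - {l0} - {k}. b) = b ^ (M - 2)"
        using k l0 by (simp add: card_Diff_singleton numeral_2_eq_2)
      finally show ?thesis
        by (simp add: mult.assoc)
    qed
    finally show ?thesis .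
  qed
  have "\<bar>dt M f\<bar> \<le> (\<Sum>p | p permutes {..<M}. \<bar>of_int (sign p) * (\<Prod>i<M. f i (p i))\<bar>)"
    unfolding dt_leibniz by (rule sum_abs)
  also have "\<dots> \<le> (\<Sum>p | p permutes {..<M}. q * r * b ^ (M - 2))"
    using summand by (intro sum_mono) auto
  also have "\<dots> = fact M * (q * r * b ^ (M - 2))"
    by (simp add: card_permutations)
  finally show ?thesis .
qed

lemma fact_power_le_fact_mult: "fact s ^ M \<le> (fact (M * s) :: real)"
proof (induction M)
  case (Suc M)
  have "fact s * fact (M * s) \<le> (fact (s + M * s) :: real)"
    by (metis dvd_imp_le fact_fact_dvd_fact fact_gt_zero of_nat_fact of_nat_le_iff of_nat_mult)
  then show ?case
    using mult_left_mono[OF Suc fact_ge_zero, of s] unfolding power_Suc mult_Suc by linarith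
qed simp

lemma fact_add_le: "fact (s + c) \<le> fact s * real (s + c) ^ c"
proof (induction c)
  case (Suc c)
  have "real (s + c) ^ c \<le> real (s + Suc c) ^ c"
    by (intro power_mono) auto
  then have "fact s * real (s + c) ^ c \<le> fact s * real (s + Suc c) ^ c"
    by (intro mult_left_mono) auto
  with Suc have "fact (s + c) \<le> fact s * real (s + Suc c) ^ c"
    by linarith
  then have "real (s + Suc c) * fact (s + c) \<le> real (s + Suc c) * (fact s * real (s + Suc c) ^ c)"
    by (intro mult_left_mono) auto
  then show ?case
    by (simp add: algebra_simps)
qed simp

context triangular_system
begin

section \<open>The auxiliary form\<close>

text \<open>Siegel's lemma for M n unknowns and L = M n - s equations: the surplus of unknowns is s,
  and L <= M n = M (M + 1) s yields the exponent M (M + 1) in \<open>B\<close>.\<close>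

lemma auxiliary_form:
  fixes C e s :: nat
  assumes C: "C \<ge> 1" and bound: "\<And>i l. i < M \<Longrightarrow> \<bar>fact l * fps_nth (w i) l\<bar> \<le> real C ^ l"
    and int: "\<And>i l. i < M \<Longrightarrow> real (Lcm {1..l}) ^ e * (fact l * fps_nth (w i) l) \<in> \<int>"
    and M: "M \<ge> 1" and s: "s \<ge> 1"
    and n: "n = (M + 1) * s" and L: "L = M * n - s"
    and B: "B = (2 * (M * n) * (2 * 64 ^ e * C) ^ (M * n)) ^ (M * (M + 1))"
  shows "\<exists>R. (\<exists>i<M. R i \<noteq> 0) \<and> (\<forall>i<M. degree (R i) \<le> n) \<and> (\<forall>i<M. \<forall>k. coeff (R i) k \<in> \<int>) \<and>
    (\<forall>l<L. fps_nth (lin R) l = 0) \<and> (\<forall>i<M. pnorm (R i) \<le> fact n * real (M * n * B)) \<and>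
    (\<forall>l. \<bar>fps_nth (lin R) l\<bar> \<le> fact n * real (M * n * B) * (2 * real C) ^ l / fact l)"
proof -
  define X where "X = {..<M} \<times> {..<n}"
  \<comment> \<open>Bounds the integer coefficients of the system: \<open>64 ^ e\<close> per order
    from the lcm, 2 from the binomial coefficient, \<open>C\<close> from the growth of the
    functions.\<close>
  define H where "H = (2 * 64 ^ e * C) ^ (M * n)"
  define d where "d = real (Lcm {1..L}) ^ e"
  define bb where "bb = (\<lambda>l (i, j). if j \<le> l
    then real (l choose j) * (fact (l - j) * fps_nth (w i) (l - j)) else 0)"
  \<comment> \<open>In the range needed the number is already an integer, as \<open>a_eq\<close>
    shows; the floor only moves it to type \<open>int\<close>.\<close>
  define a where "a = (\<lambda>l x. \<lfloor>d * bb l x\<rfloor>)"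
  have d0: "d \<noteq> 0"
    by (auto simp: d_def Lcm_0_iff)
  have sMn: "s \<le> M * n"
  proof -
    have "1 \<le> M * (M + 1)"
      using M by simp
    from mult_le_mono1[OF this, of s] show ?thesis
      by (simp only: n mult.assoc mult_1)
  qed
  have n1: "n \<ge> 1"
    using s unfolding n by simp
  have bb_le: "\<bar>bb l x\<bar> \<le> (2 * real C) ^ l" if "x \<in> X" for l x
  proof (cases "snd x \<le> l")
    case True
    obtain i j where x: "x = (i, j)"
      by (cases x)
    have "\<bar>bb l x\<bar> = real (l choose j) * \<bar>fact (l - j) * fps_nth (w i) (l - j)\<bar>"
      using True by (simp add: bb_def x abs_mult)
    also have "\<dots> \<le> 2 ^ l * real C ^ l"
    proof (intro mult_mono)
      show "real (l choose j) \<le> 2 ^ l"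
        using binomial_le_pow2[of l j] by (metis of_nat_le_iff of_nat_numeral of_nat_power)
      have "\<bar>fact (l - j) * fps_nth (w i) (l - j)\<bar> \<le> real C ^ (l - j)"
        using bound that by (auto simp: X_def x)
      also have "\<dots> \<le> real C ^ l"
        using C by (intro power_increasing) auto
      finally show "\<bar>fact (l - j) * fps_nth (w i) (l - j)\<bar> \<le> real C ^ l" .
    qed auto
    finally show ?thesis
      by (simp add: power_mult_distrib)
  qed (auto simp: bb_def split: prod.splits)
  have a_eq: "real_of_int (a l x) = d * bb l x" if "x \<in> X" "l < L" for l x
  proof -
    have "d * bb l x \<in> \<int>"
    proof (cases "snd x \<le> l")
      case True
      obtain i j where x: "x = (i, j)"
        by (cases x)
      have i: "i < M"
        using that by (simp add: X_def x)
      have "d * (fact (l - j) * fps_nth (w i) (l - j)) \<in> \<int>"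
        unfolding d_def by (rule Lcm_power_mult_Ints[OF int[OF i]]) (use that in auto)
      then have "real (l choose j) * (d * (fact (l - j) * fps_nth (w i) (l - j))) \<in> \<int>"
        by (intro Ints_mult[of "real (l choose j)"]) auto
      then show ?thesis
        using True by (simp add: bb_def x mult_ac)
    qed (auto simp: bb_def split: prod.splits)
    then show ?thesis
      unfolding a_def by (metis Ints_cases floor_of_int)
  qed
  have "card X = M * n"
    by (simp add: X_def)
  have "\<exists>p. (\<exists>x\<in>X. p x \<noteq> 0) \<and> (\<forall>l\<in>{..<L}. (\<Sum>x\<in>X. a l x * p x) = 0) \<and>
      (\<forall>x\<in>X. \<bar>p x\<bar> \<le> int ((2 * card X * H) ^ (M * (M + 1))))"
  proof (rule siegel_lemma)
    show "H \<ge> 1"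
      using C by (simp add: H_def)
    show "\<bar>a l x\<bar> \<le> int H" if "l \<in> {..<L}" "x \<in> X" for l x
    proof -
      have "\<bar>d * bb l x\<bar> = d * \<bar>bb l x\<bar>"
        by (simp add: abs_mult d_def)
      also have "\<dots> \<le> (64 ^ L) ^ e * (2 * real C) ^ L"
      proof (intro mult_mono)
        have "real (Lcm {1..L}) \<le> 64 ^ L"
          using Lcm_upto_le[of L] by (metis of_nat_le_iff of_nat_numeral of_nat_power)
        then show "d \<le> (64 ^ L) ^ e"
          unfolding d_def by (intro power_mono) auto
        have "(2 * real C) ^ l \<le> (2 * real C) ^ L"
          using that C by (intro power_increasing) auto
        then show "\<bar>bb l x\<bar> \<le> (2 * real C) ^ L"
          using bb_le[OF that(2), of l] by linarith
      qed auto
      also have "\<dots> = (2 * 64 ^ e * real C) ^ L"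
        by (simp add: power_mult_distrib power_mult[symmetric] mult_ac)
      also have "\<dots> \<le> (2 * 64 ^ e * real C) ^ (M * n)"
      proof (intro power_increasing)
        have "1 * 1 \<le> 64 ^ e * real C"
          using C by (intro mult_mono) auto
        then show "1 \<le> 2 * 64 ^ e * real C"
          by simp
      qed (simp add: L)
      finally have "\<bar>real_of_int (a l x)\<bar> \<le> real H"
        using a_eq that by (simp add: H_def)
      then show ?thesis
        by linarith
    qed
    show "card {..<L} < card X"
      using s sMn by (simp add: \<open>card X = M * n\<close> L)
    show "card {..<L} \<le> M * (M + 1) * (card X - card {..<L})"
    proof -
      have "card X - card {..<L} = s"
        using sMn by (simp add: \<open>card X = M * n\<close> L)
      moreover have "card {..<L} \<le> M * n"
        by (simp add: L)
      ultimately show ?thesis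
        by (simp only: n mult.assoc)
    qed
  qed (auto simp: X_def)
  then obtain p where p: "\<exists>x\<in>X. p x \<noteq> 0" "\<And>l. l < L \<Longrightarrow> (\<Sum>x\<in>X. a l x * p x) = 0"
      "\<And>x. x \<in> X \<Longrightarrow> \<bar>p x\<bar> \<le> int B"
    unfolding B H_def \<open>card X = M * n\<close> by auto
  \<comment> \<open>The factor \<open>n! / j!\<close> turns the vanishing conditions into equations for \<open>p\<close> whose coefficients
    grow only exponentially.\<close>
  define c where "c = (\<lambda>i j. fact n / fact j * real_of_int (p (i, j)))"
  define R where "R = (\<lambda>i. \<Sum>j<n. monom (c i j) j)"
  have coeff_R: "coeff (R i) k = (if k < n then c i k else 0)" for i k
    by (simp add: R_def coeff_sum)
  have pB: "\<bar>real_of_int (p (i, j))\<bar> \<le> real B" if "i < M" "j < n" for i j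
    using p(3)[of "(i, j)"] that by (simp add: X_def)
  have lin_R: "fps_nth (lin R) l = fact n / fact l * (\<Sum>x\<in>X. bb l x * real_of_int (p x))" for l
  proof -
    have "fps_nth (fps_of_poly (R i) * w i) l =
        fact n / fact l * (\<Sum>j<n. bb l (i, j) * real_of_int (p (i, j)))" for i
    proof -
      have "fps_nth (fps_of_poly (R i) * w i) l = (\<Sum>j\<le>l. coeff (R i) j * fps_nth (w i) (l - j))"
        by (simp add: fps_mult_nth atLeast0AtMost)
      also have "\<dots> = (\<Sum>j<n. if j \<le> l then c i j * fps_nth (w i) (l - j) else 0)"
        unfolding coeff_R
        by (intro sum.mono_neutral_cong) auto
      also have "\<dots> = (\<Sum>j<n. fact n / fact l * (bb l (i, j) * real_of_int (p (i, j))))"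
        by (intro sum.cong refl) (simp add: bb_def c_def binomial_fact field_simps)
      finally show ?thesis
        by (simp only: sum_distrib_left)
    qed
    then show ?thesis
      unfolding lin_def fps_sum_nth X_def
      by (simp add: sum_distrib_left sum.cartesian_product split_def)
  qed
  have sum_le: "\<bar>\<Sum>x\<in>X. bb l x * real_of_int (p x)\<bar> \<le> real (M * n * B) * (2 * real C) ^ l" for l
  proof -
    have "\<bar>\<Sum>x\<in>X. bb l x * real_of_int (p x)\<bar> \<le> (\<Sum>x\<in>X. (2 * real C) ^ l * real B)"
    proof (rule order.trans[OF sum_abs], rule sum_mono)
      fix x assume x: "x \<in> X"
      then show "\<bar>bb l x * real_of_int (p x)\<bar> \<le> (2 * real C) ^ l * real B"
        unfolding abs_mult using bb_le[OF x, of l] pB[of "fst x" "snd x"]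
        by (intro mult_mono) (auto simp: X_def)
    qed
    then show ?thesis
      by (simp add: \<open>card X = M * n\<close> mult_ac)
  qed
  have nz: "\<exists>i<M. R i \<noteq> 0"
  proof -
    obtain i j where ij: "i < M" "j < n" "p (i, j) \<noteq> 0"
      using p(1) by (auto simp: X_def)
    then have "coeff (R i) j \<noteq> 0"
      by (simp add: coeff_R c_def)
    with ij show ?thesis
      by (intro exI[of _ i]) auto
  qed
  have deg: "degree (R i) \<le> n" for i
    by (rule degree_le) (simp add: coeff_R)
  have ints: "coeff (R i) k \<in> \<int>" for i k
  proof -
    have "fact n / fact k \<in> (\<int> :: real set)" if k: "k \<le> n" for k
    proof -
      obtain m :: nat where "fact n = fact k * m"
        using fact_dvd[OF k, where 'a = nat] by (auto elim: dvdE)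
      then have "(fact n :: real) = fact k * real m"
        by (metis of_nat_fact of_nat_mult)
      then show ?thesis
        by simp
    qed
    then have "fact n / fact k * real_of_int (p (i, k)) \<in> \<int>" if "k < n"
      by (rule Ints_mult) (use that in auto)
    then show ?thesis
      by (simp add: coeff_R c_def del: times_divide_eq_left)
  qed
  have van: "fps_nth (lin R) l = 0" if l: "l < L" for l
  proof -
    have "d * (\<Sum>x\<in>X. bb l x * real_of_int (p x)) = (\<Sum>x\<in>X. real_of_int (a l x * p x))"
      unfolding sum_distrib_left using a_eq l by (intro sum.cong refl) simp
    also have "\<dots> = 0"
      using p(2)[OF l] by (simp only: of_int_sum[symmetric] of_int_0)
    finally show ?thesis
      using d0 by (simp add: lin_R)
  qed
  have norm: "pnorm (R i) \<le> fact n * real (M * n * B)" if i: "i < M" for i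
  proof -
    have "pnorm (R i) \<le> (\<Sum>j<n. pnorm (monom (c i j) j))"
      unfolding R_def by (rule pnorm_sum_le)
    also have "\<dots> \<le> (\<Sum>j<n. fact n * real B)"
    proof (rule sum_mono)
      fix j assume j: "j \<in> {..<n}"
      have "fact n / fact j \<le> (fact n :: real)"
        by (simp add: divide_le_eq fact_ge_1)
      then have "\<bar>c i j\<bar> \<le> fact n * real B"
        unfolding c_def abs_mult using pB[of i j] i j by (intro mult_mono) auto
      then show "pnorm (monom (c i j) j) \<le> fact n * real B"
        using pnorm_monom_le[of "c i j" j] by linarith
    qed
    also have "\<dots> = fact n * real (n * B)"
      by simp
    also have "\<dots> \<le> fact n * real (M * n * B)"
    proof -
      have "1 * real (n * B) \<le> real M * real (n * B)"
        using M by (intro mult_right_mono) auto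
      then show ?thesis
        by (simp add: mult.assoc)
    qed
    finally show ?thesis .
  qed
  have "\<bar>fps_nth (lin R) l\<bar> \<le> fact n * real (M * n * B) * (2 * real C) ^ l / fact l" for l
    using mult_left_mono[OF sum_le[of l], of "fact n / fact l"] by (simp add: lin_R abs_mult)
  with nz deg ints van norm show ?thesis
    by blast
qed

end

lemma exists_power_less_fact:
  fixes K x :: real
  shows "\<exists>s\<ge>N. K * x ^ s < fact s"
proof -
  have "(\<lambda>s. x ^ s / fact s) \<longlonglongrightarrow> 0"
    using summable_exp[of x, THEN summable_LIMSEQ_zero] by (simp add: field_simps)
  then have "(\<lambda>s. K * (x ^ s / fact s)) \<longlonglongrightarrow> 0"
    by (rule tendsto_mult_right_zero)
  then have "eventually (\<lambda>s. K * (x ^ s / fact s) < 1) sequentially"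
    by (rule order_tendstoD) simp
  then obtain s0 where s0: "\<And>s. s \<ge> s0 \<Longrightarrow> K * (x ^ s / fact s) < 1"
    by (auto simp: eventually_sequentially)
  show ?thesis
    using s0[of "max s0 N"] by (intro exI[of _ "max s0 N"]) (auto simp: field_simps)
qed

context triangular_system
begin

section \<open>Small values, large determinant, contradiction\<close>

text \<open>Differentiation multiplies coefficient l by l^k <= k! e^l: the factorial goes into
  \<open>fact t\<close>, and e^l into the base y e of an exponential tail that starts at
  \<open>L\<close>.\<close>

lemma abs_eval_lin_Dvs_le:
  assumes conv: "\<And>i. i < M \<Longrightarrow> fps_conv_radius (w i) = \<infinity>"
    and van: "\<And>l. l < L \<Longrightarrow> fps_nth (lin R) l = 0"
    and bound: "\<And>l. \<bar>fps_nth (lin R) l\<bar> \<le> G * y ^ l / fact l"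
    and "G \<ge> 0" "y \<ge> 0" "k \<le> t"
  shows "\<bar>eval_fps (lin ((Dv ^^ k) R)) 1\<bar> \<le> fact t * G * ((y * exp 1) ^ L / fact L * exp (y * exp 1))"
proof -
  let ?f = "\<lambda>l. fps_nth (lin ((Dv ^^ k) R)) l"
  let ?x = "y * exp 1"
  have term_le: "\<bar>?f l\<bar> \<le> fact t * G * (?x ^ l / fact l)" for l
  proof -
    have "real l ^ k \<le> fact k * exp (real l)"
      by (rule power_le_fact_exp) simp
    also have "\<dots> \<le> fact t * exp 1 ^ l"
      using \<open>k \<le> t\<close> by (simp add: exp_of_nat_mult[symmetric] fact_mono)
    finally have "real l ^ k * \<bar>fps_nth (lin R) l\<bar> \<le> (fact t * exp 1 ^ l) * (G * y ^ l / fact l)"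
      using bound by (intro mult_mono) auto
    then show ?thesis
      by (simp add: nth_lin_Dvs abs_mult power_abs power_mult_distrib mult_ac)
  qed
  have zero: "?f l = 0" if "l < L" for l
    using van[OF that] by (simp add: nth_lin_Dvs)
  have "(\<lambda>l. ?f l) sums eval_fps (lin ((Dv ^^ k) R)) 1"
    using sums_eval_fps[of 1 "lin ((Dv ^^ k) R)"] eval_lin[OF conv, of "(Dv ^^ k) R"] by simp
  then have "(\<lambda>l. ?f (l + L)) sums (eval_fps (lin ((Dv ^^ k) R)) 1 - (\<Sum>l<L. ?f l))"
    by (simp add: sums_iff_shift)
  then have sums: "(\<lambda>l. ?f (l + L)) sums eval_fps (lin ((Dv ^^ k) R)) 1"
    using zero by simp
  have x0: "?x \<ge> 0"
    using \<open>y \<ge> 0\<close> by simp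
  have "\<bar>eval_fps (lin ((Dv ^^ k) R)) 1\<bar> \<le> suminf (\<lambda>l. fact t * G * (?x ^ (l + L) / fact (l + L)))"
    unfolding sums_unique[OF sums] real_norm_def[symmetric]
  proof (rule norm_suminf_le)
    show "norm (?f (l + L)) \<le> fact t * G * (?x ^ (l + L) / fact (l + L))" for l
      using term_le[of "l + L"] unfolding real_norm_def .
    show "summable (\<lambda>l. fact t * G * (?x ^ (l + L) / fact (l + L)))"
      by (rule summable_mult) (rule exp_tail_le(1)[OF x0])
  qed
  also have "\<dots> = fact t * G * suminf (\<lambda>l. ?x ^ (l + L) / fact (l + L))"
    by (rule suminf_mult) (rule exp_tail_le(1)[OF x0])
  also have "\<dots> \<le> fact t * G * (?x ^ L / fact L * exp ?x)"
    using \<open>G \<ge> 0\<close> by (intro mult_left_mono exp_tail_le(2)[OF x0]) auto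
  finally show ?thesis .
qed

theorem no_integer_relation:
  fixes q :: "nat \<Rightarrow> int"
  assumes no_stable_kernel: "\<And>U v i. stable U \<Longrightarrow> v \<in> U \<Longrightarrow> i < M \<Longrightarrow> v i \<noteq> 0 \<Longrightarrow>
      \<exists>v\<in>U. (\<Sum>i<M. v i * fps_nth (w i) 0) \<noteq> 0"
    and e_fun: "\<And>i. i < M \<Longrightarrow> e_fun (w i)"
    and i1: "i1 < M" "w i1 = 1"
    and rel: "(\<Sum>i<M. of_int (q i) * eval_fps (w i) 1) = 0"
    and l0: "l0 < M" "q l0 \<noteq> 0"
  shows False
\<comment> \<open>For M = 1 the constant 1 is the only function and the relation itself says that
  \<open>q l0\<close> is 0. The determinant bound below takes two entries from different rows, so it
  needs M >= 2.\<close>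
proof (cases "M = 1")
  case True
  then show False
    using i1 l0 rel by simp
next
  case False
  then have M: "M \<ge> 2" "M \<ge> 1"
    using i1 by auto
  obtain C e :: nat where C: "C \<ge> 1" "\<And>i l. i < M \<Longrightarrow> \<bar>fact l * fps_nth (w i) l\<bar> \<le> real C ^ l"
     "\<And>i l. i < M \<Longrightarrow> real (Lcm {1..l}) ^ e * (fact l * fps_nth (w i) l) \<in> \<int>"
    using e_fun_uniform[of M w, OF e_fun] by blast
  have conv: "fps_conv_radius (w i) = \<infinity>" if "i < M" for i
    using e_fun_conv_radius[OF e_fun[OF that]] .
  \<comment> \<open>The number of iterates beyond s: M + (M (n + M) - L) = s + M^2 + M.\<close>
  define c0 where "c0 = M * M + M"
  \<comment> \<open>\<open>K0\<close> to \<open>K5\<close> collect the bases of all exponential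
    factors: \<open>K0\<close>, \<open>K1\<close>, \<open>K2\<close> for the length of
    \<open>R\<close>, \<open>K3\<close> for (s + c0)! / s!, \<open>K4\<close> for the growth of
    lengths under \<open>Dv\<close>, \<open>K5\<close> for the tail of the forms.\<close>
  define K0 :: real where "K0 = 4 * real M * (2 * 64 ^ e * real C) ^ M"
  define K1 where "K1 = 2 * real M * K0 ^ (M * (M + 1))"
  define K2 where "K2 = K1 ^ (M + 1)"
  define K3 :: real where "K3 = fact c0 * exp (real (1 + c0))"
  define K4 :: real where "K4 = exp (real (M + 2 + c0 + size_A))"
  define x where "x = 2 * real C * exp 1"
  define K5 where "K5 = x ^ (M * (M + 1)) * exp x"
  define K where "K = K2 * K3 * max K4 K5"
  define qm :: real where "qm = (\<Sum>i<M. \<bar>of_int (q i)\<bar>)"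
  have base1: "1 \<le> 2 * 64 ^ e * real C"
  proof -
    have "1 * 1 \<le> 64 ^ e * real C"
      using C by (intro mult_mono) auto
    then show ?thesis
      by simp
  qed
  have K0_1: "K0 \<ge> 1"
  proof -
    have "1 * 1 \<le> (4 * real M) * (2 * 64 ^ e * real C) ^ M"
      using M base1 by (intro mult_mono one_le_power) auto
    then show ?thesis
      by (simp add: K0_def)
  qed
  have K1_1: "K1 \<ge> 1"
  proof -
    have "1 * 1 \<le> (2 * real M) * K0 ^ (M * (M + 1))"
      using M K0_1 by (intro mult_mono one_le_power) auto
    then show ?thesis
      by (simp add: K1_def)
  qed
  have K2_1: "K2 \<ge> 1"
    using K1_1 by (simp add: K2_def one_le_power del: power_Suc)
  have K3_1: "K3 \<ge> 1"
  proof -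
    have "1 * 1 \<le> fact c0 * exp (real (1 + c0))"
      by (intro mult_mono) (auto simp: fact_ge_1)
    then show ?thesis
      by (simp add: K3_def)
  qed
  have x1: "x \<ge> 1"
  proof -
    have "1 * 1 \<le> (2 * real C) * exp 1"
      using C by (intro mult_mono) auto
    then show ?thesis
      by (simp add: x_def)
  qed
  \<comment> \<open>The first condition gives L > (n + M) (M - 1) for the zero estimate; the second
    is what the determinant contradicts.\<close>
  obtain s where s: "s \<ge> M" "fact M * qm * (K ^ (M - 1)) ^ s < fact s"
    using exists_power_less_fact[of M "fact M * qm" "K ^ (M - 1)"] by blast
  define n where "n = (M + 1) * s"
  define L where "L = M * n - s"
  define t where "t = s + c0"
  define B where "B = (2 * (M * n) * (2 * 64 ^ e * C) ^ (M * n)) ^ (M * (M + 1))"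
  have s1: "s \<ge> 1"
    using s M by simp
  have n1: "n \<ge> 1"
    using s1 by (simp add: n_def)
  have Mn: "M * n = L + s" and L_split: "L = (M - 1) * n + M * s"
  proof -
    obtain m where m: "M = Suc m"
      using M by (cases M) auto
    show "L = (M - 1) * n + M * s"
      unfolding L_def n_def m by (simp add: algebra_simps)
    then show "M * n = L + s"
      unfolding n_def m by (simp add: algebra_simps)
  qed
  obtain R where R: "\<exists>i<M. R i \<noteq> 0" "\<And>i. i < M \<Longrightarrow> degree (R i) \<le> n"
      "\<And>i k. i < M \<Longrightarrow> coeff (R i) k \<in> \<int>" "\<And>l. l < L \<Longrightarrow> fps_nth (lin R) l = 0"
      "\<And>i. i < M \<Longrightarrow> pnorm (R i) \<le> fact n * real (M * n * B)"
      "\<And>l. \<bar>fps_nth (lin R) l\<bar> \<le> fact n * real (M * n * B) * (2 * real C) ^ l / fact l"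
    using auxiliary_form[OF C M(2) s1 n_def L_def B_def] by blast
  have nonsingular: "dt M (\<lambda>k j. (Dv ^^ k) R j) \<noteq> 0"
  proof -
    obtain i where i: "i < M" "R i \<noteq> 0"
      using R(1) by blast
    have "(n + M) * (M - 1) < L"
    proof -
      have "M * (M - 1) < M * s"
        using s M by simp
      then show ?thesis
        unfolding L_split by (simp add: algebra_simps)
    qed
    show ?thesis
    proof (rule zero_estimate)
      show "\<exists>v\<in>U. (\<Sum>i<M. v i * fps_nth (w i) 0) \<noteq> 0"
        if "stable U" "v \<in> U" "i < M" "v i \<noteq> 0" for U v i
        using no_stable_kernel[OF that] .
    qed (fact i R(2,4) \<open>(n + M) * (M - 1) < L\<close>)+
  qed
  have "row_comb R (M + (M * (n + M) - L)) (\<lambda>i. if i = l then 1 else 0)" if "l < M" for l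
    by (rule row_comb_unit[OF nonsingular R(2,4) i1 that])
  moreover have "M + (M * (n + M) - L) = t"
    using Mn by (simp add: t_def c0_def algebra_simps)
  ultimately have unit: "row_comb R t (\<lambda>i. if i = l then 1 else 0)" if "l < M" for l
    using that by simp
  obtain \<kappa> where \<kappa>: "\<And>i. \<kappa> i < t"
    and dt: "dt M (\<lambda>i. if i = l0 then \<lambda>j. of_int (q j) else (\<lambda>j. poly ((Dv ^^ \<kappa> i) R j) 1)) \<noteq> 0"
    using complete_to_nonsingular[OF unit l0(1), of "\<lambda>j. of_int (q j)"] l0(2) by auto
  define y where "y = (\<lambda>i j. if i = l0 then of_int (q j) else poly ((Dv ^^ \<kappa> i) R j) 1)"
  define v where "v = (\<lambda>i. eval_fps (w i) 1)"
  define \<rho> where "\<rho> = (\<lambda>i. \<Sum>j<M. y i j * v j)"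
  have y_eq: "(\<lambda>i. if i = l0 then \<lambda>j. of_int (q j) else (\<lambda>j. poly ((Dv ^^ \<kappa> i) R j) 1)) = y"
    by (simp add: y_def fun_eq_iff)
  have dt_y: "dt M y \<noteq> 0"
    using dt unfolding y_eq .
  have "dt M y \<in> \<int>"
  proof (rule dt_Ints)
    fix i j assume "i < M" "j < M"
    then show "y i j \<in> \<int>"
      using Dvs_Ints[of R j] R(3) unfolding y_def
      by (auto simp: poly_altdef intro!: Ints_sum)
  qed
  then have dt_ge: "\<bar>dt M y\<bar> \<ge> 1"
    using dt_y Ints_nonzero_abs_ge1 by blast
  have \<rho>_l0: "\<rho> l0 = 0"
    using rel by (simp add: \<rho>_def y_def v_def)
  have \<rho>_eq: "\<rho> i = eval_fps (lin ((Dv ^^ \<kappa> i) R)) 1" if "i \<noteq> l0" for i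
    using eval_lin[OF conv, of "(Dv ^^ \<kappa> i) R"] that by (simp add: \<rho>_def y_def v_def)
  \<comment> \<open>A column operation: adding the other columns with factors \<open>v j\<close> to
    column \<open>i1\<close>, where \<open>v i1\<close> is 1, turns it into the column of values
    \<open>\<rho>\<close>.\<close>
  have dt_repl: "dt M y = dt M (\<lambda>i j. if j = i1 then \<rho> i else y i j)"
  proof -
    have "dt M (\<lambda>i j. if j = i1 then \<rho> i else y i j) = (\<Sum>k<M. adj M y i1 k * \<rho> k)"
      by (rule adj_mult_col[OF i1(1), symmetric])
    also have "\<dots> = (\<Sum>j<M. (\<Sum>k<M. adj M y i1 k * y k j) * v j)"
      unfolding \<rho>_def sum_distrib_left sum_distrib_right by (subst sum.swap) (simp add: mult.assoc)
    also have "\<dots> = (\<Sum>j<M. if j = i1 then dt M y else 0)"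
      using i1 by (intro sum.cong refl) (auto simp: adj_mult v_def)
    also have "\<dots> = dt M y"
      using i1 by simp
    finally show ?thesis
      by simp
  qed
  have MnB: "real (M * n * B) \<le> K2 ^ s"
  proof -
    have "real n \<le> 2 ^ n"
      using of_nat_less_two_power[of n] by (rule less_imp_le)
    have M_le: "real M * 2 \<le> (real M * 2) ^ n"
      using n1 M by (intro self_le_power) auto
    have "real (2 * (M * n) * (2 * 64 ^ e * C) ^ (M * n)) =
        (real M * 2) * real n * ((2 * 64 ^ e * real C) ^ M) ^ n"
      by (simp add: power_mult)
    also have "\<dots> \<le> (real M * 2) ^ n * 2 ^ n * ((2 * 64 ^ e * real C) ^ M) ^ n"
      by (intro mult_mono M_le \<open>real n \<le> 2 ^ n\<close>) auto
    also have "\<dots> = K0 ^ n"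
    proof -
      have "K0 = real M * 2 * 2 * (2 * 64 ^ e * real C) ^ M"
        by (simp add: K0_def)
      then show ?thesis
        by (simp only: power_mult_distrib)
    qed
    finally have "real B \<le> (K0 ^ n) ^ (M * (M + 1))"
      unfolding B_def of_nat_power by (intro power_mono) auto
    then have "real (M * n * B) \<le> ((real M * 2) ^ n) * (K0 ^ n) ^ (M * (M + 1))"
    proof -
      assume B: "real B \<le> (K0 ^ n) ^ (M * (M + 1))"
      have "real M * real n \<le> (real M) ^ n * 2 ^ n"
        using n1 M by (intro mult_mono \<open>real n \<le> 2 ^ n\<close> self_le_power) auto
      also have "\<dots> = (real M * 2) ^ n"
        by (simp add: power_mult_distrib)
      finally show ?thesis
        unfolding of_nat_mult using B by (intro mult_mono) auto
    qed
    also have "\<dots> = K1 ^ n"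
    proof -
      have "(K0 ^ n) ^ (M * (M + 1)) = (K0 ^ (M * (M + 1))) ^ n"
        by (simp only: power_mult[symmetric] mult.commute)
      then show ?thesis
        unfolding K1_def power_mult_distrib[of _ "K0 ^ _"] by (simp only: mult.commute[of 2])
    qed
    also have "\<dots> = K2 ^ s"
      by (simp only: K2_def n_def power_mult)
    finally show ?thesis .
  qed
  have fact_t: "fact t \<le> fact s * K3 ^ s"
  proof -
    have "fact t \<le> fact s * real (s + c0) ^ c0"
      unfolding t_def by (rule fact_add_le)
    also have "\<dots> \<le> fact s * (fact c0 * exp (real (s + c0)))"
      by (intro mult_left_mono power_le_fact_exp) auto
    also have "\<dots> \<le> fact s * (fact c0 ^ s * exp (real (1 + c0)) ^ s)"
    proof (intro mult_left_mono mult_mono)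
      show "(fact c0 :: real) \<le> fact c0 ^ s"
        using s1 by (intro self_le_power) (auto simp: fact_ge_1)
      have "s + c0 \<le> s * (1 + c0)"
        using s1 by simp
      then have "real (s + c0) \<le> real s * real (1 + c0)"
        by (metis of_nat_le_iff of_nat_mult)
      then show "exp (real (s + c0)) \<le> exp (real (1 + c0)) ^ s"
        unfolding exp_of_nat_mult[symmetric] by simp
    qed auto
    finally show ?thesis
      by (simp add: K3_def power_mult_distrib)
  qed
  define Z where "Z = fact n * fact s * (K2 * K3) ^ s"
  have Z0: "Z \<ge> 0"
    using K2_1 K3_1 by (simp add: Z_def)
  have y_le: "\<bar>y i j\<bar> \<le> Z * K4 ^ s" if "i \<noteq> l0" "j < M" for i j
  proof -
    have "\<bar>y i j\<bar> \<le> pnorm ((Dv ^^ \<kappa> i) R j)"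
      using that abs_poly_1_le_pnorm by (simp add: y_def)
    also have "\<dots> \<le> real (n + t + size_A) ^ \<kappa> i * (fact n * real (M * n * B))"
      using \<kappa>[of i] that(2) by (intro pnorm_Dvs_le R(2,5)) auto
    also have "\<dots> \<le> (fact t * exp (real (n + t + size_A))) * (fact n * K2 ^ s)"
    proof (intro mult_mono mult_left_mono MnB)
      have "real (n + t + size_A) ^ \<kappa> i \<le> real (n + t + size_A) ^ t"
        using \<kappa>[of i] n1 by (intro power_increasing) auto
      also have "\<dots> \<le> fact t * exp (real (n + t + size_A))"
        by (rule power_le_fact_exp) simp
      finally show "real (n + t + size_A) ^ \<kappa> i \<le> fact t * exp (real (n + t + size_A))" .
    qed auto
    also have "\<dots> \<le> ((fact s * K3 ^ s) * K4 ^ s) * (fact n * K2 ^ s)"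
    proof (intro mult_mono fact_t)
      have "n + t + size_A = s * (M + 2) + (c0 + size_A)"
        by (simp add: n_def t_def algebra_simps)
      also have "\<dots> \<le> s * (M + 2) + s * (c0 + size_A)"
        using s1 by simp
      also have "\<dots> = s * (M + 2 + c0 + size_A)"
        by (simp add: algebra_simps)
      finally have "real (n + t + size_A) \<le> real s * real (M + 2 + c0 + size_A)"
        by (metis of_nat_le_iff of_nat_mult)
      then show "exp (real (n + t + size_A)) \<le> K4 ^ s"
        unfolding K4_def exp_of_nat_mult[symmetric] by simp
    qed (use K2_1 K3_1 in \<open>auto simp: K4_def\<close>)
    finally show ?thesis
      by (simp add: Z_def power_mult_distrib mult_ac)
  qed
  have \<rho>_le: "\<bar>\<rho> i\<bar> \<le> Z * K5 ^ s / fact L" if "i \<noteq> l0" for i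
  proof -
    have "\<bar>\<rho> i\<bar> \<le> fact t * (fact n * real (M * n * B)) * (x ^ L / fact L * exp x)"
      unfolding \<rho>_eq[OF that] x_def
      by (rule abs_eval_lin_Dvs_le[OF conv R(4,6)]) (use \<kappa>[of i] in auto)
    also have "\<dots> \<le> (fact s * K3 ^ s) * (fact n * K2 ^ s) * (K5 ^ s / fact L)"
    proof (intro mult_mono fact_t mult_left_mono MnB)
      have "x ^ L \<le> x ^ (M * (M + 1) * s)"
      proof (intro power_increasing x1)
        have "L \<le> M * n"
          by (simp add: L_def)
        then show "L \<le> M * (M + 1) * s"
          by (simp only: n_def mult.assoc)
      qed
      moreover have "exp x \<le> exp x ^ s"
        using s1 x1 by (intro self_le_power) auto
      ultimately have "x ^ L * exp x \<le> x ^ (M * (M + 1) * s) * exp x ^ s"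
        using x1 by (intro mult_mono) auto
      then have "x ^ L * exp x \<le> K5 ^ s"
        by (simp add: K5_def power_mult_distrib power_mult)
      then show "x ^ L / fact L * exp x \<le> K5 ^ s / fact L"
        by (simp add: divide_right_mono)
    qed (use K2_1 K3_1 x1 in auto)
    finally show ?thesis
      by (simp add: Z_def power_mult_distrib mult_ac)
  qed
  define m where "m = max K4 K5"
  have "K4 \<ge> 1"
    unfolding K4_def one_le_exp_iff by (rule of_nat_0_le_iff)
  then have m1: "m \<ge> 1"
    by (simp add: m_def)
  have qm0: "qm \<ge> 0"
    unfolding qm_def by (intro sum_nonneg) auto
  have "\<bar>dt M y\<bar> \<le> fact M * (qm * (Z * m ^ s / fact L) * (Z * m ^ s) ^ (M - 2))"
    unfolding dt_repl
  proof (rule abs_dt_le[OF l0(1) i1(1)])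
    show "\<bar>if j = i1 then \<rho> l0 else y l0 j\<bar> \<le> qm" if "j < M" for j
    proof -
      have "\<bar>real_of_int (q j)\<bar> \<le> qm"
        unfolding qm_def using that by (intro member_le_sum[of j "{..<M}" "\<lambda>j. \<bar>real_of_int (q j)\<bar>"]) auto
      with qm0 show ?thesis
        by (simp add: \<rho>_l0 y_def)
    qed
    show "\<bar>if i1 = i1 then \<rho> i else y i i1\<bar> \<le> Z * m ^ s / fact L" if "i < M" "i \<noteq> l0" for i
    proof -
      have "K5 ^ s \<le> m ^ s"
        using x1 by (intro power_mono) (auto simp: m_def K5_def)
      then have "Z * K5 ^ s / fact L \<le> Z * m ^ s / fact L"
        using Z0 by (intro divide_right_mono mult_left_mono) auto
      then show ?thesis
        using \<rho>_le[OF that(2)] by simp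
    qed
    show "\<bar>if j = i1 then \<rho> i else y i j\<bar> \<le> Z * m ^ s" if "i < M" "i \<noteq> l0" "j < M" "j \<noteq> i1" for i j
    proof -
      have "K4 ^ s \<le> m ^ s"
        by (intro power_mono) (auto simp: m_def K4_def)
      then have "Z * K4 ^ s \<le> Z * m ^ s"
        using Z0 by (intro mult_left_mono)
      then show ?thesis
        using y_le[OF that(2,3)] that by simp
    qed
  qed (use \<rho>_l0 Z0 m1 qm0 in auto)
  also have "\<dots> = fact M * qm * ((Z * m ^ s) ^ (M - 1) / fact L)"
  proof -
    obtain k where "M = Suc (Suc k)"
      using M by (metis add_2_eq_Suc le_Suc_ex)
    then show ?thesis
      by simp
  qed
  finally have dt_le: "\<bar>dt M y\<bar> \<le> fact M * qm * ((Z * m ^ s) ^ (M - 1) / fact L)" .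
  have "Z * m ^ s = fact n * fact s * K ^ s"
    by (simp add: Z_def K_def m_def power_mult_distrib mult_ac)
  then have Zm: "(Z * m ^ s) ^ (M - 1) = (fact n ^ (M - 1) * fact s ^ (M - 1)) * (K ^ (M - 1)) ^ s"
    by (simp add: power_mult_distrib power_mult[symmetric] mult_ac)
  \<comment> \<open>Of the M factors s! contained in L!, the entries use up M - 1; the last one
    outgrows every exponential in s.\<close>
  have facts: "(fact n ^ (M - 1) * fact s ^ (M - 1)) * fact s \<le> (fact L :: real)"
  proof -
    have "(fact n ^ (M - 1) * fact s ^ (M - 1)) * fact s = fact n ^ (M - 1) * (fact s ^ M :: real)"
      using M by (cases M) auto
    also have "\<dots> \<le> fact ((M - 1) * n) * fact (M * s)"
      by (intro mult_mono fact_power_le_fact_mult) auto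
    also have "\<dots> \<le> fact L"
      unfolding L_split
      by (metis dvd_imp_le fact_fact_dvd_fact fact_gt_zero of_nat_fact of_nat_le_iff of_nat_mult)
    finally show ?thesis .
  qed
  have K0: "K \<ge> 0"
    using K2_1 K3_1 m1 by (simp add: K_def m_def)
  have "(Z * m ^ s) ^ (M - 1) * fact s \<le> fact L * (K ^ (M - 1)) ^ s"
    using mult_right_mono[OF facts, of "(K ^ (M - 1)) ^ s"] K0 unfolding Zm by (simp add: mult_ac)
  then have "(Z * m ^ s) ^ (M - 1) / fact L \<le> (K ^ (M - 1)) ^ s / fact s"
    by (simp add: divide_le_eq le_divide_eq mult_ac)
  then have "fact M * qm * ((Z * m ^ s) ^ (M - 1) / fact L) \<le> fact M * qm * ((K ^ (M - 1)) ^ s / fact s)"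
    using qm0 by (intro mult_left_mono) auto
  with dt_le dt_ge have "1 \<le> fact M * qm * ((K ^ (M - 1)) ^ s / fact s)"
    by linarith
  also have "\<dots> = fact M * qm * (K ^ (M - 1)) ^ s / fact s"
    by simp
  also have "\<dots> < 1"
    using s(2) by (simp only: divide_less_eq_1_pos fact_gt_zero)
  finally show False
    by simp
qed

end

subsection \<open>Monomials in the generating functions\<close>

text \<open>Index 0 is exp (-z) in place of f_0 = 1 - exp (-z): since theta f_0 = z (1 - f_0), the
  latter would put an off-diagonal term into the z part of the system, whereas exp (-z) gives a
  purely diagonal one.\<close>

definition gen_fps :: "nat \<Rightarrow> real fps" where
  "gen_fps k = (if k = 0 then fps_exp (-1)
     else Abs_fps (\<lambda>l. if l = 0 then 0 else (-1) ^ (l + 1) / (real l ^ k * fact l)))"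

lemma XD_gen_fps0: "fps_XD (gen_fps 0) = - (fps_X * gen_fps 0)"
  by (simp add: gen_fps_def fps_XD_def fps_mult_left_const_nth fps_eq_iff)

lemma XD_gen_fps1: "fps_XD (gen_fps 1) = 1 - gen_fps 0"
  by (rule fps_ext) (simp add: gen_fps_def field_simps)

lemma XD_gen_fps_Suc: "k \<ge> 1 \<Longrightarrow> fps_XD (gen_fps (Suc k)) = gen_fps k"
  by (rule fps_ext) (simp add: gen_fps_def field_simps)

text \<open>For positive \<open>k\<close> and \<open>l\<close>, l! times the coefficient is 1 / l^k
  up to sign, and l divides lcm(1, ..., l); so the growth constant 1 and the exponent
  \<open>k\<close> suffice.\<close>

lemma e_fun_gen_fps: "e_fun (gen_fps k)"
proof -
  have "real (Lcm {1..l}) ^ k * (fact l * fps_nth (gen_fps k) l) \<in> \<int>" for l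
  proof (cases "l = 0 \<or> k = 0")
    case True
    then show ?thesis
      by (auto simp: gen_fps_def)
  next
    case False
    then have "l dvd Lcm {1..l}"
      by (intro dvd_Lcm) auto
    then obtain m where m: "Lcm {1..l} = l * m" ..
    have "real (Lcm {1..l}) ^ k * (fact l * fps_nth (gen_fps k) l) = real m ^ k * (-1) ^ (l + 1)"
      unfolding m using False by (simp add: gen_fps_def power_mult_distrib)
    then show ?thesis
      by simp
  qed
  moreover have "\<bar>fact l * fps_nth (gen_fps k) l\<bar> \<le> real 1 ^ l" for l
  proof (cases "l = 0 \<or> k = 0")
    case False
    then have "1 \<le> real l ^ k"
      by (intro one_le_power) auto
    then show ?thesis
      using False by (simp add: gen_fps_def abs_mult power_abs)
  qed (auto simp: gen_fps_def power_abs)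
  ultimately show ?thesis
    unfolding e_fun_def by (intro exI[of _ 1] exI[of _ k]) auto
qed

definition gen_val :: "nat \<Rightarrow> real" where
  "gen_val k = (if k = 0 then exp (-1) else eta k / fact k)"

lemma eval_gen_fps: "eval_fps (gen_fps k) 1 = gen_val k"
proof (cases "k = 0")
  case False
  have "(\<lambda>j. fps_nth (gen_fps k) (Suc j)) sums (eta k / fact k)"
    using eta_sums[of k] False by (simp add: gen_fps_def del: of_nat_Suc fact_Suc)
  then have "(\<lambda>j. fps_nth (gen_fps k) j) sums (eta k / fact k + fps_nth (gen_fps k) 0)"
    by (rule sums_Suc)
  then have "(\<lambda>j. fps_nth (gen_fps k) j * 1 ^ j) sums (eta k / fact k)"
    using False by (simp add: gen_fps_def)
  then show ?thesis
    using False by (simp add: eval_fps_def gen_val_def sums_iff)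
qed (simp add: gen_fps_def gen_val_def)

lemma eta_0: "eta 0 = 1 - exp (-1)"
proof -
  define f where "f = fps_nth (fps_exp (-1) :: real fps)"
  have "f sums exp (-1)"
    using sums_eval_fps[of 1 "fps_exp (-1) :: real fps"] by (simp add: f_def del: fps_exp_nth)
  moreover have "f 0 = 1"
    by (simp add: f_def)
  ultimately have "(\<lambda>j. f (Suc j)) sums (exp (-1) - 1)"
    by (subst sums_Suc_iff) simp
  then have "(\<lambda>j. - f (Suc j)) sums - (exp (-1) - 1)"
    by (rule sums_minus)
  then have "(\<lambda>j. (- 1) ^ (Suc j + 1) / (real (Suc j) ^ 0 * fact (Suc j))) sums - (exp (-1) - 1)"
    by (simp add: f_def del: fact_Suc)
  from sums_unique2[OF this eta_sums[of 0]] show ?thesis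
    by simp
qed

text \<open>Exponent vectors are total functions vanishing beyond \<open>m\<close>. The bound on the
  total degree gives a finite set that the exponent changes occurring in derivatives do not
  leave.\<close>

definition exps :: "nat \<Rightarrow> nat \<Rightarrow> (nat \<Rightarrow> nat) set" where
  "exps m d = {\<mu>. (\<forall>i>m. \<mu> i = 0) \<and> (\<Sum>i\<le>m. \<mu> i) \<le> d}"

definition gen_mon :: "nat \<Rightarrow> (nat \<Rightarrow> nat) \<Rightarrow> real fps" where
  "gen_mon m \<mu> = (\<Prod>i\<le>m. gen_fps i ^ \<mu> i)"

text \<open>Truncated subtraction leaves \<open>\<mu>\<close> unchanged if its exponent at
  \<open>k\<close> is 0; such terms always carry the coefficient \<open>\<mu> k\<close>, which is
  then 0.\<close>

definition dec :: "nat \<Rightarrow> (nat \<Rightarrow> nat) \<Rightarrow> nat \<Rightarrow> nat" where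
  "dec k \<mu> = \<mu>(k := \<mu> k - 1)"

definition low :: "nat \<Rightarrow> (nat \<Rightarrow> nat) \<Rightarrow> nat \<Rightarrow> nat" where
  "low k \<mu> = (dec k \<mu>)(k - 1 := dec k \<mu> (k - 1) + 1)"

text \<open>The term with \<open>dec 1 \<mu>\<close> and the sign for \<open>k = 1\<close> come from \<open>\<theta> f\<^sub>1 = 1 - exp (-z)\<close>.\<close>

definition mon_A :: "nat \<Rightarrow> (nat \<Rightarrow> nat) \<Rightarrow> (nat \<Rightarrow> nat) \<Rightarrow> int" where
  "mon_A m \<mu> \<nu> = (\<Sum>k=1..m. if \<nu> = low k \<mu> then (if k = 1 then - int (\<mu> k) else int (\<mu> k)) else 0) +
     (if \<nu> = dec 1 \<mu> then int (\<mu> 1) else 0)"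

text \<open>The generator with index i has weight i, so that \<open>low k\<close> for k >= 1 and
  \<open>dec 1\<close>, applied to a positive exponent, lower the total by one.\<close>

definition mon_wt :: "nat \<Rightarrow> (nat \<Rightarrow> nat) \<Rightarrow> nat" where
  "mon_wt m \<mu> = (\<Sum>i\<le>m. i * \<mu> i)"

lemma finite_exps: "finite (exps m d)"
proof (rule finite_subset)
  show "exps m d \<subseteq> {\<mu>. \<forall>i. (i \<in> {..m} \<longrightarrow> \<mu> i \<in> {..d}) \<and> (i \<notin> {..m} \<longrightarrow> \<mu> i = 0)}"
  proof
    fix \<mu> assume \<mu>: "\<mu> \<in> exps m d"
    have "\<mu> i \<le> d" if "i \<le> m" for i
      using \<mu> that member_le_sum[of i "{..m}" \<mu>] by (auto simp: exps_def)
    moreover have "\<mu> i = 0" if "\<not> i \<le> m" for i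
      using \<mu> that by (auto simp: exps_def)
    ultimately show "\<mu> \<in> {\<mu>. \<forall>i. (i \<in> {..m} \<longrightarrow> \<mu> i \<in> {..d}) \<and> (i \<notin> {..m} \<longrightarrow> \<mu> i = 0)}"
      by auto
  qed
qed (rule finite_set_of_finite_funs; simp)

lemma sum_upd:
  fixes \<mu> :: "nat \<Rightarrow> nat"
  assumes "k \<le> m"
  shows "(\<Sum>i\<le>m. c i * (\<mu>(k := x)) i) + c k * \<mu> k = (\<Sum>i\<le>m. c i * \<mu> i) + c k * x"
proof -
  have "(\<Sum>i\<le>m. c i * f i) = c k * f k + (\<Sum>i\<in>{..m} - {k}. c i * f i)" for f
    using assms by (simp add: sum.remove)
  moreover have "(\<Sum>i\<in>{..m} - {k}. c i * (\<mu>(k := x)) i) = (\<Sum>i\<in>{..m} - {k}. c i * \<mu> i)"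
    by (intro sum.cong) auto
  ultimately show ?thesis
    by (simp del: fun_upd_apply) simp
qed

lemma sum_dec:
  assumes "k \<le> m" "\<mu> k > 0"
  shows "(\<Sum>i\<le>m. c i * dec k \<mu> i) + c k = (\<Sum>i\<le>m. c i * \<mu> i)"
proof -
  obtain x where "\<mu> k = Suc x"
    using assms by (cases "\<mu> k") auto
  then show ?thesis
    using sum_upd[OF assms(1), of c \<mu> x] by (simp add: dec_def)
qed

lemma sum_low:
  assumes "1 \<le> k" "k \<le> m" "\<mu> k > 0"
  shows "(\<Sum>i\<le>m. c i * low k \<mu> i) + c k = (\<Sum>i\<le>m. c i * \<mu> i) + c (k - 1)"
  using sum_dec[of k m \<mu> c] sum_upd[of "k - 1" m c "dec k \<mu>" "dec k \<mu> (k - 1) + 1"] assms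
  by (simp add: low_def)

lemma dec_exps:
  assumes "\<mu> \<in> exps m d" "k \<le> m"
  shows "dec k \<mu> \<in> exps m d"
proof -
  have "(\<Sum>i\<le>m. dec k \<mu> i) \<le> (\<Sum>i\<le>m. \<mu> i)"
    by (intro sum_mono) (simp add: dec_def)
  with assms show ?thesis
    by (auto simp: exps_def dec_def)
qed

lemma low_exps:
  assumes "\<mu> \<in> exps m d" "1 \<le> k" "k \<le> m" "\<mu> k > 0"
  shows "low k \<mu> \<in> exps m d"
proof -
  have "(\<Sum>i\<le>m. low k \<mu> i) = (\<Sum>i\<le>m. \<mu> i)"
    using sum_low[where c = "\<lambda>_. 1" and k = k and m = m and \<mu> = \<mu>] assms by simp
  moreover have "low k \<mu> i = 0" if "i > m" for i
    using assms that by (simp add: low_def dec_def exps_def)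
  ultimately show ?thesis
    using assms(1) by (simp add: exps_def)
qed

lemma exps_pos_le: "\<mu> \<in> exps m d \<Longrightarrow> \<mu> k > 0 \<Longrightarrow> k \<le> m"
  by (auto simp: exps_def not_less[symmetric])

lemma mon_wt_less:
  assumes "mon_A m \<mu> \<nu> \<noteq> 0" "\<mu> \<in> exps m d"
  shows "mon_wt m \<nu> < mon_wt m \<mu>"
proof -
  have "(\<exists>k. 1 \<le> k \<and> k \<le> m \<and> \<nu> = low k \<mu> \<and> \<mu> k > 0) \<or> (\<nu> = dec 1 \<mu> \<and> \<mu> 1 > 0)"
  proof (rule ccontr)
    assume *: "\<not> ?thesis"
    then have "(if \<nu> = low k \<mu> then (if k = 1 then - int (\<mu> k) else int (\<mu> k)) else 0) = 0"
      if "k \<in> {1..m}" for k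
      using that by auto
    then have "mon_A m \<mu> \<nu> = 0"
      unfolding mon_A_def using * by (simp add: sum.neutral)
    with assms show False
      by simp
  qed
  then show ?thesis
  proof (elim disjE exE conjE)
    fix k assume "1 \<le> k" "k \<le> m" "\<nu> = low k \<mu>" "\<mu> k > 0"
    then show ?thesis
      using sum_low[of k m \<mu> id] by (simp add: mon_wt_def)
  next
    assume "\<nu> = dec 1 \<mu>" "\<mu> 1 > 0"
    then show ?thesis
      using sum_dec[of 1 m \<mu> id] exps_pos_le[OF assms(2), of 1] by (simp add: mon_wt_def)
  qed
qed

lemma fps_XD_power: "fps_XD (f ^ n) = fps_const (of_nat n) * fps_XD f * (f :: real fps) ^ (n - 1)"
  by (simp add: fps_XD_def fps_deriv_power mult_ac)

lemma fps_XD_prod: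
  fixes f :: "'i \<Rightarrow> real fps"
  shows "finite S \<Longrightarrow> fps_XD (prod f S) = (\<Sum>s\<in>S. fps_XD (f s) * prod f (S - {s}))"
proof (induction S rule: finite_induct)
  case (insert x S)
  have "prod f (insert x S - {s}) = f x * prod f (S - {s})" if "s \<in> S" for s
  proof -
    have "insert x S - {s} = insert x (S - {s})"
      using insert that by auto
    then show ?thesis
      using insert by simp
  qed
  then show ?case
    using insert by (simp add: fps_XD_mult sum_distrib_left mult_ac)
qed (simp add: fps_XD_def)

lemma gen_mon_remove:
  assumes "k \<le> m"
  shows "gen_mon m \<mu> = gen_fps k ^ \<mu> k * (\<Prod>i\<in>{..m} - {k}. gen_fps i ^ \<mu> i)"
  unfolding gen_mon_def using assms by (simp add: prod.remove)

lemma gen_mon_upd: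
  assumes "k \<le> m"
  shows "gen_mon m (\<mu>(k := x)) = gen_fps k ^ x * (\<Prod>i\<in>{..m} - {k}. gen_fps i ^ \<mu> i)"
  unfolding gen_mon_remove[OF assms] by (intro arg_cong2[of _ _ _ _ "(*)"] prod.cong) auto

lemma gen_fps_mult_gen_mon_dec: "k \<le> m \<Longrightarrow> \<mu> k > 0 \<Longrightarrow> gen_fps k * gen_mon m (dec k \<mu>) = gen_mon m \<mu>"
  unfolding dec_def gen_mon_upd gen_mon_remove[of k m \<mu>]
  by (simp add: power_eq_if)

lemma gen_mon_low: "1 \<le> k \<Longrightarrow> k \<le> m \<Longrightarrow> gen_mon m (low k \<mu>) = gen_fps (k - 1) * gen_mon m (dec k \<mu>)"
  unfolding low_def by (subst gen_mon_upd; simp add: gen_mon_remove[of "k - 1" m "dec k \<mu>"] mult.assoc)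

text \<open>Leibniz rule by generators: one factor of index k >= 2 becomes one of index k - 1, index
  1 yields 1 - exp (-z), and index 0 supplies the diagonal z term.\<close>

lemma XD_gen_mon:
  assumes \<mu>: "\<mu> \<in> exps m d"
  shows "fps_XD (gen_mon m \<mu>) = (\<Sum>\<nu>\<in>exps m d. fps_const (of_int (mon_A m \<mu> \<nu>)) * gen_mon m \<nu>) +
    fps_const (of_int (- int (\<mu> 0))) * fps_X * gen_mon m \<mu>"
proof -
  define T where "T = (\<lambda>k. fps_const (of_nat (\<mu> k)) * fps_XD (gen_fps k) * gen_mon m (dec k \<mu>))"
  define G where "G = (\<lambda>k. fps_const (if k = 1 then - real (\<mu> k) else real (\<mu> k)) * gen_mon m (low k \<mu>))"
  define c where "c = (\<lambda>k \<nu>. if \<nu> = low k \<mu> then (if k = 1 then - int (\<mu> k) else int (\<mu> k)) else 0)"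
  have "fps_XD (gen_mon m \<mu>) = (\<Sum>k\<le>m. T k)"
    unfolding gen_mon_def
  proof (subst fps_XD_prod, simp, intro sum.cong refl)
    fix k assume "k \<in> {..m}"
    then show "fps_XD (gen_fps k ^ \<mu> k) * (\<Prod>i\<in>{..m} - {k}. gen_fps i ^ \<mu> i) = T k"
      by (simp add: T_def fps_XD_power dec_def gen_mon_upd mult.assoc)
  qed
  also have "\<dots> = T 0 + (\<Sum>k=1..m. T k)"
    by (simp add: sum.atMost_shift sum.atLeast1_atMost_eq)
  also have "T 0 = fps_const (of_int (- int (\<mu> 0))) * fps_X * gen_mon m \<mu>"
  proof (cases "\<mu> 0 = 0")
    case False
    then have "gen_mon m \<mu> = gen_fps 0 * gen_mon m (dec 0 \<mu>)"
      by (simp add: gen_fps_mult_gen_mon_dec)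
    then show ?thesis
      unfolding T_def XD_gen_fps0 by (simp add: mult_ac flip: fps_const_neg)
  qed (simp add: T_def)
  also have "(\<Sum>k=1..m. T k) = (\<Sum>k=1..m. G k) + fps_const (real (\<mu> 1)) * gen_mon m (dec 1 \<mu>)"
  proof -
    have T1: "T 1 = G 1 + fps_const (real (\<mu> 1)) * gen_mon m (dec 1 \<mu>)" if "1 \<le> m"
      unfolding T_def G_def XD_gen_fps1 using that
      by (simp add: gen_mon_low algebra_simps flip: fps_const_neg)
    have Tk: "T k = G k" if k: "2 \<le> k" "k \<le> m" for k
    proof -
      obtain j where "k = Suc j" "j \<ge> 1"
        using k by (cases k) auto
      then show ?thesis
        unfolding T_def G_def using k by (simp add: gen_mon_low XD_gen_fps_Suc mult.assoc)
    qed
    show ?thesis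
    proof (cases "m = 0")
      case True
      then show ?thesis
        using \<mu> by (simp add: exps_def)
    next
      case False
      then have split: "{1..m} = insert 1 {2..m}"
        by auto
      have "(\<Sum>k=2..m. T k) = (\<Sum>k=2..m. G k)"
        by (intro sum.cong) (auto simp: Tk)
      then show ?thesis
        unfolding split using T1 False by (simp add: algebra_simps)
    qed
  qed
  also have "(\<Sum>k=1..m. G k) = (\<Sum>\<nu>\<in>exps m d. fps_const (of_int (\<Sum>k=1..m. c k \<nu>)) * gen_mon m \<nu>)"
  proof -
    have const_sum: "fps_const (of_int (\<Sum>k\<in>S. f k)) * g = (\<Sum>k\<in>S. fps_const (of_int (f k)) * g)"
      for S :: "nat set" and f :: "nat \<Rightarrow> int" and g :: "real fps"
      by (induction S rule: infinite_finite_induct) (simp_all add: distrib_right flip: fps_const_add)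
    have "G k = (\<Sum>\<nu>\<in>exps m d. fps_const (of_int (c k \<nu>)) * gen_mon m \<nu>)" if k: "k \<in> {1..m}" for k
    proof (cases "\<mu> k = 0")
      case True
      then have "c k \<nu> = 0" for \<nu>
        by (auto simp: c_def)
      with True show ?thesis
        by (auto simp: G_def)
    next
      case False
      then have "low k \<mu> \<in> exps m d"
        using low_exps[OF \<mu>] k by auto
      moreover have "(\<Sum>\<nu>\<in>exps m d. fps_const (of_int (c k \<nu>)) * gen_mon m \<nu>) =
          (\<Sum>\<nu>\<in>exps m d. if \<nu> = low k \<mu> then G k else 0)"
        by (intro sum.cong) (auto simp: G_def c_def)
      ultimately show ?thesis
        by (simp add: finite_exps)
    qed
    then have "(\<Sum>k=1..m. G k) = (\<Sum>k=1..m. \<Sum>\<nu>\<in>exps m d. fps_const (of_int (c k \<nu>)) * gen_mon m \<nu>)"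
      by (intro sum.cong refl)
    also have "\<dots> = (\<Sum>\<nu>\<in>exps m d. \<Sum>k=1..m. fps_const (of_int (c k \<nu>)) * gen_mon m \<nu>)"
      by (rule sum.swap)
    finally show ?thesis
      by (simp only: const_sum)
  qed
  also have "fps_const (real (\<mu> 1)) * gen_mon m (dec 1 \<mu>) =
      (\<Sum>\<nu>\<in>exps m d. fps_const (of_int (if \<nu> = dec 1 \<mu> then int (\<mu> 1) else 0)) * gen_mon m \<nu>)"
  proof (cases "\<mu> 1 = 0")
    case False
    then have "dec 1 \<mu> \<in> exps m d"
      using dec_exps[OF \<mu>] exps_pos_le[OF \<mu>, of 1] by simp
    moreover have "(\<Sum>\<nu>\<in>exps m d. fps_const (of_int (if \<nu> = dec 1 \<mu> then int (\<mu> 1) else 0)) * gen_mon m \<nu>) =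
        (\<Sum>\<nu>\<in>exps m d. if \<nu> = dec 1 \<mu> then fps_const (real (\<mu> 1)) * gen_mon m (dec 1 \<mu>) else 0)"
      by (intro sum.cong) auto
    ultimately show ?thesis
      by (simp add: finite_exps)
  qed (simp cong: if_cong)
  finally show ?thesis
    by (simp only: mon_A_def c_def of_int_add fps_const_add[symmetric] distrib_right sum.distrib add_ac)
qed


text \<open>A nonzero element of minimal top weight in a stable space is annihilated by the matrix
  \<open>mon_A\<close>; choosing it with the least number of exponents of \<open>gen_fps 0\<close> as well makes it homogeneous
  in \<open>gen_fps 0\<close>, and the two properties force it to be a multiple of a power of \<open>gen_fps 0\<close>.\<close>

lemma kernel_supported_on_powers_of_gen_fps_0:
  assumes hom: "\<And>\<mu>. \<mu> \<in> S \<Longrightarrow> \<mu> 0 = b" and S: "S \<subseteq> exps m d"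
    and v: "\<And>\<mu>. \<mu> \<in> S \<Longrightarrow> v \<mu> \<noteq> (0::real)"
    and ker: "\<And>\<nu>. \<nu> \<in> exps m d \<Longrightarrow> (\<Sum>\<mu>\<in>S. of_int (mon_A m \<mu> \<nu>) * v \<mu>) = 0"
    and \<mu>: "\<mu> \<in> S" "k0 \<ge> 1"
  shows "\<mu> k0 = 0"
proof (rule ccontr)
  assume "\<mu> k0 \<noteq> 0"
  then have ex: "\<exists>k. k \<ge> 1 \<and> (\<exists>\<mu>\<in>S. \<mu> k > 0)"
    using \<mu> by auto
  \<comment> \<open>The least positive index occurring in the support. In the kernel equation at
    \<open>low k \<mu>\<close> only \<open>\<mu>\<close> contributes: any other
    \<open>\<mu>'\<close> would need a different exponent at 0 or a positive exponent at an index
    from 1 to k - 1. Hence the equation fails.\<close>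
  define k where "k = (LEAST k. k \<ge> 1 \<and> (\<exists>\<mu>\<in>S. \<mu> k > 0))"
  have "k \<ge> 1 \<and> (\<exists>\<mu>\<in>S. \<mu> k > 0)"
    unfolding k_def using LeastI_ex[OF ex] .
  then obtain \<mu> where k: "k \<ge> 1" and \<mu>: "\<mu> \<in> S" "\<mu> k > 0"
    by blast
  have least: "\<mu>' l = 0" if "\<mu>' \<in> S" "1 \<le> l" "l < k" for \<mu>' l
    using not_less_Least[of l "\<lambda>k. k \<ge> 1 \<and> (\<exists>\<mu>\<in>S. \<mu> k > 0)"] that unfolding k_def by auto
  have \<mu>I: "\<mu> \<in> exps m d"
    using \<mu> S by auto
  have km: "k \<le> m"
    using exps_pos_le[OF \<mu>I \<mu>(2)] .
  define \<nu> where "\<nu> = low k \<mu>"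
  have \<nu>: "\<nu> \<in> exps m d"
    unfolding \<nu>_def by (rule low_exps[OF \<mu>I k km \<mu>(2)])
  have \<nu>1: "\<nu> (k - 1) = \<mu> (k - 1) + 1"
    using k by (auto simp: \<nu>_def low_def dec_def)
  have not_dec: "\<not> (\<nu> = dec 1 \<mu>' \<and> \<mu>' 1 > 0)" if \<mu>': "\<mu>' \<in> S" for \<mu>'
  proof
    assume *: "\<nu> = dec 1 \<mu>' \<and> \<mu>' 1 > 0"
    then have "k = 1"
      using least[OF \<mu>', of 1] k by (cases "k = 1") auto
    then show False
      using * \<nu>1 hom[OF \<mu>'] hom[OF \<mu>(1)] by (simp add: dec_def)
  qed
  have only: "\<mu>' = \<mu> \<and> l = k" if \<mu>': "\<mu>' \<in> S" and l: "\<nu> = low l \<mu>'" "\<mu>' l > 0" "l \<ge> 1" for \<mu>' l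
  proof -
    have "k \<le> l"
      using least[OF \<mu>', of l] l by (cases "l < k") auto
    moreover have "\<not> k < l"
    proof
      assume "k < l"
      then have "\<nu> (k - 1) = \<mu>' (k - 1)"
        unfolding l(1) using k \<open>k < l\<close> by (auto simp: low_def dec_def)
      then have pos: "\<mu>' (k - 1) = \<mu> (k - 1) + 1"
        using \<nu>1 by simp
      show False
      proof (cases "k = 1")
        case True
        then show ?thesis
          using pos hom[OF \<mu>'] hom[OF \<mu>(1)] by simp
      next
        case False
        then have "1 \<le> k - 1" "k - 1 < k"
          using k by auto
        then show ?thesis
          using pos least[OF \<mu>', of "k - 1"] by simp
      qed
    qed
    ultimately have "l = k"
      by simp
    moreover have "\<mu>' i = \<mu> i" for i
    proof -
      have "low k \<mu>' i = low k \<mu> i"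
        using l(1) \<open>l = k\<close> by (simp add: \<nu>_def)
      then show ?thesis
        using \<mu>(2) l(2) k \<open>l = k\<close> by (cases "i = k"; cases "i = k - 1") (auto simp: low_def dec_def)
    qed
    ultimately show ?thesis
      by auto
  qed
  have A_other: "mon_A m \<mu>' \<nu> = 0" if "\<mu>' \<in> S" "\<mu>' \<noteq> \<mu>" for \<mu>'
  proof -
    have "(\<Sum>l=1..m. if \<nu> = low l \<mu>' then (if l = 1 then - int (\<mu>' l) else int (\<mu>' l)) else 0) = 0"
    proof (intro sum.neutral ballI)
      fix l assume "l \<in> {1..m}"
      then show "(if \<nu> = low l \<mu>' then (if l = 1 then - int (\<mu>' l) else int (\<mu>' l)) else 0) = 0"
        using only[OF that(1), of l] that(2) by (cases "\<mu>' l = 0") auto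
    qed
    then show ?thesis
      unfolding mon_A_def using not_dec[OF that(1)] by auto
  qed
  have "(\<Sum>l=1..m. if \<nu> = low l \<mu> then (if l = 1 then - int (\<mu> l) else int (\<mu> l)) else 0) =
      (\<Sum>l=1..m. if l = k then (if k = 1 then - int (\<mu> k) else int (\<mu> k)) else 0)"
    using only[OF \<mu>(1)] by (intro sum.cong refl) (auto simp: \<nu>_def)
  then have "mon_A m \<mu> \<nu> = (if k = 1 then - int (\<mu> k) else int (\<mu> k))"
    unfolding mon_A_def using not_dec[OF \<mu>(1)] k km by auto
  then have "mon_A m \<mu> \<nu> \<noteq> 0"
    using \<mu>(2) by auto
  moreover have "(\<Sum>\<mu>'\<in>S. of_int (mon_A m \<mu>' \<nu>) * v \<mu>') = of_int (mon_A m \<mu> \<nu>) * v \<mu>"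
  proof -
    have "(\<Sum>\<mu>'\<in>S. of_int (mon_A m \<mu>' \<nu>) * v \<mu>') =
        (\<Sum>\<mu>'\<in>S. if \<mu>' = \<mu> then of_int (mon_A m \<mu> \<nu>) * v \<mu> else 0)"
      using A_other by (intro sum.cong) auto
    then show ?thesis
      using \<mu>(1) finite_subset[OF S finite_exps] by simp
  qed
  ultimately show False
    using ker[OF \<nu>] v[OF \<mu>(1)] by simp
qed

lemma gen_mon_e_fun: "e_fun (gen_mon m \<mu>)"
  unfolding gen_mon_def by (intro e_fun_prod e_fun_power e_fun_gen_fps)

lemma eval_prod_entire:
  fixes f :: "'i \<Rightarrow> real fps"
  assumes "\<And>i. i \<in> S \<Longrightarrow> fps_conv_radius (f i) = \<infinity>"
  shows "fps_conv_radius (prod f S) = \<infinity> \<and> eval_fps (prod f S) z = (\<Prod>i\<in>S. eval_fps (f i) z)"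
  using assms
proof (induction S rule: infinite_finite_induct)
  case (insert i S)
  then have *: "fps_conv_radius (f i) = \<infinity>" "fps_conv_radius (prod f S) = \<infinity>"
      "eval_fps (prod f S) z = (\<Prod>i\<in>S. eval_fps (f i) z)"
    by auto
  have "fps_conv_radius (f i * prod f S) = \<infinity>"
    using fps_conv_radius_mult[of "f i" "prod f S"] * by simp
  with * insert show ?case
    by (simp add: eval_fps_mult)
qed auto

lemma eval_gen_mon: "eval_fps (gen_mon m \<mu>) 1 = (\<Prod>i\<le>m. gen_val i ^ \<mu> i)"
proof -
  have "fps_conv_radius (gen_fps i) = \<infinity>" "fps_conv_radius (gen_fps i ^ k) = \<infinity>" for i k
    by (intro e_fun_conv_radius e_fun_power e_fun_gen_fps)+
  then show ?thesis
    unfolding gen_mon_def using eval_prod_entire[of "{..m}" "\<lambda>i. gen_fps i ^ \<mu> i" 1]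
    by (simp add: eval_fps_power eval_gen_fps)
qed

lemma (in triangular_system) exists_minimal_nonzero:
  assumes U: "stable U" and v: "v \<in> U" "\<exists>i<M. v i \<noteq> 0"
  shows "\<exists>v\<in>U. (\<exists>i<M. v i \<noteq> 0) \<and> (\<forall>j<M. (\<Sum>i<M. of_int (A0 i j) * v i) = 0) \<and>
    (\<exists>b. \<forall>i<M. v i \<noteq> 0 \<longrightarrow> be i = b)"
proof -
  define supp where "supp = (\<lambda>v :: nat \<Rightarrow> real. {i. i < M \<and> v i \<noteq> 0})"
  define top where "top = (\<lambda>v. Max (wt ` supp v))"
  \<comment> \<open>Codes a lexicographic order in one number: top weight first, then the number of
    values of \<open>be\<close>, which is at most M.\<close>
  define phi where "phi = (\<lambda>v. top v * (M + 1) + card (be ` supp v))"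
  define nz where "nz = (\<lambda>v. v \<in> U \<and> supp v \<noteq> {})"
  have fin: "finite (supp v)" for v
    by (simp add: supp_def)
  have nz0: "nz v"
    using v by (auto simp: nz_def supp_def)
  obtain v where nz: "nz v" and min: "\<And>u. nz u \<Longrightarrow> phi v \<le> phi u"
    using ex_has_least_nat[of nz v phi, OF nz0] by blast
  have vU: "v \<in> U" and ne: "supp v \<noteq> {}"
    using nz by (auto simp: nz_def)
  have card_le: "card (be ` supp u) \<le> M" for u
  proof -
    have "card (be ` supp u) \<le> card (supp u)"
      using fin by (rule card_image_le)
    also have "\<dots> \<le> card {..<M}"
      by (rule card_mono) (auto simp: supp_def)
    finally show ?thesis
      by simp
  qed
  define u where "u = (\<lambda>j. \<Sum>i<M. of_int (A0 i j) * v i)"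
  have "supp u = {}"
  proof (rule ccontr)
    assume ne_u: "supp u \<noteq> {}"
    have "u \<in> U"
      using U vU unfolding stable_def u_def by blast
    then have "nz u"
      using ne_u by (simp add: nz_def)
    have "wt j < top v" if j: "j \<in> supp u" for j
    proof -
      have "(\<Sum>i<M. of_int (A0 i j) * v i) \<noteq> 0"
        using j by (simp add: supp_def u_def)
      then obtain i where i: "i < M" "of_int (A0 i j) * v i \<noteq> 0"
        by (metis (no_types, lifting) lessThan_iff sum.neutral)
      then have "wt j < wt i"
        using tri[of i j] j by (auto simp: supp_def)
      also have "wt i \<le> top v"
        unfolding top_def using i fin by (intro Max_ge) (auto simp: supp_def)
      finally show ?thesis .
    qed
    then have "Max (wt ` supp u) < top v"
      using fin ne_u by (subst Max_less_iff) auto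
    then have "top u < top v"
      by (simp add: top_def)
    then have "(top u + 1) * (M + 1) \<le> top v * (M + 1)"
      by (intro mult_le_mono1) simp
    then have "phi u < phi v"
      using card_le[of u] by (simp add: phi_def)
    then show False
      using min[OF \<open>nz u\<close>] by simp
  qed
  then have ker: "\<forall>j<M. (\<Sum>i<M. of_int (A0 i j) * v i) = 0"
    by (auto simp: supp_def u_def)
  have same: "be i = be i'" if "i \<in> supp v" "i' \<in> supp v" for i i'
  proof (rule ccontr)
    assume ne_be: "be i \<noteq> be i'"
    \<comment> \<open>Multiplying entry j by \<open>be j - be i\<close> removes the value
      \<open>be i\<close> from the support, keeps the entry \<open>i'\<close>, and does not raise
      the top weight.\<close>
    define x where "x = (\<lambda>j. of_int (be j) * v j + (- of_int (be i)) * v j)"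
    have x: "x j = of_int (be j - be i) * v j" for j
      by (simp add: x_def algebra_simps)
    have add: "(\<lambda>j. f j + g j) \<in> U" if "f \<in> U" "g \<in> U" for f g
      using U that unfolding stable_def by blast
    have "(\<lambda>j. of_int (be j) * v j) \<in> U" "(\<lambda>j. (- of_int (be i)) * v j) \<in> U"
      using U vU unfolding stable_def by blast+
    then have "x \<in> U"
      unfolding x_def by (rule add)
    moreover have sub: "supp x \<subseteq> supp v"
      by (auto simp: supp_def x)
    moreover have i': "i' \<in> supp x"
      using that ne_be by (auto simp: supp_def x)
    ultimately have "nz x"
      by (auto simp: nz_def)
    have "top x \<le> top v"
      unfolding top_def using sub i' fin by (intro Max_mono) auto
    have "be i \<notin> be ` supp x"
      by (auto simp: supp_def x)
    then have "be ` supp x \<subset> be ` supp v"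
      using sub that(1) by auto
    then have "card (be ` supp x) < card (be ` supp v)"
      using fin by (intro psubset_card_mono) auto
    then have "phi x < phi v"
      using \<open>top x \<le> top v\<close> unfolding phi_def by (intro add_le_less_mono mult_le_mono1)
    then show False
      using min[OF \<open>nz x\<close>] by simp
  qed
  obtain i0 where "i0 \<in> supp v"
    using ne by blast
  then have "\<forall>i<M. v i \<noteq> 0 \<longrightarrow> be i = be i0"
    using same[of _ i0] unfolding supp_def by blast
  moreover have "\<exists>i<M. v i \<noteq> 0"
    using ne unfolding supp_def by blast
  ultimately show ?thesis
    using vU ker by blast
qed

theorem gen_val_monomials_independent:
  fixes c :: "(nat \<Rightarrow> nat) \<Rightarrow> int"
  assumes rel: "(\<Sum>\<mu>\<in>exps m d. of_int (c \<mu>) * (\<Prod>i\<le>m. gen_val i ^ \<mu> i)) = 0" and \<mu>: "\<mu> \<in> exps m d"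
  shows "c \<mu> = 0"
proof (rule ccontr)
  assume c: "c \<mu> \<noteq> 0"
  define M where "M = card (exps m d)"
  obtain h where h: "bij_betw h {..<M} (exps m d)"
    unfolding M_def using ex_bij_betw_nat_finite[OF finite_exps, of m d] by (auto simp: atLeast0LessThan)
  have hI: "h i \<in> exps m d" if "i < M" for i
    using h that by (auto simp: bij_betw_def)
  have h_ex: "\<exists>i<M. h i = \<nu>" if "\<nu> \<in> exps m d" for \<nu>
  proof -
    have "\<nu> \<in> h ` {..<M}"
      using h that by (simp add: bij_betw_def)
    then show ?thesis
      by auto
  qed
  have h_inj: "i = j" if "i < M" "j < M" "h i = h j" for i j
    using h that unfolding bij_betw_def inj_on_def by simp
  have reindex: "(\<Sum>i<M. g (h i)) = (\<Sum>\<nu>\<in>exps m d. g \<nu>)" for g :: "(nat \<Rightarrow> nat) \<Rightarrow> 'b::comm_monoid_add"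
    by (rule sum.reindex_bij_betw[OF h])
  interpret triangular_system M "\<lambda>i j. mon_A m (h i) (h j)" "\<lambda>i. - int (h i 0)"
    "\<lambda>i. mon_wt m (h i)" "\<lambda>i. gen_mon m (h i)"
  proof
    show "mon_wt m (h j) < mon_wt m (h i)" if "i < M" "j < M" "mon_A m (h i) (h j) \<noteq> 0" for i j
      using mon_wt_less[OF that(3) hI[OF that(1)]] .
    show "fps_XD (gen_mon m (h i)) = (\<Sum>j<M. fps_const (real_of_int (mon_A m (h i) (h j))) * gen_mon m (h j)) +
        fps_const (real_of_int (- int (h i 0))) * fps_X * gen_mon m (h i)" if "i < M" for i
      using XD_gen_mon[OF hI[OF that]] reindex[of "\<lambda>\<nu>. fps_const (real_of_int (mon_A m (h i) \<nu>)) * gen_mon m \<nu>"]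
      by simp
  qed
  \<comment> \<open>The minimal vector of a stable space is supported on a single power of exp (-z),
    and such a power has constant term 1.\<close>
  have kernel: "\<exists>v\<in>U. (\<Sum>i<M. v i * fps_nth (gen_mon m (h i)) 0) \<noteq> 0"
    if U: "stable U" and v0: "v0 \<in> U" "i0 < M" "v0 i0 \<noteq> 0" for U v0 i0
  proof -
    obtain v b where v: "v \<in> U" "\<exists>i<M. v i \<noteq> 0"
      and ker: "\<And>j. j < M \<Longrightarrow> (\<Sum>i<M. of_int (mon_A m (h i) (h j)) * v i) = 0"
      and b: "\<And>i. i < M \<Longrightarrow> v i \<noteq> 0 \<Longrightarrow> - int (h i 0) = b"
      using exists_minimal_nonzero[OF U v0(1)] v0(2,3) by blast
    obtain i where i: "i < M" "v i \<noteq> 0"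
      using v(2) by blast
    define S where "S = h ` {i. i < M \<and> v i \<noteq> 0}"
    \<comment> \<open>Moves \<open>v\<close> from indices to exponent vectors; on the range of
      \<open>h\<close> the choice is unique by injectivity.\<close>
    define u where "u = (\<lambda>\<nu>. v (SOME i. i < M \<and> h i = \<nu>))"
    have u: "u (h j) = v j" if "j < M" for j
    proof -
      have "(SOME i. i < M \<and> h i = h j) = j"
        by (rule some_equality) (use that h_inj in blast)+
      then show ?thesis
        by (simp add: u_def)
    qed
    have zero: "h j k = 0" if j: "j < M" "v j \<noteq> 0" and k: "k \<ge> 1" for j k
    proof (rule kernel_supported_on_powers_of_gen_fps_0[of S "nat (- b)" m d u "h j" k])
      show "\<nu> 0 = nat (- b)" if "\<nu> \<in> S" for \<nu>
        using that b by (force simp: S_def)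
      show "S \<subseteq> exps m d"
        using hI by (auto simp: S_def)
      show "u \<nu> \<noteq> 0" if "\<nu> \<in> S" for \<nu>
        using that u by (auto simp: S_def)
      show "(\<Sum>\<mu>\<in>S. of_int (mon_A m \<mu> \<nu>) * u \<mu>) = 0" if \<nu>: "\<nu> \<in> exps m d" for \<nu>
      proof -
        obtain l where l: "l < M" "h l = \<nu>"
          using h_ex[OF \<nu>] by blast
        have "(\<Sum>\<mu>\<in>S. of_int (mon_A m \<mu> \<nu>) * u \<mu>) = (\<Sum>\<mu>\<in>exps m d. of_int (mon_A m \<mu> \<nu>) * u \<mu>)"
        proof (rule sum.mono_neutral_left[OF finite_exps])
          show "S \<subseteq> exps m d"
            using hI by (auto simp: S_def)
          show "\<forall>\<mu>\<in>exps m d - S. of_int (mon_A m \<mu> \<nu>) * u \<mu> = 0"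
          proof
            fix \<mu> assume \<mu>: "\<mu> \<in> exps m d - S"
            then obtain j where "j < M" "h j = \<mu>"
              using h_ex by blast
            then show "of_int (mon_A m \<mu> \<nu>) * u \<mu> = 0"
              using \<mu> u[of j] by (auto simp: S_def)
          qed
        qed
        also have "\<dots> = (\<Sum>i<M. of_int (mon_A m (h i) \<nu>) * u (h i))"
          by (rule reindex[symmetric])
        also have "\<dots> = (\<Sum>i<M. of_int (mon_A m (h i) \<nu>) * v i)"
          by (intro sum.cong refl) (simp add: u)
        finally show ?thesis
          using ker[OF l(1)] l(2) by simp
      qed
      show "h j \<in> S"
        using j by (auto simp: S_def)
    qed (rule k)
    have single: "j = i" if j: "j < M" "v j \<noteq> 0" for j
    proof (rule h_inj[OF j(1) i(1)], rule ext)
      fix k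
      show "h j k = h i k"
        using b[OF j] b[OF i] zero[OF j, of k] zero[OF i, of k] by (cases "k = 0") auto
    qed
    have "gen_mon m (h i) = gen_fps 0 ^ h i 0"
    proof -
      have "(\<Prod>k\<le>m. gen_fps k ^ h i k) = (\<Prod>k\<in>{0}. gen_fps k ^ h i k)"
        by (rule prod.mono_neutral_right) (use zero[OF i] in auto)
      then show ?thesis
        by (simp add: gen_mon_def)
    qed
    then have one: "fps_nth (gen_mon m (h i)) 0 = 1"
      by (simp add: gen_fps_def fps_power_zeroth)
    have "(\<Sum>j<M. v j * fps_nth (gen_mon m (h j)) 0) = (\<Sum>j<M. if j = i then v i else 0)"
      using single one by (intro sum.cong refl) auto
    then show ?thesis
      using v(1) i by (intro bexI[of _ v]) auto
  qed
  have "(\<lambda>_. 0) \<in> exps m d"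
    by (simp add: exps_def)
  then obtain i1 where i1: "i1 < M" "h i1 = (\<lambda>_. 0)"
    using h_ex by blast
  have w1: "gen_mon m (h i1) = 1"
    by (simp add: i1 gen_mon_def)
  have rel': "(\<Sum>i<M. of_int (c (h i)) * eval_fps (gen_mon m (h i)) 1) = 0"
    using rel reindex[of "\<lambda>\<mu>. of_int (c \<mu>) * eval_fps (gen_mon m \<mu>) 1"] by (simp add: eval_gen_mon)
  obtain l0 where l0: "l0 < M" "h l0 = \<mu>"
    using h_ex[OF \<mu>] by blast
  show False
  proof (rule no_integer_relation[of i1 "\<lambda>i. c (h i)" l0])
    show "\<exists>v\<in>U. (\<Sum>i<M. v i * fps_nth (gen_mon m (h i)) 0) \<noteq> 0"
      if "stable U" "v \<in> U" "i < M" "v i \<noteq> 0" for U v i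
      using kernel[OF that] .
    show "c (h l0) \<noteq> 0"
      using l0 c by simp
  qed (rule gen_mon_e_fun i1(1) w1 rel' l0(1))+
qed

subsection \<open>From algebraic to integer coefficients\<close>

text \<open>\<open>B\<close> serves as a set of generators that may be dependent, so the
  coefficients \<open>t\<close> are in general not determined by the element.\<close>

definition zspan :: "complex set \<Rightarrow> complex set" where
  "zspan B = {x. \<exists>t :: complex \<Rightarrow> int. x = (\<Sum>y\<in>B. of_int (t y) * y)}"

lemma zspan_add: "x \<in> zspan B \<Longrightarrow> y \<in> zspan B \<Longrightarrow> x + y \<in> zspan B"
  unfolding zspan_def
proof safe
  fix t u :: "complex \<Rightarrow> int"
  show "\<exists>v :: complex \<Rightarrow> int. (\<Sum>y\<in>B. of_int (t y) * y) + (\<Sum>y\<in>B. of_int (u y) * y) = (\<Sum>y\<in>B. of_int (v y) * y)"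
    by (intro exI[of _ "\<lambda>y. t y + u y"]) (simp add: distrib_right sum.distrib)
qed

lemma zspan_scale: "x \<in> zspan B \<Longrightarrow> of_int n * x \<in> zspan B"
  unfolding zspan_def
proof safe
  fix t :: "complex \<Rightarrow> int"
  show "\<exists>v :: complex \<Rightarrow> int. of_int n * (\<Sum>y\<in>B. of_int (t y) * y) = (\<Sum>y\<in>B. of_int (v y) * y)"
    by (intro exI[of _ "\<lambda>y. n * t y"]) (simp add: sum_distrib_left mult.assoc)
qed

lemma zspan_0: "0 \<in> zspan B"
  unfolding zspan_def by (auto intro: exI[of _ "\<lambda>_. 0"])

lemma zspan_sum: "(\<And>s. s \<in> S \<Longrightarrow> f s \<in> zspan B) \<Longrightarrow> sum f S \<in> zspan B"
  by (induction S rule: infinite_finite_induct) (auto intro: zspan_0 zspan_add)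

lemma zspan_base: "finite B \<Longrightarrow> x \<in> B \<Longrightarrow> x \<in> zspan B"
  unfolding zspan_def by (auto intro!: exI[of _ "\<lambda>y. if y = x then 1 else 0"]
      simp: if_distrib[of "\<lambda>c. of_int c * _"] cong: if_cong)

lemma zspan_mult:
  assumes "\<And>y. y \<in> B \<Longrightarrow> a * y \<in> zspan C" "x \<in> zspan B"
  shows "a * x \<in> zspan C"
proof -
  obtain t :: "complex \<Rightarrow> int" where t: "x = (\<Sum>y\<in>B. of_int (t y) * y)"
    using assms(2) unfolding zspan_def by blast
  have "a * x = (\<Sum>y\<in>B. of_int (t y) * (a * y))"
    by (simp add: t sum_distrib_left mult.left_commute)
  also have "\<dots> \<in> zspan C"
    by (intro zspan_sum zspan_scale assms(1))
  finally show ?thesis .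
qed

text \<open>The elements are adjoined one at a time: \<open>B\<close> is multiplied by the powers of
  \<open>a\<close> below the degree of an integer polynomial annihilating \<open>a\<close>, whose
  leading coefficient serves as denominator because it rewrites the top power in lower ones. The
  denominators of the earlier elements stay valid.\<close>

lemma algebraic_module:
  assumes "finite S" "\<And>a. a \<in> S \<Longrightarrow> algebraic a"
  shows "\<exists>B. finite B \<and> 1 \<in> B \<and> (\<forall>a\<in>S. \<exists>N::int. N \<noteq> 0 \<and> (\<forall>x\<in>B. of_int N * a * x \<in> zspan B))"
  using assms
proof (induction S rule: finite_induct)
  case empty
  then show ?case
    by (intro exI[of _ "{1}"]) auto
next
  case (insert a S)
  then obtain B where B: "finite B" "1 \<in> B"
    "\<And>a. a \<in> S \<Longrightarrow> \<exists>N::int. N \<noteq> 0 \<and> (\<forall>x\<in>B. of_int N * a * x \<in> zspan B)"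
    by auto
  have "algebraic a"
    using insert.prems by simp
  then obtain p :: "int poly" where p: "poly (map_poly of_int p) a = 0" "p \<noteq> 0"
    by (elim algebraicE') auto
  define e where "e = degree p"
  define c where "c = coeff p"
  have ce: "c e \<noteq> 0"
    using p by (simp add: c_def e_def)
  have "(\<Sum>k\<le>e. of_int (c k) * a ^ k) = 0"
    using p(1) by (simp add: poly_altdef c_def e_def coeff_map_poly degree_map_poly)
  then have top: "of_int (c e) * a ^ e = (\<Sum>k<e. of_int (- c k) * a ^ k)"
    by (simp add: lessThan_Suc_atMost[symmetric] sum_negf eq_neg_iff_add_eq_0 add.commute)
  have e: "e > 0"
  proof (rule ccontr)
    assume "\<not> e > 0"
    then show False
      using top ce by simp
  qed
  define B' where "B' = (\<lambda>(x, k). x * a ^ k) ` (B \<times> {..<e})"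
  have B': "finite B'"
    using B by (simp add: B'_def)
  have B'I: "x * a ^ k \<in> B'" if "x \<in> B" "k < e" for x k
    unfolding B'_def using that by force
  have base: "x * a ^ k \<in> zspan B'" if "x \<in> B" "k < e" for x k
    by (intro zspan_base B' B'I that)
  have "1 \<in> B'"
    using B'I[of 1 0] B e by simp
  moreover have "\<exists>N::int. N \<noteq> 0 \<and> (\<forall>x\<in>B'. of_int N * a' * x \<in> zspan B')" if a': "a' \<in> S" for a'
  proof -
    obtain N :: int where N: "N \<noteq> 0" "\<And>x. x \<in> B \<Longrightarrow> of_int N * a' * x \<in> zspan B"
      using B(3)[OF a'] by blast
    have "of_int N * a' * (x * a ^ k) \<in> zspan B'" if xk: "x \<in> B" "k < e" for x k
    proof -
      have "a ^ k * (of_int N * a' * x) \<in> zspan B'"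
      proof (rule zspan_mult[of B])
        show "a ^ k * y \<in> zspan B'" if "y \<in> B" for y
          using base[OF that xk(2)] by (simp add: mult.commute)
      qed (rule N(2)[OF xk(1)])
      then show ?thesis
        by (simp add: mult_ac)
    qed
    then show ?thesis
      using N(1) by (intro exI[of _ N]) (auto simp: B'_def)
  qed
  moreover have "\<exists>N::int. N \<noteq> 0 \<and> (\<forall>x\<in>B'. of_int N * a * x \<in> zspan B')"
  proof -
    have "of_int (c e) * a * (x * a ^ k) \<in> zspan B'" if xk: "x \<in> B" "k < e" for x k
    proof (cases "Suc k < e")
      case True
      have "of_int (c e) * a * (x * a ^ k) = of_int (c e) * (x * a ^ Suc k)"
        by (simp add: mult_ac)
      then show ?thesis
        using zspan_scale[OF base[OF xk(1) True]] by metis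
    next
      case False
      then have "e = Suc k"
        using xk by simp
      then have "of_int (c e) * a * (x * a ^ k) = x * (of_int (c e) * a ^ e)"
        by (simp add: mult_ac)
      also have "\<dots> = (\<Sum>k<e. of_int (- c k) * (x * a ^ k))"
        unfolding top by (simp add: sum_distrib_left mult_ac)
      also have "\<dots> \<in> zspan B'"
        by (intro zspan_sum zspan_scale base xk) auto
      finally show ?thesis .
    qed
    then show ?thesis
      using ce by (intro exI[of _ "c e"]) (auto simp: B'_def)
  qed
  ultimately show ?case
    using B' by (intro exI[of _ B']) auto
qed

section \<open>Evaluation of integer polynomials\<close>

context
  fixes x :: "'i \<Rightarrow> complex"
begin

definition mexp :: "('i \<Rightarrow>\<^sub>0 nat) \<Rightarrow> complex" where
  "mexp \<mu> = (\<Prod>i\<in>Poly_Mapping.keys \<mu>. x i ^ Poly_Mapping.lookup \<mu> i)"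

definition int_eval :: "('i, int) mpolynomial \<Rightarrow> complex" where
  "int_eval q = (\<Sum>\<mu>\<in>Poly_Mapping.keys q. of_int (Poly_Mapping.lookup q \<mu>) * mexp \<mu>)"

lemma mexp_superset:
  assumes "finite K" "Poly_Mapping.keys \<mu> \<subseteq> K"
  shows "mexp \<mu> = (\<Prod>i\<in>K. x i ^ Poly_Mapping.lookup \<mu> i)"
  unfolding mexp_def using assms
  by (intro prod.mono_neutral_left) (auto simp: in_keys_iff)

lemma mexp_add: "mexp (\<mu> + \<nu>) = mexp \<mu> * mexp \<nu>"
proof -
  define K where "K = Poly_Mapping.keys \<mu> \<union> Poly_Mapping.keys \<nu>"
  have K: "finite K" "Poly_Mapping.keys \<mu> \<subseteq> K" "Poly_Mapping.keys \<nu> \<subseteq> K"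
    "Poly_Mapping.keys (\<mu> + \<nu>) \<subseteq> K"
    using Poly_Mapping.keys_add[of \<mu> \<nu>] by (auto simp: K_def)
  then show ?thesis
    by (simp add: mexp_superset[of K] lookup_add power_add prod.distrib)
qed

lemma int_eval_superset:
  assumes "finite K" "Poly_Mapping.keys q \<subseteq> K"
  shows "int_eval q = (\<Sum>\<mu>\<in>K. of_int (Poly_Mapping.lookup q \<mu>) * mexp \<mu>)"
  unfolding int_eval_def using assms
  by (intro sum.mono_neutral_left) (auto simp: in_keys_iff)

lemma int_eval_add: "int_eval (p + q) = int_eval p + int_eval q"
proof -
  define K where "K = Poly_Mapping.keys p \<union> Poly_Mapping.keys q"
  have K: "finite K" "Poly_Mapping.keys p \<subseteq> K" "Poly_Mapping.keys q \<subseteq> K"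
    "Poly_Mapping.keys (p + q) \<subseteq> K"
    using Poly_Mapping.keys_add[of p q] by (auto simp: K_def)
  then show ?thesis
    by (simp add: int_eval_superset[of K] lookup_add distrib_right sum.distrib)
qed

lemma int_eval_single: "int_eval (Poly_Mapping.single \<mu> c) = of_int c * mexp \<mu>"
  by (simp add: int_eval_def)

lemma int_eval_0: "int_eval 0 = 0"
  by (simp add: int_eval_def)

lemma int_eval_diff: "int_eval (p - q) = int_eval p - int_eval q"
  using int_eval_add[of "p - q" q] by simp

text \<open>Integer polynomials form the free abelian group on the monomials and both sides are
  additive in each factor, so monomials suffice.\<close>

lemma int_eval_mult: "int_eval (p * q) = int_eval p * int_eval q"
using subset_UNIV[of "Poly_Mapping.keys p"]
proof (induction p rule: frag_induction)
  case (one \<mu>)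
  show ?case
    using subset_UNIV[of "Poly_Mapping.keys q"]
proof (induction q rule: frag_induction)
    case (one \<nu>)
    show ?case
      by (simp add: mult_single int_eval_single mexp_add)
  next
    case (diff a b)
    then show ?case
      by (simp add: right_diff_distrib int_eval_diff)
  qed (simp_all add: int_eval_0)
next
  case (diff a b)
  then show ?case
    by (simp add: left_diff_distrib int_eval_diff)
qed (simp_all add: int_eval_0)

lemma int_eval_1: "int_eval 1 = 1"
  using int_eval_single[of 0 1] by (simp add: mexp_def)

lemma int_eval_dt: "int_eval (dt n f) = dt n (\<lambda>i j. int_eval (f i j))"
proof -
  interpret comm_ring_hom int_eval
    by unfold_locales (simp_all add: int_eval_add int_eval_mult int_eval_1 int_eval_0)
  show ?thesis
    by (rule hom_dt)
qed

end

lemma lookup_single_mult: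
  fixes c :: "('i \<Rightarrow>\<^sub>0 nat) \<Rightarrow>\<^sub>0 int"
  shows "Poly_Mapping.lookup (Poly_Mapping.single \<mu> t * c) (\<mu> + \<kappa>) = t * Poly_Mapping.lookup c \<kappa>"
using subset_UNIV[of "Poly_Mapping.keys c"]
proof (induction c rule: frag_induction)
  case (one \<nu>)
  show ?case
    by (simp add: mult_single lookup_single when_def)
next
  case (diff a b)
  then show ?case
    by (simp add: right_diff_distrib lookup_minus)
qed simp_all

theorem integer_relation_of_algebraic_relation:
  fixes p :: "(nat, complex) mpolynomial"
  assumes alg: "\<And>\<mu>. algebraic (Poly_Mapping.lookup p \<mu>)" and p: "p \<noteq> 0"
    and eval: "mpolynomial_eval x p = 0"
  shows "\<exists>q :: (nat, int) mpolynomial. q \<noteq> 0 \<and> int_eval x q = 0"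
proof -
  define K where "K = Poly_Mapping.keys p"
  have K: "finite K" "K \<noteq> {}"
    using p by (simp_all add: K_def)
  define \<mu>0 where "\<mu>0 = Max K"
  have \<mu>0: "\<mu>0 \<in> K" "\<And>\<mu>. \<mu> \<in> K \<Longrightarrow> \<mu> \<le> \<mu>0"
    using K by (auto simp: \<mu>0_def)
  define a where "a = (\<lambda>\<mu>. Poly_Mapping.lookup p \<mu>)"
  \<comment> \<open>Dividing by the coefficient of the largest monomial turns its multiplication
    matrix into \<open>N0\<close> times the identity; this is what will make the determinant a
    nonzero polynomial.\<close>
  define r where "r = inverse (a \<mu>0)"
  have a0: "a \<mu>0 \<noteq> 0"
    using \<mu>0(1) by (simp add: a_def K_def in_keys_iff)
  have "algebraic y" if "y \<in> insert r (a ` K)" for y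
    using that alg by (auto simp: a_def r_def)
  then have "\<exists>B. finite B \<and> 1 \<in> B \<and> (\<forall>y\<in>insert r (a ` K). \<exists>N::int. N \<noteq> 0 \<and> (\<forall>z\<in>B. of_int N * y * z \<in> zspan B))"
    using K(1) by (intro algebraic_module) auto
  then obtain B where B: "finite B" "1 \<in> B"
    "\<And>y. y \<in> insert r (a ` K) \<Longrightarrow> \<exists>N::int. N \<noteq> 0 \<and> (\<forall>z\<in>B. of_int N * y * z \<in> zspan B)"
    by blast
  have "\<exists>N::int. N \<noteq> 0 \<and> (\<forall>z\<in>B. of_int N * (a \<mu> * r) * z \<in> zspan B)" if \<mu>: "\<mu> \<in> K" for \<mu>
  proof -
    obtain N1 :: int where N1: "N1 \<noteq> 0" "\<And>z. z \<in> B \<Longrightarrow> of_int N1 * a \<mu> * z \<in> zspan B"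
      using B(3)[of "a \<mu>"] \<mu> by auto
    obtain N2 :: int where N2: "N2 \<noteq> 0" "\<And>z. z \<in> B \<Longrightarrow> of_int N2 * r * z \<in> zspan B"
      using B(3)[of r] by auto
    have "of_int (N1 * N2) * (a \<mu> * r) * z \<in> zspan B" if "z \<in> B" for z
    proof -
      have "of_int (N1 * N2) * (a \<mu> * r) * z = (of_int N1 * a \<mu>) * (of_int N2 * r * z)"
        by simp
      also have "\<dots> \<in> zspan B"
        by (rule zspan_mult[OF N1(2) N2(2)[OF that]])
      finally show ?thesis .
    qed
    then show ?thesis
      using N1(1) N2(1) by (intro exI[of _ "N1 * N2"]) auto
  qed
  then obtain N :: "(nat \<Rightarrow>\<^sub>0 nat) \<Rightarrow> int"
    where N: "\<And>\<mu>. \<mu> \<in> K \<Longrightarrow> N \<mu> \<noteq> 0"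
      "\<And>\<mu> z. \<mu> \<in> K \<Longrightarrow> z \<in> B \<Longrightarrow> of_int (N \<mu>) * (a \<mu> * r) * z \<in> zspan B"
    by metis
  define N0 where "N0 = (\<Prod>\<mu>\<in>K. N \<mu>)"
  have N0: "N0 \<noteq> 0"
    using N(1) K(1) by (simp add: N0_def)
  have common: "of_int N0 * (a \<mu> * r) * z \<in> zspan B" if "\<mu> \<in> K" "z \<in> B" for \<mu> z
  proof -
    have "N0 = (\<Prod>\<nu>\<in>K - {\<mu>}. N \<nu>) * N \<mu>"
      unfolding N0_def using K(1) that(1) by (subst prod.remove[of K \<mu>]) auto
    then have "of_int N0 * (a \<mu> * r) * z = of_int (\<Prod>\<nu>\<in>K - {\<mu>}. N \<nu>) * (of_int (N \<mu>) * (a \<mu> * r) * z)"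
      by (simp add: mult.assoc)
    then show ?thesis
      using zspan_scale[OF N(2)[OF that]] by metis
  qed
  define D where "D = card B"
  obtain b where b: "bij_betw b {..<D} B"
    unfolding D_def using ex_bij_betw_nat_finite[OF B(1)] by (auto simp: atLeast0LessThan)
  have bB: "b i \<in> B" if "i < D" for i
    using b that by (auto simp: bij_betw_def)
  have "\<exists>t :: nat \<Rightarrow> int. of_int N0 * (a \<mu> * r) * b i = (\<Sum>j<D. of_int (t j) * b j)"
    if \<mu>: "\<mu> \<in> K" and i: "i < D" for \<mu> i
  proof -
    obtain t :: "complex \<Rightarrow> int" where t: "of_int N0 * (a \<mu> * r) * b i = (\<Sum>y\<in>B. of_int (t y) * y)"
      using common[OF \<mu> bB[OF i]] unfolding zspan_def by blast
    have "(\<Sum>y\<in>B. of_int (t y) * y) = (\<Sum>j<D. of_int (t (b j)) * b j)"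
      by (rule sum.reindex_bij_betw[OF b, symmetric])
    then show ?thesis
      using t by (intro exI[of _ "\<lambda>j. t (b j)"]) simp
  qed
  then obtain T0 :: "(nat \<Rightarrow>\<^sub>0 nat) \<Rightarrow> nat \<Rightarrow> nat \<Rightarrow> int" where
    T0: "\<And>\<mu> i. \<mu> \<in> K \<Longrightarrow> i < D \<Longrightarrow> of_int N0 * (a \<mu> * r) * b i = (\<Sum>j<D. of_int (T0 \<mu> i j) * b j)"
    by metis
  \<comment> \<open>At \<open>\<mu>0\<close> the multiplier is \<open>N0\<close> itself. Since the
    generators may be dependent, \<open>T0\<close> need not be diagonal there, so the diagonal
    expansion is imposed.\<close>
  define T where "T = (\<lambda>\<mu> i j. if \<mu> = \<mu>0 then (if j = i then N0 else 0) else T0 \<mu> i j)"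
  have T: "of_int N0 * (a \<mu> * r) * b i = (\<Sum>j<D. of_int (T \<mu> i j) * b j)" if "\<mu> \<in> K" "i < D" for \<mu> i
  proof (cases "\<mu> = \<mu>0")
    case True
    have "(\<Sum>j<D. of_int (T \<mu> i j) * b j) = (\<Sum>j<D. if j = i then of_int N0 * b i else 0)"
      by (intro sum.cong) (auto simp: T_def True)
    then show ?thesis
      using True a0 that by (simp add: r_def)
  next
    case False
    then show ?thesis
      using T0[OF that] by (simp add: T_def)
  qed
  define A :: "nat \<Rightarrow> nat \<Rightarrow> (nat, int) mpolynomial"
    where "A = (\<lambda>i j. \<Sum>\<mu>\<in>K. Poly_Mapping.single \<mu> (T \<mu> i j))"
  have eval_A: "int_eval x (A i j) = (\<Sum>\<mu>\<in>K. of_int (T \<mu> i j) * mexp x \<mu>)" for i j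
  proof -
    have "int_eval x (sum f S) = (\<Sum>s\<in>S. int_eval x (f s))" for f :: "(nat \<Rightarrow>\<^sub>0 nat) \<Rightarrow> (nat, int) mpolynomial" and S
      by (induction S rule: infinite_finite_induct) (simp_all add: int_eval_0 int_eval_add)
    then show ?thesis
      by (simp add: A_def int_eval_single)
  qed
  have eval_p: "(\<Sum>\<mu>\<in>K. a \<mu> * mexp x \<mu>) = 0"
    using eval by (simp add: mpolynomial_eval_def mexp_def K_def a_def)
  \<comment> \<open>The matrix evaluated at x maps the vector \<open>b\<close> to
    \<open>N0 * r\<close> times p(x) times \<open>b\<close>, which is 0; and \<open>b\<close> is
    nonzero because 1 is among its entries.\<close>
  have kernel: "(\<Sum>j<D. int_eval x (A i j) * b j) = 0" if i: "i < D" for i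
  proof -
    have "(\<Sum>j<D. int_eval x (A i j) * b j) = (\<Sum>\<mu>\<in>K. mexp x \<mu> * (\<Sum>j<D. of_int (T \<mu> i j) * b j))"
      unfolding eval_A sum_distrib_left sum_distrib_right by (subst sum.swap) (simp add: mult_ac)
    also have "\<dots> = (\<Sum>\<mu>\<in>K. (of_int N0 * r * b i) * (a \<mu> * mexp x \<mu>))"
      using T[OF _ i, symmetric] by (intro sum.cong refl) simp
    also have "\<dots> = 0"
      unfolding sum_distrib_left[symmetric] eval_p by simp
    finally show ?thesis .
  qed
  have "1 \<in> b ` {..<D}"
    using b B(2) by (simp add: bij_betw_def)
  then obtain i1 where i1: "i1 < D" "b i1 = 1"
    by auto
  have "dt D (\<lambda>i j. int_eval x (A i j)) = 0"
  proof -
    define f where "f = (\<lambda>i j. int_eval x (A i j))"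
    have "0 = (\<Sum>k<D. adj D f i1 k * (\<Sum>j<D. f k j * b j))"
      using kernel by (simp add: f_def)
    also have "\<dots> = (\<Sum>j<D. (\<Sum>k<D. adj D f i1 k * f k j) * b j)"
      unfolding sum_distrib_left sum_distrib_right by (subst sum.swap) (simp add: mult.assoc)
    also have "\<dots> = (\<Sum>j<D. if j = i1 then dt D f else 0)"
      using i1 by (intro sum.cong refl) (auto simp: adj_mult)
    finally show ?thesis
      using i1(1) by (simp add: f_def)
  qed
  then have "int_eval x (dt D A) = 0"
    by (simp add: int_eval_dt)
  moreover have "dt D A \<noteq> 0"
  proof
    assume "dt D A = 0"
    then obtain c where c: "\<exists>i<D. c i \<noteq> 0" "\<And>j. j < D \<Longrightarrow> (\<Sum>i<D. c i * A i j) = 0"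
      unfolding dt_eq_0_iff_rows_dependent by blast
    define W where "W = (\<Union>i<D. Poly_Mapping.keys (c i))"
    have W: "finite W" "W \<noteq> {}"
      using c(1) by (auto simp: W_def)
    \<comment> \<open>The largest monomial in a supposed dependency \<open>c\<close>, attained in
      \<open>c j\<close>. In column \<open>j\<close> the monomial \<open>\<mu>0 + \<kappa>\<close>
      arises only from leading terms, hence only from the diagonal entry, with coefficient
      \<open>N0\<close> times a nonzero one.\<close>
    define \<kappa> where "\<kappa> = Max W"
    have \<kappa>: "\<kappa> \<in> W" "\<And>\<kappa>'. \<kappa>' \<in> W \<Longrightarrow> \<kappa>' \<le> \<kappa>"
      using W by (auto simp: \<kappa>_def)
    obtain j where j: "j < D" "\<kappa> \<in> Poly_Mapping.keys (c j)"
      using \<kappa>(1) by (auto simp: W_def)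
    have lower: "Poly_Mapping.lookup (Poly_Mapping.single \<mu> t * c i) (\<mu>0 + \<kappa>) = 0"
      if \<mu>: "\<mu> \<in> K" "\<mu> \<noteq> \<mu>0" and i: "i < D" for \<mu> i t
    proof (rule ccontr)
      assume "\<not> ?thesis"
      then have "\<mu>0 + \<kappa> \<in> Poly_Mapping.keys (Poly_Mapping.single \<mu> t * c i)"
        by (simp add: in_keys_iff)
      then obtain \<kappa>' where \<kappa>': "\<mu>0 + \<kappa> = \<mu> + \<kappa>'" "\<kappa>' \<in> Poly_Mapping.keys (c i)"
        using keys_mult[of "Poly_Mapping.single \<mu> t" "c i"] by (auto split: if_splits)
      have "\<mu> < \<mu>0"
        using \<mu>0(2)[OF \<mu>(1)] \<mu>(2) by simp
      moreover have "\<kappa>' \<le> \<kappa>"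
        using \<kappa>(2) \<kappa>'(2) i by (auto simp: W_def)
      ultimately have "\<mu> + \<kappa>' < \<mu>0 + \<kappa>"
        by (rule add_less_le_mono)
      then show False
        using \<kappa>'(1) by simp
    qed
    have entry: "Poly_Mapping.lookup (c i * A i j) (\<mu>0 + \<kappa>) = (if i = j then N0 * Poly_Mapping.lookup (c j) \<kappa> else 0)"
      if i: "i < D" for i
    proof -
      have "Poly_Mapping.lookup (c i * A i j) (\<mu>0 + \<kappa>) =
          (\<Sum>\<mu>\<in>K. Poly_Mapping.lookup (Poly_Mapping.single \<mu> (T \<mu> i j) * c i) (\<mu>0 + \<kappa>))"
        unfolding A_def sum_distrib_left lookup_sum by (simp only: mult.commute)
      also have "\<dots> = (\<Sum>\<mu>\<in>K. if \<mu> = \<mu>0 then T \<mu>0 i j * Poly_Mapping.lookup (c i) \<kappa> else 0)"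
        using lower i by (intro sum.cong refl) (auto simp: lookup_single_mult)
      also have "\<dots> = T \<mu>0 i j * Poly_Mapping.lookup (c i) \<kappa>"
        using K(1) \<mu>0(1) by simp
      finally show ?thesis
        by (auto simp: T_def)
    qed
    have "0 = (\<Sum>i<D. Poly_Mapping.lookup (c i * A i j) (\<mu>0 + \<kappa>))"
      unfolding lookup_sum[symmetric] c(2)[OF j(1)] by simp
    also have "\<dots> = (\<Sum>i<D. if i = j then N0 * Poly_Mapping.lookup (c j) \<kappa> else 0)"
      by (intro sum.cong refl) (simp add: entry)
    also have "\<dots> = N0 * Poly_Mapping.lookup (c j) \<kappa>"
      using j(1) by simp
    finally show False
      using N0 j(2) by (simp add: in_keys_iff)
  qed
  ultimately show ?thesis
    by blast
qed

section \<open>From exp (-1) back to eta 0\<close>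

lemma eta_eq_gen_val: "eta i = (if i = 0 then 1 - gen_val 0 else fact i * gen_val i)"
  by (simp add: gen_val_def eta_0)

lemma one_minus_power:
  "(1 - y) ^ n = (\<Sum>j\<le>n. of_int ((-1) ^ j * int (n choose j)) * (y::real) ^ j)"
  using binomial_ring[of "- y" 1 n] by (simp add: power_minus[of y] mult_ac)

text \<open>The substitution of 1 - exp (-1) for \<open>eta 0\<close> is triangular: it only lowers
  the exponent at 0. A monomial with the largest such exponent among those with nonzero
  \<open>c\<close> keeps its coefficient up to sign and the nonzero factor \<open>k\<close>, so the
  relation for \<open>gen_val\<close> would be nontrivial.\<close>

theorem eta_monomials_independent:
  fixes c :: "(nat \<Rightarrow> nat) \<Rightarrow> int"
  assumes rel: "(\<Sum>\<mu>\<in>exps m d. of_int (c \<mu>) * (\<Prod>i\<le>m. eta i ^ \<mu> i)) = 0" and \<mu>: "\<mu> \<in> exps m d"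
  shows "c \<mu> = 0"
proof (rule ccontr)
  assume c: "c \<mu> \<noteq> 0"
  define E where "E = exps m d"
  define k where "k = (\<lambda>\<mu> :: nat \<Rightarrow> nat. \<Prod>i=1..m. fact i ^ \<mu> i :: int)"
  define g where "g = (\<lambda>\<mu> j. c \<mu> * k \<mu> * ((-1) ^ j * int (\<mu> 0 choose j)))"
  define c' where "c' = (\<lambda>\<nu>. \<Sum>n | \<nu> 0 \<le> n \<and> \<nu>(0 := n) \<in> E. g (\<nu>(0 := n)) (\<nu> 0))"
  have split0: "(\<Prod>i\<le>m. f i) = f 0 * (\<Prod>i=1..m. f i)" for f :: "nat \<Rightarrow> real"
    by (simp add: prod.atMost_shift prod.atLeast1_atMost_eq)
  have fin: "finite E"
    by (simp add: E_def finite_exps)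
  have fin0: "finite {n. \<nu> 0 \<le> n \<and> \<nu>(0 := n) \<in> E}" for \<nu>
  proof (rule finite_subset)
    show "{n. \<nu> 0 \<le> n \<and> \<nu>(0 := n) \<in> E} \<subseteq> (\<lambda>\<mu>. \<mu> 0) ` E"
    proof
      fix n assume "n \<in> {n. \<nu> 0 \<le> n \<and> \<nu>(0 := n) \<in> E}"
      then show "n \<in> (\<lambda>\<mu>. \<mu> 0) ` E"
        by (intro image_eqI[of _ _ "\<nu>(0 := n)"]) auto
    qed
  qed (simp add: fin)
  have smaller: "\<mu>(0 := j) \<in> E" if "\<mu> \<in> E" "j \<le> \<mu> 0" for \<mu> j
  proof -
    have "(\<Sum>i\<le>m. (\<mu>(0 := j)) i) \<le> (\<Sum>i\<le>m. \<mu> i)"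
      using that by (intro sum_mono) auto
    then show ?thesis
      using that by (auto simp: E_def exps_def)
  qed
  have expand: "of_int (c \<mu>) * (\<Prod>i\<le>m. eta i ^ \<mu> i) =
      (\<Sum>j\<le>\<mu> 0. of_int (g \<mu> j) * (\<Prod>i\<le>m. gen_val i ^ (\<mu>(0 := j)) i))" for \<mu>
  proof -
    have "(\<Prod>i=1..m. eta i ^ \<mu> i) = of_int (k \<mu>) * (\<Prod>i=1..m. gen_val i ^ \<mu> i)"
      unfolding k_def of_int_prod prod.distrib[symmetric]
      by (intro prod.cong refl) (simp add: eta_eq_gen_val power_mult_distrib)
    then have "of_int (c \<mu>) * (\<Prod>i\<le>m. eta i ^ \<mu> i) =
        of_int (c \<mu>) * ((\<Sum>j\<le>\<mu> 0. of_int ((-1) ^ j * int (\<mu> 0 choose j)) * gen_val 0 ^ j) *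
          (of_int (k \<mu>) * (\<Prod>i=1..m. gen_val i ^ \<mu> i)))"
      by (simp only: split0 eta_eq_gen_val[of 0, simplified] one_minus_power)
    also have "\<dots> = (\<Sum>j\<le>\<mu> 0. of_int (g \<mu> j) * (gen_val 0 ^ j * (\<Prod>i=1..m. gen_val i ^ \<mu> i)))"
      by (simp add: g_def sum_distrib_left sum_distrib_right mult_ac)
    also have "\<dots> = (\<Sum>j\<le>\<mu> 0. of_int (g \<mu> j) * (\<Prod>i\<le>m. gen_val i ^ (\<mu>(0 := j)) i))"
      unfolding split0 by (intro sum.cong refl arg_cong2[of _ _ _ _ "(*)"] prod.cong) auto
    finally show ?thesis .
  qed
  have "0 = (\<Sum>\<mu>\<in>E. \<Sum>j\<le>\<mu> 0. of_int (g \<mu> j) * (\<Prod>i\<le>m. gen_val i ^ (\<mu>(0 := j)) i))"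
    using rel unfolding expand E_def by simp
  also have "\<dots> = (\<Sum>(\<mu>, j)\<in>(SIGMA \<mu>:E. {..\<mu> 0}). of_int (g \<mu> j) * (\<Prod>i\<le>m. gen_val i ^ (\<mu>(0 := j)) i))"
    by (rule sum.Sigma) (auto simp: fin)
  also have "\<dots> = (\<Sum>(\<nu>, n)\<in>(SIGMA \<nu>:E. {n. \<nu> 0 \<le> n \<and> \<nu>(0 := n) \<in> E}).
      of_int (g (\<nu>(0 := n)) (\<nu> 0)) * (\<Prod>i\<le>m. gen_val i ^ \<nu> i))"
    by (rule sum.reindex_bij_witness[of _ "\<lambda>(\<nu>, n). (\<nu>(0 := n), \<nu> 0)" "\<lambda>(\<mu>, j). (\<mu>(0 := j), \<mu> 0)"])
       (auto simp: smaller)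
  also have "\<dots> = (\<Sum>\<nu>\<in>E. \<Sum>n | \<nu> 0 \<le> n \<and> \<nu>(0 := n) \<in> E.
      of_int (g (\<nu>(0 := n)) (\<nu> 0)) * (\<Prod>i\<le>m. gen_val i ^ \<nu> i))"
    by (rule sum.Sigma[symmetric]) (auto simp: fin fin0)
  also have "\<dots> = (\<Sum>\<nu>\<in>E. of_int (c' \<nu>) * (\<Prod>i\<le>m. gen_val i ^ \<nu> i))"
    by (simp add: c'_def sum_distrib_right)
  finally have zero: "c' \<nu> = 0" if "\<nu> \<in> E" for \<nu>
    using gen_val_monomials_independent[of c' m d \<nu>] that unfolding E_def by simp
  define S where "S = {\<mu> \<in> E. c \<mu> \<noteq> 0}"
  have S: "finite S" "S \<noteq> {}"
    using c \<mu> fin by (auto simp: S_def E_def)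
  have "Max ((\<lambda>\<mu>. \<mu> 0) ` S) \<in> (\<lambda>\<mu>. \<mu> 0) ` S"
    using S by (intro Max_in) auto
  then obtain \<nu> where \<nu>: "\<nu> \<in> S" "Max ((\<lambda>\<mu>. \<mu> 0) ` S) = \<nu> 0"
    by auto
  have "c (\<nu>(0 := n)) = 0" if "\<nu> 0 \<le> n" "\<nu>(0 := n) \<in> E" "n \<noteq> \<nu> 0" for n
  proof (rule ccontr)
    assume "c (\<nu>(0 := n)) \<noteq> 0"
    then have "\<nu>(0 := n) \<in> S"
      using that by (simp add: S_def)
    then have "n \<in> (\<lambda>\<mu>. \<mu> 0) ` S"
      by (intro image_eqI[of _ _ "\<nu>(0 := n)"]) auto
    then have "n \<le> Max ((\<lambda>\<mu>. \<mu> 0) ` S)"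
      using S(1) by (intro Max_ge) auto
    then show False
      using that \<nu>(2) by simp
  qed
  then have "c' \<nu> = (\<Sum>n | \<nu> 0 \<le> n \<and> \<nu>(0 := n) \<in> E. if n = \<nu> 0 then g \<nu> (\<nu> 0) else 0)"
    unfolding c'_def by (intro sum.cong refl) (auto simp: g_def fun_upd_idem)
  also have "\<dots> = g \<nu> (\<nu> 0)"
    using fin0[of \<nu>] \<nu>(1) by (simp add: S_def)
  finally have "c \<nu> * k \<nu> = 0"
    using zero[of \<nu>] \<nu>(1) by (simp add: g_def S_def)
  then show False
    using \<nu>(1) by (simp add: S_def k_def)
qed

text \<open>A single polynomial fits into one set \<open>exps m d\<close>, with \<open>m\<close>
  bounding its variables and \<open>d\<close> its total degrees; as the \<open>eta\<close> are real,
  the complex relation is a real one.\<close>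

lemma eta_int_eval_nonzero:
  fixes q :: "(nat, int) mpolynomial"
  assumes "int_eval (\<lambda>n. complex_of_real (eta n)) q = 0"
  shows "q = 0"
proof (rule ccontr)
  assume "q \<noteq> 0"
  then have "Poly_Mapping.keys q \<noteq> {}"
    by simp
  then obtain \<mu>1 where \<mu>1: "\<mu>1 \<in> Poly_Mapping.keys q"
    by blast
  define V where "V = mpolynomial_vars q"
  have "finite V"
    by (simp add: V_def mpolynomial_vars_def)
  then obtain m where m: "V \<subseteq> {..m}"
    using finite_nat_iff_bounded_le by blast
  define L where "L = (\<lambda>\<mu> :: nat \<Rightarrow>\<^sub>0 nat. Poly_Mapping.lookup \<mu>)"
  define d where "d = Max ((\<lambda>\<mu>. \<Sum>i\<le>m. L \<mu> i) ` Poly_Mapping.keys q)"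
  define S where "S = L ` Poly_Mapping.keys q"
  have inj: "inj L"
    unfolding L_def by (rule injI) (rule poly_mapping_eq_iff[THEN iffD2])
  have S: "S \<subseteq> exps m d"
  proof
    fix \<mu>' assume "\<mu>' \<in> S"
    then obtain \<mu> where \<mu>: "\<mu> \<in> Poly_Mapping.keys q" "\<mu>' = L \<mu>"
      by (auto simp: S_def)
    have "(\<Sum>i\<le>m. L \<mu> i) \<le> d"
      unfolding d_def using \<mu> by (intro Max_ge) auto
    moreover have "L \<mu> i = 0" if "i > m" for i
    proof -
      have "i \<notin> V"
        using m that by auto
      then have "i \<notin> Poly_Mapping.keys \<mu>"
        using \<mu>(1) by (auto simp: V_def mpolynomial_vars_def)
      then show ?thesis
        by (simp add: L_def in_keys_iff)
    qed
    ultimately show "\<mu>' \<in> exps m d"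
      using \<mu>(2) by (simp add: exps_def)
  qed
  define c where "c = (\<lambda>\<mu>'. if \<mu>' \<in> S then Poly_Mapping.lookup q (inv_into UNIV L \<mu>') else 0)"
  have c_L: "c (L \<mu>) = Poly_Mapping.lookup q \<mu>" if "\<mu> \<in> Poly_Mapping.keys q" for \<mu>
    unfolding c_def S_def inv_f_f[OF inj] using that by (simp only: imageI if_True)
  have mexp: "mexp (\<lambda>n. complex_of_real (eta n)) \<mu> = of_real (\<Prod>i\<le>m. eta i ^ L \<mu> i)"
    if "\<mu> \<in> Poly_Mapping.keys q" for \<mu>
  proof -
    have keys: "Poly_Mapping.keys \<mu> \<subseteq> {..m}"
      using m that by (auto simp: V_def mpolynomial_vars_def)
    show ?thesis
      unfolding mexp_superset[OF finite_atMost keys] L_def by simp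
  qed
  have "(\<Sum>\<mu>\<in>exps m d. of_int (c \<mu>) * (\<Prod>i\<le>m. eta i ^ \<mu> i)) = (\<Sum>\<mu>\<in>S. of_int (c \<mu>) * (\<Prod>i\<le>m. eta i ^ \<mu> i))"
    using S by (intro sum.mono_neutral_right finite_exps) (auto simp: c_def)
  also have "\<dots> = (\<Sum>\<mu>\<in>Poly_Mapping.keys q. of_int (c (L \<mu>)) * (\<Prod>i\<le>m. eta i ^ L \<mu> i))"
    unfolding S_def sum.reindex[OF inj_on_subset[OF inj subset_UNIV]] by (simp only: o_def)
  also have "\<dots> = (\<Sum>\<mu>\<in>Poly_Mapping.keys q. of_int (Poly_Mapping.lookup q \<mu>) * (\<Prod>i\<le>m. eta i ^ L \<mu> i))"
    by (intro sum.cong refl) (simp add: c_L)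
  finally have eq: "(\<Sum>\<mu>\<in>exps m d. of_int (c \<mu>) * (\<Prod>i\<le>m. eta i ^ \<mu> i)) =
      (\<Sum>\<mu>\<in>Poly_Mapping.keys q. of_int (Poly_Mapping.lookup q \<mu>) * (\<Prod>i\<le>m. eta i ^ L \<mu> i))" .
  have "complex_of_real (\<Sum>\<mu>\<in>exps m d. of_int (c \<mu>) * (\<Prod>i\<le>m. eta i ^ \<mu> i)) =
      int_eval (\<lambda>n. complex_of_real (eta n)) q"
    unfolding eq int_eval_def of_real_sum by (intro sum.cong refl) (simp add: mexp)
  then have "(\<Sum>\<mu>\<in>exps m d. of_int (c \<mu>) * (\<Prod>i\<le>m. eta i ^ \<mu> i)) = 0"
    using assms by (simp only: of_real_eq_0_iff)
  moreover have "L \<mu>1 \<in> exps m d"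
    using S \<mu>1 unfolding S_def by blast
  ultimately have "c (L \<mu>1) = 0"
    by (rule eta_monomials_independent)
  then show False
    using c_L[OF \<mu>1] \<mu>1 by (simp add: in_keys_iff)
qed

theorem theorem1:
  "algebraically_independent_over algebraic_numbers (\<lambda>n. complex_of_real (eta n)) UNIV \<and>
   (\<forall>n. complex_of_real (eta n) \<in> \<real> - algebraic_numbers)"
proof
  show indep: "algebraically_independent_over algebraic_numbers (\<lambda>n. complex_of_real (eta n)) UNIV"
    unfolding algebraically_independent_over_def
  proof (intro allI impI)
    fix p :: "(nat, complex) mpolynomial"
    assume p: "\<forall>m. Poly_Mapping.lookup p m \<in> algebraic_numbers"
      "mpolynomial_eval (\<lambda>n. complex_of_real (eta n)) p = 0"
    show "p = 0"
    proof (rule ccontr)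
      assume "p \<noteq> 0"
      with p obtain q :: "(nat, int) mpolynomial"
        where "q \<noteq> 0" "int_eval (\<lambda>n. complex_of_real (eta n)) q = 0"
        using integer_relation_of_algebraic_relation[of p] by (auto simp: algebraic_numbers_def)
      then show False
        using eta_int_eval_nonzero by blast
    qed
  qed
  show "\<forall>n. complex_of_real (eta n) \<in> \<real> - algebraic_numbers"
  proof (intro allI DiffI notI)
    fix n
    show "complex_of_real (eta n) \<in> \<real>"
      by simp
    assume alg: "complex_of_real (eta n) \<in> algebraic_numbers"
    define X :: "nat \<Rightarrow>\<^sub>0 nat" where "X = Poly_Mapping.single n 1"
    \<comment> \<open>If \<open>eta n\<close> were algebraic, the polynomial X_n -
      \<open>eta n\<close> would be a nontrivial relation with algebraic coefficients.\<close>
    define p :: "(nat, complex) mpolynomial"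
      where "p = Poly_Mapping.single X 1 - Poly_Mapping.single 0 (of_real (eta n))"
    have X: "X \<noteq> 0"
      unfolding X_def by (metis lookup_single_eq lookup_zero zero_neq_one)
    have lookup_p: "Poly_Mapping.lookup p \<mu> = (if \<mu> = X then 1 else if \<mu> = 0 then - of_real (eta n) else 0)" for \<mu>
      using X by (auto simp: p_def lookup_minus lookup_single when_def)
    have "Poly_Mapping.lookup p \<mu> \<in> algebraic_numbers" for \<mu>
      using alg by (simp add: lookup_p algebraic_numbers_def)
    moreover have "mpolynomial_eval (\<lambda>n. complex_of_real (eta n)) p = 0"
    proof -
      have "mpolynomial_eval (\<lambda>n. complex_of_real (eta n)) p =
          (\<Sum>\<mu>\<in>{X, 0}. Poly_Mapping.lookup p \<mu> * mexp (\<lambda>n. complex_of_real (eta n)) \<mu>)"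
        unfolding mpolynomial_eval_def mexp_def[symmetric]
        by (intro sum.mono_neutral_left) (auto simp: in_keys_iff lookup_p split: if_splits)
      also have "\<dots> = 0"
        using X by (simp add: lookup_p mexp_def) (simp add: X_def)
      finally show ?thesis .
    qed
    ultimately have "p = 0"
      using indep unfolding algebraically_independent_over_def by blast
    then show False
      using lookup_p[of X] by simp
  qed
qed

end
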